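(* Let $\eta\in\mathbb N^n$, let $L$ be a subset of $\{1,\ldots,n\}$ that is maximal with respect to $\eta$, put $\lambda=c_L(\eta)$, and let $1\le k\le n$. Let $g_{k\eta}^\mu\in\mathbb Q(\alpha)$ be the coefficients defined by $F_{\varepsilon_k}F_\eta=\sum_\mu g_{k\eta}^\mu F_\mu^*$. Then $$g_{k\eta}^\lambda=\mathbf 1_{\{k\in L\}}(\alpha+k)\,b_{\eta\lambda}^{(k)}+\sum_{\substack{i\in L\\ i>k}}b_{\eta\lambda}^{(i)}.$$ As $L$ ranges over the maximal subsets with respect to $\eta$, this formula gives all coefficients $g_{k\eta}^\mu$ whose target $\mu$ is of the form $c_L(\eta)$; and $g_{k\eta}^\mu=0$ for every $\mu\in\mathbb N^n$ that is not of the form $c_L(\eta)$ with $L$ maximal with respect to $\eta$.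
   Context: Throughout $\mathbb N=\{0,1,2,\ldots\}$, $n\ge1$, $\alpha$ is an indeterminate, and polynomials lie in $\mathbb Q(\alpha)[x_1,\ldots,x_n]$. Elements $\gamma=(\gamma_1,\ldots,\gamma_n)\in\mathbb N^n$ are called compositions; $\varepsilon_k$ is the $k$-th standard basis vector. Operator $c_L$ and maximality: for a nonempty $L=\{j_1<\cdots<j_\ell\}\subseteq\{1,\ldots,n\}$, $c_L(\eta)=\lambda$ is defined by $\lambda_{j_p}=\eta_{j_{p+1}}$ for $p<\ell$, $\lambda_{j_\ell}=\eta_{j_1}+1$, and $\lambda_i=\eta_i$ for $i\notin L$. The nonempty set $L$ is maximal with respect to $\eta$ if (M1) $\eta_i\ne\eta_{j_1}$ for $i<j_1$; (M2) $\eta_i\ne\eta_{j_p}$ for $j_{p-1}<i<j_p$, $1<p\le\ell$; (M3) $\eta_i\ne\eta_{j_1}+1$ for $j_\ell<i\le n$. Distinct maximal subsets have distinct images $c_L(\eta)$, so $\lambda$ determines $L$. Nonsymmetric Jack polynomials: put $l'_\gamma(i)=\#\{h<i:\gamma_h\ge\gamma_i\}+\#\{h>i:\gamma_h>\gamma_i\}$ and $\overline\gamma_i=\alpha\gamma_i-l'_\gamma(i)$. The Cherednik operators are $\xi_i=\alpha x_i\partial_i+\sum_{j<i}N_{ij}x_j+\sum_{j>i}x_jN_{ij}$, where $N_{ij}=\frac{1-s_{ij}}{x_i-x_j}$, $s_{ij}$ exchanges the variables $x_i$ and $x_j$, and $x_j$ denotes multiplication by $x_j$ (so $N_{ij}x_j$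 is $f\mapsto N_{ij}(x_jf)$). The monic nonsymmetric Jack polynomial $E_\gamma$ is the unique polynomial with $\xi_iE_\gamma=\overline\gamma_iE_\gamma$ for all $i$ and coefficient of $x^\gamma$ equal to $1$ (its existence and uniqueness, and the fact that the $E_\gamma$ form a basis, are known). Hooks: the diagram of $\gamma$ is the set of boxes $s=(i,j)$ with $1\le i\le n$, $1\le j\le\gamma_i$. Put $a_\gamma(s)=\gamma_i-j$, $l_\gamma(s)=\#\{h<i:j\le\gamma_h+1\le\gamma_i\}+\#\{h>i:j\le\gamma_h\le\gamma_i\}$; the upper hook is $d_\gamma(s)=\alpha(a_\gamma(s)+1)+l_\gamma(s)+1$, the lower hook is $d'_\gamma(s)=d_\gamma(s)-1$; $d_\gamma=\prod_{s\in\gamma}d_\gamma(s)$, $d'_\gamma=\prod_{s\in\gamma}d'_\gamma(s)$. The integral nonsymmetric Jack polynomial is $F_\gamma=d_\gamma E_\gamma$, and $F_\gamma^*=(d_\gamma d'_\gamma)^{-1}F_\gamma$ (the basis dual to $\{F_\gamma\}$ under Sahi's scalar product, for which the $F_\gamma$ are orthogonal with $\langle F_\gamma,F_\gamma\rangle=d_\gamma d'_\gamma$). Jeu de flèches: let $L$ be maximal with respect to $\eta$ and $\lambda=c_L(\eta)$. Fill the diagrams of $\eta$ (source) and $\lambda$ (target): for $i\in L$, each source box $(i,j)$ receives $d_\eta(i,j)$ and each target box $(i,j)$ receives $d'_\lambda(i,j)$; for $i\notin L$, each source box $(i,j)$ receives $d'_\eta(i,j)$ and each target box $(i,j)$ receives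 $d_\lambda(i,j)$. Then arrows make the following replacements in rows $i\in L$: if $\eta_i>\lambda_i$, the source entry in box $(i,\lambda_i+1)$ is replaced by $1$; if $\eta_i<\lambda_i$, the target entry in box $(i,\eta_i+1)$ is replaced by $-1$; if $\eta_i=\lambda_i$, nothing is replaced in row $i$. The product of all resulting entries of both diagrams is $b_{\eta\lambda}$. For $1\le k\le n$, $b_{\eta\lambda}^{(k)}$ is the product obtained in the same way except that any replacement in row $k$ (source or target) is suppressed (so $b_{\eta\lambda}^{(k)}=b_{\eta\lambda}$ if $k\notin L$). *)

theory Defs
  imports
    "HOL-Library.Poly_Mapping"
    "HOL-Computational_Algebra.Polynomial_Factorial"
    "HOL-Combinatorics.Transposition"
begin

text \<open>
  The field \<open>Q(\<alpha>)\<close> is the fraction field of \<open>Q[\<alpha>]\<close>.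
  A polynomial in the variables \<open>x\<^sub>1, x\<^sub>2, \<dots>\<close> is a finitely supported map from exponent
  vectors to coefficients; multiplication is the convolution product of \<open>Poly_Mapping\<close>.
  Variables are indexed by positive naturals, as in \<open>x\<^sub>1, \<dots>, x\<^sub>n\<close>, and the ring
  in \<open>n\<close> variables is the subset \<open>polys n\<close>.
\<close>

abbreviation "lookup \<equiv> Poly_Mapping.lookup"
abbreviation "keys \<equiv> Poly_Mapping.keys"
abbreviation "single \<equiv> Poly_Mapping.single"
abbreviation "map_key \<equiv> Poly_Mapping.map_key"

type_synonym qalpha = "rat poly fract"
type_synonym expvec = "nat \<Rightarrow>\<^sub>0 nat"
type_synonym mpol = "expvec \<Rightarrow>\<^sub>0 qalpha"

definition alpha :: qalpha where
  "alpha = Fract [:0, 1:] 1"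

definition compositions :: "nat \<Rightarrow> expvec set" where
  "compositions n = {\<gamma>. keys \<gamma> \<subseteq> {1..n}}"

definition polys :: "nat \<Rightarrow> mpol set" where
  "polys n = {f. keys f \<subseteq> compositions n}"

definition Const :: "qalpha \<Rightarrow> mpol" where
  "Const c = single 0 c"

definition eps :: "nat \<Rightarrow> expvec" where
  "eps k = single k 1"

definition Var :: "nat \<Rightarrow> mpol" where
  "Var i = single (eps i) 1"

definition partial :: "nat \<Rightarrow> mpol \<Rightarrow> mpol" where
  "partial i f =
     (\<Sum>m\<in>keys f. single (m - eps i) (of_nat (lookup m i) * lookup f m))"

definition swap_vars :: "nat \<Rightarrow> nat \<Rightarrow> mpol \<Rightarrow> mpol" where
  "swap_vars i j f =
     (\<Sum>m\<in>keys f. single (map_key (transpose i j) m) (lookup f m))"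

text \<open>
  For \<open>i \<noteq> j\<close> the quotient \<open>(f - s\<^sub>i\<^sub>j f) / (x\<^sub>i - x\<^sub>j)\<close> is the unique
  polynomial whose product with \<open>x\<^sub>i - x\<^sub>j\<close> is \<open>f - s\<^sub>i\<^sub>j f\<close>; the polynomials form an
  integral domain.
\<close>

definition Nop :: "nat \<Rightarrow> nat \<Rightarrow> mpol \<Rightarrow> mpol" where
  "Nop i j f = (THE g. (Var i - Var j) * g = f - swap_vars i j f)"

definition cherednik :: "nat \<Rightarrow> nat \<Rightarrow> mpol \<Rightarrow> mpol" where
  "cherednik n i f =
     Const alpha * (Var i * partial i f)
     + (\<Sum>j\<in>{1..<i}. Nop i j (Var j * f))
     + (\<Sum>j\<in>{i<..n}. Var j * Nop i j f)"

definition leg' :: "nat \<Rightarrow> expvec \<Rightarrow> nat \<Rightarrow> nat" where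
  "leg' n \<gamma> i =
     card {h \<in> {1..n}. h < i \<and> lookup \<gamma> h \<ge> lookup \<gamma> i}
     + card {h \<in> {1..n}. h > i \<and> lookup \<gamma> h > lookup \<gamma> i}"

definition spectral :: "nat \<Rightarrow> expvec \<Rightarrow> nat \<Rightarrow> qalpha" where
  "spectral n \<gamma> i = alpha * of_nat (lookup \<gamma> i) - of_nat (leg' n \<gamma> i)"

definition jackE :: "nat \<Rightarrow> expvec \<Rightarrow> mpol" where
  "jackE n \<gamma> =
     (THE f. f \<in> polys n
        \<and> (\<forall>i\<in>{1..n}. cherednik n i f = Const (spectral n \<gamma> i) * f)
        \<and> lookup f \<gamma> = 1)"

definition diagram :: "nat \<Rightarrow> expvec \<Rightarrow> (nat \<times> nat) set" where
  "diagram n \<gamma> = (SIGMA i:{1..n}. {1..lookup \<gamma> i})"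

definition arm :: "expvec \<Rightarrow> nat \<times> nat \<Rightarrow> nat" where
  "arm \<gamma> = (\<lambda>(i, j). lookup \<gamma> i - j)"

definition leg :: "nat \<Rightarrow> expvec \<Rightarrow> nat \<times> nat \<Rightarrow> nat" where
  "leg n \<gamma> = (\<lambda>(i, j).
     card {h \<in> {1..n}. h < i \<and> j \<le> lookup \<gamma> h + 1 \<and> lookup \<gamma> h + 1 \<le> lookup \<gamma> i}
     + card {h \<in> {1..n}. h > i \<and> j \<le> lookup \<gamma> h \<and> lookup \<gamma> h \<le> lookup \<gamma> i})"

definition upper_hook :: "nat \<Rightarrow> expvec \<Rightarrow> nat \<times> nat \<Rightarrow> qalpha" where
  "upper_hook n \<gamma> s = alpha * (of_nat (arm \<gamma> s) + 1) + of_nat (leg n \<gamma> s) + 1"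

definition lower_hook :: "nat \<Rightarrow> expvec \<Rightarrow> nat \<times> nat \<Rightarrow> qalpha" where
  "lower_hook n \<gamma> s = upper_hook n \<gamma> s - 1"

definition upper_hooks :: "nat \<Rightarrow> expvec \<Rightarrow> qalpha" where
  "upper_hooks n \<gamma> = (\<Prod>s\<in>diagram n \<gamma>. upper_hook n \<gamma> s)"

definition lower_hooks :: "nat \<Rightarrow> expvec \<Rightarrow> qalpha" where
  "lower_hooks n \<gamma> = (\<Prod>s\<in>diagram n \<gamma>. lower_hook n \<gamma> s)"

definition jackF :: "nat \<Rightarrow> expvec \<Rightarrow> mpol" where
  "jackF n \<gamma> = Const (upper_hooks n \<gamma>) * jackE n \<gamma>"

definition jackF_dual :: "nat \<Rightarrow> expvec \<Rightarrow> mpol" where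
  "jackF_dual n \<gamma> = Const (inverse (upper_hooks n \<gamma> * lower_hooks n \<gamma>)) * jackF n \<gamma>"

text \<open>\<open>lookup (pieri_coeff n k \<eta>) \<mu>\<close> is \<open>g\<^sub>k\<^sub>\<eta>\<^sup>\<mu>\<close>.\<close>

definition pieri_coeff :: "nat \<Rightarrow> nat \<Rightarrow> expvec \<Rightarrow> (expvec \<Rightarrow>\<^sub>0 qalpha)" where
  "pieri_coeff n k \<eta> =
     (THE g. keys g \<subseteq> compositions n
        \<and> jackF n (eps k) * jackF n \<eta> = (\<Sum>\<mu>\<in>keys g. Const (lookup g \<mu>) * jackF_dual n \<mu>))"

text \<open>\<open>elt L p\<close> is \<open>j\<^sub>p\<close> for \<open>L = {j\<^sub>1 < \<dots> < j\<^sub>\<ell>}\<close>, where \<open>1 \<le> p \<le> \<ell> = card L\<close>.\<close>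

definition elt :: "nat set \<Rightarrow> nat \<Rightarrow> nat" where
  "elt L p = sorted_list_of_set L ! (p - 1)"

definition cop :: "nat set \<Rightarrow> expvec \<Rightarrow> expvec" where
  "cop L \<eta> =
     (\<Sum>i\<in>keys \<eta> - L. single i (lookup \<eta> i))
     + (\<Sum>p\<in>{1..<card L}. single (elt L p) (lookup \<eta> (elt L (p + 1))))
     + single (elt L (card L)) (lookup \<eta> (elt L 1) + 1)"

definition maximal_set :: "nat \<Rightarrow> expvec \<Rightarrow> nat set \<Rightarrow> bool" where
  "maximal_set n \<eta> L \<longleftrightarrow>
     L \<noteq> {} \<and> L \<subseteq> {1..n}
     \<and> (\<forall>i\<in>{1..n}. i < elt L 1 \<longrightarrow> lookup \<eta> i \<noteq> lookup \<eta> (elt L 1))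
     \<and> (\<forall>p. 1 < p \<and> p \<le> card L \<longrightarrow>
          (\<forall>i. elt L (p - 1) < i \<and> i < elt L p \<longrightarrow> lookup \<eta> i \<noteq> lookup \<eta> (elt L p)))
     \<and> (\<forall>i. elt L (card L) < i \<and> i \<le> n \<longrightarrow> lookup \<eta> i \<noteq> lookup \<eta> (elt L 1) + 1)"

lemma elt_bij:
  assumes "finite L"
  shows "bij_betw (elt L) {1..card L} L"
proof -
  have "bij_betw ((!) (sorted_list_of_set L)) {..<card L} L"
    using assms by (intro bij_betw_nth) simp_all
  moreover have "bij_betw (\<lambda>p. p - 1) {1..card L} {..<card L}"
    by (rule bij_betw_byWitness[where f' = Suc]) auto
  ultimately have "bij_betw ((!) (sorted_list_of_set L) \<circ> (\<lambda>p. p - 1)) {1..card L} L"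
    by (rule bij_betw_trans[rotated])
  then show ?thesis
    by (simp add: elt_def[abs_def] comp_def)
qed

lemma lookup_cop_outside:
  assumes "finite L" "L \<noteq> {}" "i \<notin> L"
  shows "lookup (cop L \<eta>) i = lookup \<eta> i"
proof -
  have ne: "elt L p \<noteq> i" if "1 \<le> p" "p \<le> card L" for p
    using bij_betwE[OF elt_bij[OF assms(1)]] that assms(3) by (metis atLeastAtMost_iff)
  have c: "1 \<le> card L"
    using assms(1,2) by (simp add: Suc_le_eq card_gt_0_iff)
  have 1: "(\<Sum>p\<in>{1..<card L}. lookup (single (elt L p) (lookup \<eta> (elt L (p + 1)))) i) = 0"
  proof (rule sum.neutral, rule ballI)
    fix p assume "p \<in> {1..<card L}"
    then have "elt L p \<noteq> i" using ne by simp
    then show "lookup (single (elt L p) (lookup \<eta> (elt L (p + 1)))) i = 0"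
      by (rule lookup_single_not_eq)
  qed
  have 2: "lookup (single (elt L (card L)) (lookup \<eta> (elt L 1) + 1)) i = 0"
    using ne[OF c order.refl] by (rule lookup_single_not_eq)
  have "(\<Sum>h\<in>keys \<eta> - L. lookup (single h (lookup \<eta> h)) i)
      = (\<Sum>h\<in>keys \<eta> - L. if h = i then lookup \<eta> h else 0)"
    by (rule sum.cong) (simp_all add: lookup_single when_def)
  also have "\<dots> = lookup \<eta> i"
    using assms(3) by (simp add: sum.delta' in_keys_iff)
  finally show ?thesis
    unfolding cop_def lookup_add lookup_sum 1 2 by (simp del: One_nat_def)
qed

lemma lookup_cop_inside:
  assumes "finite L" "1 \<le> p" "p \<le> card L"
  shows "lookup (cop L \<eta>) (elt L p) =
    (if p < card L then lookup \<eta> (elt L (p + 1)) else lookup \<eta> (elt L 1) + 1)"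
proof -
  have mem: "elt L p \<in> L"
    using bij_betwE[OF elt_bij[OF assms(1)]] assms(2,3) by (metis atLeastAtMost_iff)
  have inj: "elt L q = elt L p \<longleftrightarrow> q = p" if "1 \<le> q" "q \<le> card L" for q
    using inj_on_eq_iff[OF bij_betw_imp_inj_on[OF elt_bij[OF assms(1)]]] that assms(2,3)
    by (metis atLeastAtMost_iff)
  have "(\<Sum>q\<in>{1..<card L}. lookup (single (elt L q) (lookup \<eta> (elt L (q + 1)))) (elt L p))
      = (\<Sum>q\<in>{1..<card L}. if q = p then lookup \<eta> (elt L (q + 1)) else 0)"
  proof (rule sum.cong[OF refl])
    fix q assume "q \<in> {1..<card L}"
    then have "elt L q = elt L p \<longleftrightarrow> q = p" using inj by simp
    then show "lookup (single (elt L q) (lookup \<eta> (elt L (q + 1)))) (elt L p)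
        = (if q = p then lookup \<eta> (elt L (q + 1)) else 0)"
      by (metis lookup_single_eq lookup_single_not_eq)
  qed
  also have "\<dots> = (if p < card L then lookup \<eta> (elt L (p + 1)) else 0)"
    using assms(2) by (subst sum.delta) (simp_all only: finite_atLeastLessThan atLeastLessThan_iff, simp)
  finally have 1: "(\<Sum>q\<in>{1..<card L}. lookup (single (elt L q) (lookup \<eta> (elt L (q + 1)))) (elt L p))
      = (if p < card L then lookup \<eta> (elt L (p + 1)) else 0)" .
  have 2: "(\<Sum>h\<in>keys \<eta> - L. lookup (single h (lookup \<eta> h)) (elt L p)) = 0"
  proof (rule sum.neutral, rule ballI)
    fix h assume "h \<in> keys \<eta> - L"
    then have "h \<noteq> elt L p" using mem by blast
    then show "lookup (single h (lookup \<eta> h)) (elt L p) = 0"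
      by (rule lookup_single_not_eq)
  qed
  have "1 \<le> card L"
    using assms(2,3) by simp
  then have 3: "lookup (single (elt L (card L)) (lookup \<eta> (elt L 1) + 1)) (elt L p)
      = (if p < card L then 0 else lookup \<eta> (elt L 1) + 1)"
    using inj[of "card L"] assms(3)
    by (metis lookup_single_eq lookup_single_not_eq nat_less_le order.refl)
  show ?thesis
    unfolding cop_def lookup_add lookup_sum 1 2 3 by (cases "p < card L") simp_all
qed

text \<open>
  The set \<open>K\<close> holds the rows in which replacements are suppressed: \<open>jeu n \<eta> L {}\<close> is
  \<open>b\<^sub>\<eta>\<^sub>\<lambda>\<close>, and \<open>jeu n \<eta> L {k}\<close> is \<open>b\<^sub>\<eta>\<^sub>\<lambda>\<^sup>(\<^sup>k\<^sup>)\<close>, where \<open>\<lambda> = c\<^sub>L(\<eta>)\<close>.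
\<close>

definition source_entry :: "nat \<Rightarrow> expvec \<Rightarrow> nat set \<Rightarrow> nat set \<Rightarrow> nat \<times> nat \<Rightarrow> qalpha" where
  "source_entry n \<eta> L K = (\<lambda>(i, j).
     if i \<in> L then
       (if i \<notin> K \<and> lookup \<eta> i > lookup (cop L \<eta>) i \<and> j = lookup (cop L \<eta>) i + 1
        then 1 else upper_hook n \<eta> (i, j))
     else lower_hook n \<eta> (i, j))"

definition target_entry :: "nat \<Rightarrow> expvec \<Rightarrow> nat set \<Rightarrow> nat set \<Rightarrow> nat \<times> nat \<Rightarrow> qalpha" where
  "target_entry n \<eta> L K = (\<lambda>(i, j).
     if i \<in> L then
       (if i \<notin> K \<and> lookup \<eta> i < lookup (cop L \<eta>) i \<and> j = lookup \<eta> i + 1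
        then - 1 else lower_hook n (cop L \<eta>) (i, j))
     else upper_hook n (cop L \<eta>) (i, j))"

definition jeu :: "nat \<Rightarrow> expvec \<Rightarrow> nat set \<Rightarrow> nat set \<Rightarrow> qalpha" where
  "jeu n \<eta> L K =
     (\<Prod>s\<in>diagram n \<eta>. source_entry n \<eta> L K s)
     * (\<Prod>s\<in>diagram n (cop L \<eta>). target_entry n \<eta> L K s)"

definition jeu_except :: "nat \<Rightarrow> expvec \<Rightarrow> nat set \<Rightarrow> nat \<Rightarrow> qalpha" where
  "jeu_except n \<eta> L k = jeu n \<eta> L {k}"

end

theory Submission
  imports Defs
begin

text \<open>
  Let \<open>\<Phi> f = x\<^sub>n f(x\<^sub>n, x\<^sub>1, \<dots>, x\<^sub>n\<^sub>-\<^sub>1)\<close>. Then multiplication by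
  \<open>x\<^sub>i\<close> factors as \<open>s\<^sub>i \<cdots> s\<^sub>n\<^sub>-\<^sub>1 \<Phi> s\<^sub>1 \<cdots> s\<^sub>i\<^sub>-\<^sub>1\<close>. The intertwiner
  \<open>\<Phi>\<close> maps each \<open>E\<^sub>\<gamma>\<close> to some \<open>E\<^sub>\<gamma>\<^sub>'\<close>, and \<open>s\<^sub>r E\<^sub>\<gamma>\<close> is a combination of \<open>E\<^sub>\<gamma>\<close>
  (the travelling entry stops at \<open>r\<close> and is exchanged for the entry found there) and of the
  Jack polynomial of the swapped composition (the travelling entry passes \<open>r\<close>).
  The set of rows where the travelling entry stops, together with \<open>i\<close>, is \<open>L\<close>; the result is \<open>c\<^sub>L(\<eta>)\<close>, and the path survives exactly
  when no row equals the entry that passes it, i.e. when \<open>L\<close> is maximal. The coefficient of a stop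
  is the inverse of a difference of spectral values, which up to sign is the hook replaced by an arrow; the
  coefficient of a pass is the ratio of hooks in a row outside \<open>L\<close>. Finally
  \<open>F\<close> at \<open>\<epsilon>\<^sub>k\<close> equals \<open>(\<alpha> + k) x\<^sub>k + (\<Sum>i>k. x\<^sub>i)\<close>.

  Existence of the \<open>E\<^sub>\<gamma>\<close> comes from the same intertwiners, uniqueness and linear independence from
  triangularity of the Cherednik operators with respect to the weight
  \<open>\<Sum>r. n \<gamma>\<^sub>r\<^sup>2 + (n - r) \<gamma>\<^sub>r\<close>.
\<close>

section \<open>Polynomials and the action of permutations\<close>

text \<open>The index i only records where the journey begins: after reaching row 1 the travelling
  entry re-enters at row n, increased by one if it is the last to arrive there, and comes back to
  row i. All values met on the way depend on L alone, so the paths for different i in L differ only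
  in the row whose factor is missing; this omission is the suppressed replacement. The obstacle is
  to write all factors with spectral values of \<eta> itself. Exchanging unequal neighbours permutes
  the spectral vector, exchanging equal ones does not. In the latter case the factor is zero, so
  spectral vectors of intermediate compositions are claimed only while the coefficient is nonzero.
  Hooks enter because the dual element at \<mu> is E at \<mu> divided by the lower hooks: a
  coefficient is the upper hooks of \<eta> times the row factors times the lower hooks of the
  target. In a row outside L passed by a smaller entry, one box changes its leg, by one, and (d -
  1)(d + 1) = d^2 (1 - d^(-2)) turns the pass factor into the interchange of upper and lower
  hooks.\<close>

lemma lookup_Const_mult: "lookup (Const c * f) m = c * lookup f m"
  unfolding Const_def mult_map_scale_conv_mult[symmetric]
  by (simp add: map.rep_eq when_def)

lemma Const_add: "Const (a + b) = Const a + Const b"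
  by (simp add: Const_def single_add)

lemma Const_mult: "Const (a * b) = Const a * Const b"
  by (simp add: Const_def mult_single)

lemma Const_diff: "Const (a - b) = Const a - Const b"
  by (simp add: Const_def single_diff)

lemma Const_uminus: "Const (- a) = - Const a"
  by (simp add: Const_def single_uminus)

lemma Const_0 [simp]: "Const 0 = 0"
  by (simp add: Const_def)

lemma Const_1 [simp]: "Const 1 = 1"
  by (simp add: Const_def)

lemma Const_sum: "Const (sum f A) = (\<Sum>x\<in>A. Const (f x))"
  by (induction A rule: infinite_finite_induct) (simp_all add: Const_add)

lemma Const_mult_single: "Const a * single m b = single m (a * b)"
  by (simp add: Const_def mult_single)

lemma sum_single_lookup: "(\<Sum>m\<in>keys f. single m (lookup f m)) = f"
proof (rule poly_mapping_eqI)
  fix k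
  have "lookup (\<Sum>m\<in>keys f. single m (lookup f m)) k = (\<Sum>m\<in>keys f. if m = k then lookup f m else 0)"
    by (simp add: lookup_sum lookup_single when_def)
  also have "\<dots> = lookup f k"
    by (simp add: sum.delta' in_keys_iff)
  finally show "lookup (\<Sum>m\<in>keys f. single m (lookup f m)) k = lookup f k" .
qed

definition linear_op :: "(mpol \<Rightarrow> mpol) \<Rightarrow> bool" where
  "linear_op T \<longleftrightarrow> (\<forall>f g. T (f + g) = T f + T g) \<and> (\<forall>c f. T (Const c * f) = Const c * T f)"

lemma linear_opI:
  assumes "\<And>f g. T (f + g) = T f + T g" "\<And>c f. T (Const c * f) = Const c * T f"
  shows "linear_op T"
  using assms by (simp add: linear_op_def)

lemma linear_op_add: "linear_op T \<Longrightarrow> T (f + g) = T f + T g"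
  by (simp add: linear_op_def)

lemma linear_op_scale: "linear_op T \<Longrightarrow> T (Const c * f) = Const c * T f"
  by (simp add: linear_op_def)

lemma linear_op_0: "linear_op T \<Longrightarrow> T 0 = 0"
  using linear_op_scale[of T 0 0] by simp

lemma linear_op_uminus: "linear_op T \<Longrightarrow> T (- f) = - T f"
  using linear_op_scale[of T "- 1" f] by (simp add: Const_uminus)

lemma linear_op_diff:
  assumes "linear_op T"
  shows "T (f - g) = T f - T g"
  using linear_op_add[OF assms, of f "- g"] by (simp add: linear_op_uminus[OF assms])

lemma linear_op_sum:
  assumes "linear_op T"
  shows "T (sum f A) = (\<Sum>x\<in>A. T (f x))"
  by (induction A rule: infinite_finite_induct)
    (simp_all add: linear_op_0[OF assms] linear_op_add[OF assms])

lemma linear_op_expand: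
  assumes "linear_op T"
  shows "T f = (\<Sum>m\<in>keys f. Const (lookup f m) * T (single m 1))"
proof -
  have "T f = T (\<Sum>m\<in>keys f. Const (lookup f m) * single m 1)"
    by (simp add: Const_mult_single sum_single_lookup)
  also have "\<dots> = (\<Sum>m\<in>keys f. T (Const (lookup f m) * single m 1))"
    by (rule linear_op_sum[OF assms])
  finally show ?thesis
    by (simp only: linear_op_scale[OF assms])
qed

text \<open>Reduces operator identities to monomials, notably multiplicativity of \<open>act\<close>
  and its agreement with \<open>swap_vars\<close>.\<close>

lemma linear_op_eqI:
  assumes "linear_op S" "linear_op T" "\<And>m. S (single m 1) = T (single m 1)"
  shows "S f = T f"
  by (subst linear_op_expand[OF assms(1)], subst linear_op_expand[OF assms(2)]) (simp only: assms(3))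

lemma linear_op_sum_keys:
  "linear_op (\<lambda>f. \<Sum>m\<in>keys f. single (h m) (c m * lookup f m))"
proof (rule linear_opI)
  fix f g :: mpol and a :: qalpha
  show "(\<Sum>m\<in>keys (f + g). single (h m) (c m * lookup (f + g) m))
    = (\<Sum>m\<in>keys f. single (h m) (c m * lookup f m)) + (\<Sum>m\<in>keys g. single (h m) (c m * lookup g m))"
    by (rule setsum_keys_plus_distrib) (simp_all add: single_add distrib_left)
  have "(\<Sum>m\<in>keys (Const a * f). single (h m) (c m * lookup (Const a * f) m))
    = (\<Sum>m\<in>keys f. single (h m) (c m * lookup (Const a * f) m))"
    by (rule sum.mono_neutral_left) (auto simp: in_keys_iff lookup_Const_mult)
  then show "(\<Sum>m\<in>keys (Const a * f). single (h m) (c m * lookup (Const a * f) m))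
    = Const a * (\<Sum>m\<in>keys f. single (h m) (c m * lookup f m))"
    by (simp add: lookup_Const_mult sum_distrib_left Const_mult_single mult.left_commute)
qed

lemma linear_op_partial: "linear_op (partial i)"
  using linear_op_sum_keys[of "\<lambda>m. m - eps i" "\<lambda>m. of_nat (lookup m i)"]
  by (simp add: partial_def[abs_def])

lemma linear_op_id: "linear_op (\<lambda>f. f)"
  by (simp add: linear_op_def)

lemma linear_op_times: "linear_op T \<Longrightarrow> linear_op (\<lambda>f. g * T f)"
  by (simp add: linear_op_def distrib_left mult.left_commute[of g])

lemma linear_op_times_right: "linear_op T \<Longrightarrow> linear_op (\<lambda>f. T f * g)"
  by (simp add: linear_op_def distrib_right mult.assoc)

lemma linear_op_plus: "linear_op S \<Longrightarrow> linear_op T \<Longrightarrow> linear_op (\<lambda>f. S f + T f)"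
  by (simp add: linear_op_def distrib_left add.assoc add.left_commute)

lemma linear_op_minus: "linear_op S \<Longrightarrow> linear_op T \<Longrightarrow> linear_op (\<lambda>f. S f - T f)"
  by (simp add: linear_op_def right_diff_distrib)

lemma linear_op_Sum:
  "(\<And>x. x \<in> A \<Longrightarrow> linear_op (T x)) \<Longrightarrow> linear_op (\<lambda>f. \<Sum>x\<in>A. T x f)"
  by (simp add: linear_op_def sum.distrib sum_distrib_left)

lemma linear_op_compose: "linear_op S \<Longrightarrow> linear_op T \<Longrightarrow> linear_op (\<lambda>f. S (T f))"
  by (simp add: linear_op_def)

lemma lookup_eps: "lookup (eps k) j = (if j = k then 1 else 0)"
  by (simp add: eps_def lookup_single when_def)

lemma eps_plus_minus: "0 < lookup m i \<Longrightarrow> eps i + (m - eps i) = m"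
  by (rule poly_mapping_eqI) (auto simp: lookup_add lookup_minus lookup_eps)

lemma Var_mult_single: "Var i * single m c = single (eps i + m) c"
  by (simp add: Var_def mult_single)

lemma lookup_Var_mult:
  "lookup (Var i * f) m = (if lookup m i = 0 then 0 else lookup f (m - eps i))"
proof -
  have "lookup (Var i * f) m = lookup (\<Sum>k\<in>keys f. single (eps i + k) (lookup f k)) m"
    by (subst (1) sum_single_lookup[of f, symmetric]) (simp add: sum_distrib_left Var_mult_single)
  also have "\<dots> = (\<Sum>k\<in>keys f. lookup f k when eps i + k = m)"
    by (simp add: lookup_sum lookup_single)
  also have "\<dots> = (if lookup m i = 0 then 0 else lookup f (m - eps i))"
  proof (cases "lookup m i = 0")
    case True
    then have "eps i + k \<noteq> m" for k
      by (metis add_eq_0_iff_both_eq_0 lookup_add lookup_eps one_neq_zero)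
    then show ?thesis using True by simp
  next
    case False
    then have "eps i + k = m \<longleftrightarrow> k = m - eps i" for k
      by (metis add_diff_cancel_left' eps_plus_minus gr0I)
    then have "(\<Sum>k\<in>keys f. lookup f k when eps i + k = m) = (\<Sum>k\<in>keys f. if k = m - eps i then lookup f k else 0)"
      by (simp add: when_def)
    then show ?thesis using False by (simp add: sum.delta' in_keys_iff)
  qed
  finally show ?thesis .
qed

text \<open>The Euler operator is diagonal on monomials. At exponent 0 the truncated
  \<open>m - eps i\<close> in \<open>partial\<close> is harmless because its coefficient is
  zero.\<close>

lemma lookup_Var_mult_partial:
  "lookup (Var i * partial i f) m = of_nat (lookup m i) * lookup f m"
proof -
  have "Var i * partial i (single k 1) = single k (of_nat (lookup k i))" for k
    by (cases "lookup k i = 0") (simp_all add: partial_def Var_mult_single eps_plus_minus)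
  then have "Var i * partial i f = (\<Sum>k\<in>keys f. Const (lookup f k) * single k (of_nat (lookup k i)))"
    by (subst linear_op_expand[OF linear_op_partial])
       (simp add: sum_distrib_left mult.left_commute[of "Var i"])
  also have "\<dots> = (\<Sum>k\<in>keys f. single k (of_nat (lookup k i) * lookup f k))"
    by (simp add: Const_mult_single mult.commute)
  finally have "lookup (Var i * partial i f) m = (\<Sum>k\<in>keys f. if k = m then of_nat (lookup k i) * lookup f k else 0)"
    by (simp add: lookup_sum lookup_single when_def)
  also have "\<dots> = of_nat (lookup m i) * lookup f m"
    by (simp add: sum.delta' in_keys_iff)
  finally show ?thesis .
qed

section \<open>Permutations acting on exponents and polynomials\<close>

lemma lookup_map_key: "inj \<pi> \<Longrightarrow> lookup (map_key \<pi> p) k = lookup p (\<pi> k)"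
  by (simp add: map_key.rep_eq)

lemma map_key_inv_map_key: "bij \<pi> \<Longrightarrow> map_key \<pi> (map_key (inv \<pi>) m) = (m :: expvec)"
  by (rule poly_mapping_eqI) (simp add: lookup_map_key bij_is_inj bij_imp_bij_inv)

lemma map_key_map_key_inv: "bij \<pi> \<Longrightarrow> map_key (inv \<pi>) (map_key \<pi> m) = (m :: expvec)"
  by (rule poly_mapping_eqI)
    (simp add: lookup_map_key bij_is_inj bij_imp_bij_inv bij_is_surj surj_f_inv_f)

lemma bij_map_key: "bij \<pi> \<Longrightarrow> bij (map_key \<pi> :: expvec \<Rightarrow> expvec)"
  by (rule o_bij[where g = "map_key (inv \<pi>)"])
    (simp_all add: fun_eq_iff map_key_inv_map_key map_key_map_key_inv)

text \<open>Renaming of variables from index i to \<open>\<pi> i\<close>. Pulling back twice is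
  covariant: exponents move by \<open>inv \<pi>\<close>, which makes this a left action.\<close>

definition act :: "(nat \<Rightarrow> nat) \<Rightarrow> mpol \<Rightarrow> mpol" where
  "act \<pi> = map_key (map_key \<pi>)"

lemma lookup_act: "bij \<pi> \<Longrightarrow> lookup (act \<pi> f) m = lookup f (map_key \<pi> m)"
  by (simp add: act_def lookup_map_key bij_is_inj bij_map_key)

lemma linear_op_act: "bij \<pi> \<Longrightarrow> linear_op (act \<pi>)"
  by (intro linear_opI poly_mapping_eqI) (simp_all add: lookup_act lookup_add lookup_Const_mult)

lemma act_single:
  assumes "bij \<pi>"
  shows "act \<pi> (single m c) = single (map_key (inv \<pi>) m) c"
proof -
  have "map_key (map_key \<pi>) (single (map_key \<pi> (map_key (inv \<pi>) m)) c) = single (map_key (inv \<pi>) m) c"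
    by (rule map_key_single) (simp add: bij_is_inj bij_map_key assms)
  then show ?thesis
    by (simp add: act_def map_key_inv_map_key assms)
qed

lemma act_mult:
  assumes "bij \<pi>"
  shows "act \<pi> (f * g) = act \<pi> f * act \<pi> g"
proof -
  note lin = linear_op_act[OF assms]
  have i: "inj (inv \<pi>)" using assms by (simp add: bij_imp_bij_inv bij_is_inj)
  have 1: "act \<pi> (single m 1 * g) = act \<pi> (single m 1) * act \<pi> g" for m
    by (rule linear_op_eqI[OF linear_op_compose[OF lin linear_op_times[OF linear_op_id]] linear_op_times[OF lin]])
      (simp add: mult_single act_single assms map_key_plus[OF i])
  show ?thesis
    by (rule linear_op_eqI[OF linear_op_compose[OF lin linear_op_times_right[OF linear_op_id]] linear_op_times_right[OF lin]])
      (rule 1)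
qed

lemma act_Var: "bij \<pi> \<Longrightarrow> act \<pi> (Var i) = Var (\<pi> i)"
proof -
  assume b: "bij \<pi>"
  have "map_key (inv \<pi>) (eps i) = eps (\<pi> i)"
    using b by (intro poly_mapping_eqI)
      (auto simp: lookup_map_key lookup_eps bij_imp_bij_inv bij_is_inj bij_inv_eq_iff)
  then show ?thesis by (simp add: Var_def act_single b)
qed

lemma act_Const [simp]: "bij \<pi> \<Longrightarrow> act \<pi> (Const c) = Const c"
  by (simp add: Const_def act_single bij_imp_bij_inv bij_is_inj)

lemma act_act: "bij \<pi> \<Longrightarrow> bij \<rho> \<Longrightarrow> act \<pi> (act \<rho> f) = act (\<pi> \<circ> \<rho>) f"
proof (rule poly_mapping_eqI)
  fix m :: expvec assume b: "bij \<pi>" "bij \<rho>"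
  have "map_key \<rho> (map_key \<pi> m) = map_key (\<pi> \<circ> \<rho>) m"
    using b by (simp add: map_key_compose bij_is_inj)
  then show "lookup (act \<pi> (act \<rho> f)) m = lookup (act (\<pi> \<circ> \<rho>) f) m"
    using b by (simp add: lookup_act bij_comp)
qed

lemma act_id [simp]: "act id f = f"
proof (rule poly_mapping_eqI)
  fix m :: expvec
  have "map_key id m = m" by (rule poly_mapping_eqI) (simp add: lookup_map_key)
  then show "lookup (act id f) m = lookup f m" by (simp add: lookup_act)
qed

lemma swap_vars_eq_act: "swap_vars i j f = act (transpose i j) f"
proof (rule linear_op_eqI[of "swap_vars i j" "act (transpose i j)"])
  show "linear_op (swap_vars i j)"
    using linear_op_sum_keys[of "map_key (transpose i j)" "\<lambda>_. 1"]
    by (simp add: swap_vars_def[abs_def])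
qed (simp_all add: linear_op_act act_single swap_vars_def)

lemma act_swap_swap [simp]: "act (transpose i j) (act (transpose i j) f) = f"
  by (simp add: act_act)

section \<open>Cherednik operators and their intertwining relations\<close>

lemma Var_neq: "i \<noteq> j \<Longrightarrow> Var i - Var j \<noteq> 0"
proof
  assume "i \<noteq> j" "Var i - Var j = 0"
  then have "lookup (Var i) (eps i) = lookup (Var j) (eps i)" by simp
  moreover have "eps j \<noteq> eps i"
    using \<open>i \<noteq> j\<close> by (metis lookup_eps zero_neq_one)
  ultimately show False by (simp add: Var_def lookup_single)
qed

lemma transpose_conj: "bij \<pi> \<Longrightarrow> \<pi> \<circ> transpose i j = transpose (\<pi> i) (\<pi> j) \<circ> \<pi>"
  by (auto simp: fun_eq_iff transpose_def bij_def inj_eq)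

lemma act_transpose_conj:
  "bij \<pi> \<Longrightarrow> act \<pi> (act (transpose i j) f) = act (transpose (\<pi> i) (\<pi> j)) (act \<pi> f)"
  by (simp add: act_act transpose_conj)

text \<open>Quotients by \<open>Var i - Var j\<close> are unique in an integral domain, so the rules
  for \<open>Nop\<close> below can be checked after multiplying out.\<close>

lemma Nop_eqI:
  assumes "i \<noteq> j" "(Var i - Var j) * g = f - act (transpose i j) f"
  shows "Nop i j f = g"
  unfolding Nop_def swap_vars_eq_act
proof (rule the_equality)
  fix h assume "(Var i - Var j) * h = f - act (transpose i j) f"
  then have "(Var i - Var j) * h = (Var i - Var j) * g" using assms(2) by simp
  then show "h = g" using Var_neq[OF assms(1)] by (metis mult_left_cancel)
qed (rule assms(2))

lemma single_diff_add_exchange: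
  fixes m :: expvec
  assumes "s \<le> lookup m i" "i \<noteq> j" "0 < s"
  shows "eps i + (m - single i s + single j (s - 1)) = m - single i (s - 1) + single j (s - 1)"
    "eps j + (m - single i s + single j (s - 1)) = m - single i s + single j s"
  using assms
  by (auto intro!: poly_mapping_eqI simp: lookup_add lookup_minus lookup_eps lookup_single when_def)

text \<open>A geometric sum: multiplied by the difference of the variables it telescopes from the
  monomial to its reflection, one unit moving from i to j per step.\<close>

lemma Nop_single_telescope:
  fixes m :: expvec
  assumes "i \<noteq> j" "lookup m j \<le> lookup m i"
  shows "(Var i - Var j) * (\<Sum>s\<in>{1..lookup m i - lookup m j}. single (m - single i s + single j (s - 1)) 1)
    = single m 1 - act (transpose i j) (single m 1)"
proof -
  define d where "d = lookup m i - lookup m j"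
  define X :: "nat \<Rightarrow> mpol" where "X s = single (m - single i s + single j s) 1" for s
  have "(Var i - Var j) * (\<Sum>s\<in>{1..d}. single (m - single i s + single j (s - 1)) 1)
    = (\<Sum>s\<in>{1..d}. X (s - 1) - X s)"
    unfolding sum_distrib_left
  proof (rule sum.cong[OF refl])
    fix s assume "s \<in> {1..d}"
    then have "s \<le> lookup m i" "0 < s" by (auto simp: d_def)
    from single_diff_add_exchange[OF this(1) assms(1) this(2)]
    show "(Var i - Var j) * single (m - single i s + single j (s - 1)) 1 = X (s - 1) - X s"
      by (simp only: left_diff_distrib Var_mult_single X_def)
  qed
  also have "\<dots> = X 0 - X d"
    by (induction d) simp_all
  also have "m - single i 0 + single j 0 = m"
    by simp
  then have "X 0 = single m 1" by (simp only: X_def)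
  \<comment> \<open>Moving the whole difference d of the two exponents exchanges them.\<close>
  also have "m - single i d + single j d = map_key (inv (transpose i j)) m"
    using assms
    by (auto intro!: poly_mapping_eqI simp: lookup_add lookup_minus lookup_single when_def lookup_map_key d_def transpose_def)
  then have "X d = act (transpose i j) (single m 1)"
    by (simp only: X_def act_single bij_transpose)
  finally show ?thesis by (simp only: d_def)
qed

lemma Nop_single:
  assumes "i \<noteq> j"
  shows "lookup m j \<le> lookup m i \<Longrightarrow>
    Nop i j (single m 1) = (\<Sum>s\<in>{1..lookup m i - lookup m j}. single (m - single i s + single j (s - 1)) 1)"
   and "lookup m i < lookup m j \<Longrightarrow>
    Nop i j (single m 1) = - (\<Sum>s\<in>{1..lookup m j - lookup m i}. single (m - single j s + single i (s - 1)) 1)"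
proof -
  assume "lookup m j \<le> lookup m i"
  from Nop_single_telescope[OF assms this]
  show "Nop i j (single m 1) = (\<Sum>s\<in>{1..lookup m i - lookup m j}. single (m - single i s + single j (s - 1)) 1)"
    by (rule Nop_eqI[OF assms])
next
  assume "lookup m i < lookup m j"
  with Nop_single_telescope[of j i m] assms
  have "(Var j - Var i) * (\<Sum>s\<in>{1..lookup m j - lookup m i}. single (m - single j s + single i (s - 1)) 1)
     = single m 1 - act (transpose i j) (single m 1)"
    by (simp only: less_imp_le transpose_commute[of j i])
  then show "Nop i j (single m 1) = - (\<Sum>s\<in>{1..lookup m j - lookup m i}. single (m - single j s + single i (s - 1)) 1)"
    by (intro Nop_eqI[OF assms]) (simp only: mult_minus_right minus_mult_left minus_diff_eq)
qed

text \<open>Existence of the quotient: it is known on monomials and extends linearly, so the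
  description in \<open>Nop\<close> denotes a polynomial.\<close>

lemma Nop_mult:
  assumes "i \<noteq> j"
  shows "(Var i - Var j) * Nop i j f = f - act (transpose i j) f"
proof -
  define g where "g = (\<Sum>m\<in>keys f. Const (lookup f m) * Nop i j (single m 1))"
  have 1: "(Var i - Var j) * Nop i j (single m 1) = single m 1 - act (transpose i j) (single m 1)" for m
  proof (cases "lookup m j \<le> lookup m i")
    case True
    show ?thesis unfolding Nop_single(1)[OF assms True] by (rule Nop_single_telescope[OF assms True])
  next
    case False
    then have F: "lookup m i < lookup m j" by simp
    show ?thesis unfolding Nop_single(2)[OF assms F]
      using Nop_single_telescope[of j i m] assms F
      by (simp only: less_imp_le transpose_commute[of j i] mult_minus_right minus_mult_left minus_diff_eq)
  qed
  have lin: "linear_op (\<lambda>f. f - act (transpose i j) f)"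
    by (simp add: linear_op_minus linear_op_id linear_op_act)
  have "(Var i - Var j) * g = f - act (transpose i j) f"
    unfolding g_def by (subst linear_op_expand[OF lin])
      (simp only: sum_distrib_left mult.left_commute[of "Var i - Var j"] 1)
  then show ?thesis using Nop_eqI[OF assms] by metis
qed

lemma linear_op_Nop: "i \<noteq> j \<Longrightarrow> linear_op (Nop i j)"
proof (rule linear_opI)
  assume ij: "i \<noteq> j"
  have lin: "linear_op (act (transpose i j))" by (simp add: linear_op_act)
  show "Nop i j (f + g) = Nop i j f + Nop i j g" for f g
    by (rule Nop_eqI[OF ij]) (simp add: distrib_left Nop_mult[OF ij] linear_op_add[OF lin])
  show "Nop i j (Const c * f) = Const c * Nop i j f" for c f
    by (rule Nop_eqI[OF ij])
      (simp add: mult.left_commute[of _ "Const c"] Nop_mult[OF ij] linear_op_scale[OF lin] right_diff_distrib)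
qed

lemma act_Nop:
  assumes "bij \<pi>" "i \<noteq> j"
  shows "act \<pi> (Nop i j f) = Nop (\<pi> i) (\<pi> j) (act \<pi> f)"
proof (rule Nop_eqI[symmetric])
  note lin = linear_op_act[OF assms(1)]
  show "\<pi> i \<noteq> \<pi> j" using assms by (simp add: bij_is_inj inj_eq)
  have "act \<pi> ((Var i - Var j) * Nop i j f) = act \<pi> (f - act (transpose i j) f)"
    by (simp only: Nop_mult[OF assms(2)])
  then show "(Var (\<pi> i) - Var (\<pi> j)) * act \<pi> (Nop i j f) = act \<pi> f - act (transpose (\<pi> i) (\<pi> j)) (act \<pi> f)"
    by (simp only: act_mult[OF assms(1)] linear_op_diff[OF lin] act_Var[OF assms(1)]
        act_transpose_conj[OF assms(1)])
qed

lemma Nop_Var_other: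
  assumes "i \<noteq> j" "k \<noteq> i" "k \<noteq> j"
  shows "Nop i j (Var k * f) = Var k * Nop i j f"
proof (rule Nop_eqI[OF assms(1)])
  have "(Var i - Var j) * (Var k * Nop i j f) = Var k * ((Var i - Var j) * Nop i j f)"
    by (simp only: mult.left_commute)
  also have "\<dots> = Var k * f - Var k * act (transpose i j) f"
    by (simp only: Nop_mult[OF assms(1)] right_diff_distrib)
  finally show "(Var i - Var j) * (Var k * Nop i j f) = Var k * f - act (transpose i j) (Var k * f)"
    using assms by (simp add: act_mult act_Var)
qed

text \<open>A variable taking part in the divided difference commutes with it up to a reflection.
  These reflections separate \<open>cherednik\<close> from its permutation-equivariant part.\<close>

lemma Nop_Var_right:
  assumes "i \<noteq> j"
  shows "Nop i j (Var j * f) = Var j * Nop i j f - act (transpose i j) f"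
proof (rule Nop_eqI[OF assms(1)])
  let ?s = "act (transpose i j)"
  have "(Var i - Var j) * (Var j * Nop i j f - ?s f)
    = Var j * ((Var i - Var j) * Nop i j f) - (Var i - Var j) * ?s f"
    by (simp only: mult.left_commute right_diff_distrib)
  also have "\<dots> = Var j * f - Var i * ?s f"
    by (simp only: Nop_mult[OF assms(1)]) (simp add: algebra_simps)
  finally show "(Var i - Var j) * (Var j * Nop i j f - ?s f) = Var j * f - ?s (Var j * f)"
    by (simp add: act_mult act_Var)
qed

lemma Nop_Var_left:
  assumes "i \<noteq> j"
  shows "Nop i j (Var i * f) = Var i * Nop i j f + act (transpose i j) f"
proof (rule Nop_eqI[OF assms(1)])
  let ?s = "act (transpose i j)"
  have "(Var i - Var j) * (Var i * Nop i j f + ?s f)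
    = Var i * ((Var i - Var j) * Nop i j f) + (Var i - Var j) * ?s f"
    by (simp only: mult.left_commute distrib_left)
  also have "\<dots> = Var i * f - Var j * ?s f"
    by (simp only: Nop_mult[OF assms(1)]) (simp add: algebra_simps)
  finally show "(Var i - Var j) * (Var i * Nop i j f + ?s f) = Var i * f - ?s (Var i * f)"
    by (simp add: act_mult act_Var)
qed

text \<open>The part of the Cherednik operator that treats all j alike. It is equivariant under
  every permutation of the n variables (\<open>act_dunkl\<close>); only the subtracted reflections
  with j < i break the symmetry.\<close>

definition dunkl :: "nat \<Rightarrow> nat \<Rightarrow> mpol \<Rightarrow> mpol" where
  "dunkl n i f = Const alpha * (Var i * partial i f) + (\<Sum>j\<in>{1..n} - {i}. Var j * Nop i j f)"

lemma cherednik_eq_dunkl: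
  assumes "i \<in> {1..n}"
  shows "cherednik n i f = dunkl n i f - (\<Sum>j\<in>{1..<i}. act (transpose i j) f)"
proof -
  have s: "{1..n} - {i} = {1..<i} \<union> {i<..n}" using assms by auto
  have "(\<Sum>j\<in>{1..<i}. Nop i j (Var j * f))
      = (\<Sum>j\<in>{1..<i}. Var j * Nop i j f) - (\<Sum>j\<in>{1..<i}. act (transpose i j) f)"
    by (simp add: Nop_Var_right sum_subtractf)
  moreover have "(\<Sum>j\<in>{1..n} - {i}. Var j * Nop i j f)
      = (\<Sum>j\<in>{1..<i}. Var j * Nop i j f) + (\<Sum>j\<in>{i<..n}. Var j * Nop i j f)"
    unfolding s by (rule sum.union_disjoint) auto
  ultimately show ?thesis by (simp add: cherednik_def dunkl_def)
qed

lemma linear_op_cherednik: "linear_op (cherednik n i)"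
  unfolding cherednik_def[abs_def]
  by (intro linear_op_plus linear_op_times linear_op_partial linear_op_Sum
      linear_op_compose[OF linear_op_Nop linear_op_times[OF linear_op_id]] linear_op_Nop) auto

lemma act_Var_partial:
  assumes "bij \<pi>"
  shows "act \<pi> (Var i * partial i f) = Var (\<pi> i) * partial (\<pi> i) (act \<pi> f)"
  by (rule poly_mapping_eqI)
    (simp add: lookup_act assms lookup_Var_mult_partial lookup_map_key bij_is_inj)

lemma act_dunkl:
  assumes "bij \<pi>" "\<pi> ` {1..n} = {1..n}"
  shows "act \<pi> (dunkl n i f) = dunkl n (\<pi> i) (act \<pi> f)"
proof -
  note lin = linear_op_act[OF assms(1)]
  have inj: "inj_on \<pi> S" for S using assms(1) by (meson bij_is_inj inj_on_subset subset_UNIV)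
  have im: "\<pi> ` ({1..n} - {i}) = {1..n} - {\<pi> i}"
    using assms inj_on_image_set_diff[of \<pi> UNIV "{1..n}" "{i}"] inj by simp
  have "(\<Sum>j\<in>{1..n} - {\<pi> i}. Var j * Nop (\<pi> i) j (act \<pi> f))
      = (\<Sum>j\<in>{1..n} - {i}. Var (\<pi> j) * Nop (\<pi> i) (\<pi> j) (act \<pi> f))"
    unfolding im[symmetric] by (simp add: sum.reindex[OF inj])
  moreover have "act \<pi> (Const alpha * (Var i * partial i f))
      = Const alpha * (Var (\<pi> i) * partial (\<pi> i) (act \<pi> f))"
    by (simp only: linear_op_scale[OF lin] act_Var_partial[OF assms(1)])
  moreover have "act \<pi> (\<Sum>j\<in>{1..n} - {i}. Var j * Nop i j f)
      = (\<Sum>j\<in>{1..n} - {i}. Var (\<pi> j) * Nop (\<pi> i) (\<pi> j) (act \<pi> f))"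
    by (simp add: linear_op_sum[OF lin] assms(1) act_mult act_Var act_Nop)
  ultimately show ?thesis
    by (simp only: dunkl_def linear_op_add[OF lin])
qed

lemma transpose_image_Icc:
  "i \<in> {1..n} \<Longrightarrow> j \<in> {1..n} \<Longrightarrow> transpose i j ` {1..n} = {1..n::nat}"
  by (simp add: transpose_image_eq)

text \<open>The cross relation of the degenerate affine Hecke algebra. The equivariant parts match,
  and the reflection sums for i and i + 1 differ by one term.\<close>

lemma act_cherednik_left:
  assumes "1 \<le> i" "i < n"
  shows "act (transpose i (Suc i)) (cherednik n i f) = cherednik n (Suc i) (act (transpose i (Suc i)) f) + f"
proof -
  let ?s = "transpose i (Suc i)"
  note lin = linear_op_act[OF bij_transpose, of i "Suc i"]
  have "cherednik n i f = dunkl n i f - (\<Sum>j\<in>{1..<i}. act (transpose i j) f)"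
    using assms by (intro cherednik_eq_dunkl) auto
  then have "act ?s (cherednik n i f)
      = dunkl n (Suc i) (act ?s f) - (\<Sum>j\<in>{1..<i}. act (transpose (Suc i) (?s j)) (act ?s f))"
    using assms by (simp add: linear_op_diff[OF lin] linear_op_sum[OF lin] act_dunkl transpose_image_Icc
        act_transpose_conj[of ?s i])
  also have "(\<Sum>j\<in>{1..<i}. act (transpose (Suc i) (?s j)) (act ?s f))
      = (\<Sum>j\<in>{1..<i}. act (transpose (Suc i) j) (act ?s f))"
    by (intro sum.cong) (auto simp: transpose_apply_other)
  finally have "act ?s (cherednik n i f)
      = dunkl n (Suc i) (act ?s f) - (\<Sum>j\<in>{1..<i}. act (transpose (Suc i) j) (act ?s f))" .
  \<comment> \<open>The new index j = i contributes the transposition already applied to f; the two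
    cancel and leave the extra f.\<close>
  moreover have "(\<Sum>j\<in>{1..<Suc i}. act (transpose (Suc i) j) (act ?s f))
      = f + (\<Sum>j\<in>{1..<i}. act (transpose (Suc i) j) (act ?s f))"
  proof -
    have ins: "{1..<Suc i} = insert i {1..<i}"
      using assms by auto
    show ?thesis
      unfolding ins by (subst sum.insert) (simp_all add: transpose_commute[of "Suc i" i])
  qed
  moreover have "cherednik n (Suc i) (act ?s f)
      = dunkl n (Suc i) (act ?s f) - (\<Sum>j\<in>{1..<Suc i}. act (transpose (Suc i) j) (act ?s f))"
    using assms by (intro cherednik_eq_dunkl) auto
  ultimately show ?thesis
    by simp
qed

lemma act_cherednik_right:
  assumes "1 \<le> i" "i < n"
  shows "act (transpose i (Suc i)) (cherednik n (Suc i) f) = cherednik n i (act (transpose i (Suc i)) f) - f"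
proof -
  let ?s = "act (transpose i (Suc i))"
  note lin = linear_op_act[OF bij_transpose, of i "Suc i"]
  have "?s (?s (cherednik n i (?s f))) = ?s (cherednik n (Suc i) f + ?s f)"
    using act_cherednik_left[OF assms, of "?s f"] by simp
  then show ?thesis by (simp add: linear_op_add[OF lin])
qed

lemma act_cherednik_other:
  assumes "1 \<le> i" "i < n" "j \<in> {1..n}" "j \<noteq> i" "j \<noteq> Suc i"
  shows "act (transpose i (Suc i)) (cherednik n j f) = cherednik n j (act (transpose i (Suc i)) f)"
proof -
  let ?s = "transpose i (Suc i)"
  note lin = linear_op_act[OF bij_transpose, of i "Suc i"]
  \<comment> \<open>As j is neither i nor i + 1, these two lie either both below j or both above
    it.\<close>
  have im: "?s ` {1..<j} = {1..<j}"
    using assms by (intro transpose_image_eq) auto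
  have "(\<Sum>h\<in>{1..<j}. act (transpose j h) (act ?s f)) = (\<Sum>h\<in>{1..<j}. act (transpose j (?s h)) (act ?s f))"
    by (subst (1) im[symmetric], subst sum.reindex) (simp_all add: inj_on_subset[OF inj_transpose])
  then show ?thesis
    using assms by (simp add: cherednik_eq_dunkl linear_op_diff[OF lin] linear_op_sum[OF lin]
        act_dunkl transpose_image_Icc act_transpose_conj[of ?s] transpose_apply_other)
qed

text \<open>\<open>raise n\<close> is the intertwiner \<open>\<Phi>\<close>.\<close>

definition rot :: "nat \<Rightarrow> nat \<Rightarrow> nat" where
  "rot n p = (if p = 1 then n else if 2 \<le> p \<and> p \<le> n then p - 1 else p)"

definition raise :: "nat \<Rightarrow> mpol \<Rightarrow> mpol" where
  "raise n f = Var n * act (rot n) f"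

lemma bij_rot: "1 \<le> n \<Longrightarrow> bij (rot n)"
  by (rule o_bij[where g = "\<lambda>p. if p = n then 1 else if 1 \<le> p \<and> p < n then p + 1 else p"])
    (auto simp: fun_eq_iff rot_def)

lemma rot_image: 
  assumes "1 \<le> n"
  shows "rot n ` {1..n} = {1..n}"
proof (rule endo_inj_surj)
  show "inj_on (rot n) {1..n}" using bij_rot[OF assms] by (meson bij_is_inj inj_on_subset subset_UNIV)
  show "rot n ` {1..n} \<subseteq> {1..n}" by (auto simp: rot_def)
qed simp

lemma linear_op_raise: "1 \<le> n \<Longrightarrow> linear_op (raise n)"
  unfolding raise_def[abs_def] by (intro linear_op_times linear_op_act bij_rot)

lemma partial_Var_mult_other: "i \<noteq> k \<Longrightarrow> Var i * partial i (Var k * f) = Var k * (Var i * partial i f)"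
  by (rule poly_mapping_eqI)
    (simp add: lookup_Var_mult_partial lookup_Var_mult[of k] lookup_minus lookup_eps)

lemma partial_Var_mult_same: "Var k * partial k (Var k * f) = Var k * (Var k * partial k f) + Var k * f"
proof (rule poly_mapping_eqI)
  fix m
  show "lookup (Var k * partial k (Var k * f)) m = lookup (Var k * (Var k * partial k f) + Var k * f) m"
  proof (cases "lookup m k")
    case 0
    then show ?thesis
      by (simp add: lookup_add lookup_Var_mult_partial lookup_Var_mult[of k "Var k * _"])
        (simp add: lookup_Var_mult)
  next
    case (Suc c)
    then show ?thesis
      by (simp only: lookup_add lookup_Var_mult_partial lookup_Var_mult[of k "Var k * _"] lookup_Var_mult[of k f]
         lookup_minus lookup_eps) (simp add: distrib_right)
  qed
qed

text \<open>The rotation turns the reflections belonging to row i + 1 into those of row i and one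
  more, exchanging i and n. Moving \<open>Var n\<close> through the equivariant part produces
  exactly this surplus reflection.\<close>

lemma cherednik_raise:
  assumes "1 \<le> i" "i < n"
  shows "cherednik n i (raise n f) = raise n (cherednik n (Suc i) f)"
proof -
  define g where "g = act (rot n) f"
  have b: "bij (rot n)" and im: "rot n ` {1..n} = {1..n}" using assms bij_rot rot_image by auto
  note lin = linear_op_act[OF b]
  have r: "rot n (Suc i) = i" using assms by (auto simp: rot_def)
  have ins: "{1..<Suc i} = insert 1 (Suc ` {1..<i})"
    using assms by (auto simp: image_Suc_atLeastLessThan)
  have "(\<Sum>j\<in>{1..<Suc i}. act (transpose i (rot n j)) g)
     = act (transpose i n) g + (\<Sum>j\<in>Suc ` {1..<i}. act (transpose i (rot n j)) g)"
    unfolding ins by (subst sum.insert) (auto simp: rot_def)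
  also have "(\<Sum>j\<in>Suc ` {1..<i}. act (transpose i (rot n j)) g) = (\<Sum>j\<in>{1..<i}. act (transpose i (rot n (Suc j))) g)"
    by (rule sum.reindex_cong[of Suc]) auto
  also have "(\<Sum>j\<in>{1..<i}. act (transpose i (rot n (Suc j))) g) = (\<Sum>j\<in>{1..<i}. act (transpose i j) g)"
    using assms by (intro sum.cong) (auto simp: rot_def)
  finally have sum: "(\<Sum>j\<in>{1..<Suc i}. act (transpose i (rot n j)) g)
     = act (transpose i n) g + (\<Sum>j\<in>{1..<i}. act (transpose i j) g)" .
  have "cherednik n (Suc i) f = dunkl n (Suc i) f - (\<Sum>j\<in>{1..<Suc i}. act (transpose (Suc i) j) f)"
    using assms by (intro cherednik_eq_dunkl) auto
  then have "act (rot n) (cherednik n (Suc i) f) = dunkl n i g - (\<Sum>j\<in>{1..<Suc i}. act (transpose i (rot n j)) g)"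
    by (simp only: g_def linear_op_diff[OF lin] linear_op_sum[OF lin] act_dunkl[OF b im] act_transpose_conj[OF b] r)
  then have 1: "raise n (cherednik n (Suc i) f)
     = Var n * (dunkl n i g - act (transpose i n) g - (\<Sum>j\<in>{1..<i}. act (transpose i j) g))"
    by (simp only: raise_def sum diff_diff_eq)
  have s: "{1..n} - {i} = insert n ({1..<n} - {i})" using assms by auto
  have "(\<Sum>j\<in>{1..<n} - {i}. Var j * Nop i j (Var n * g)) = Var n * (\<Sum>j\<in>{1..<n} - {i}. Var j * Nop i j g)"
    unfolding sum_distrib_left using assms
    by (intro sum.cong) (auto simp: Nop_Var_other mult.left_commute[of "Var n"])
  \<comment> \<open>The only divided difference that does not commute with \<open>Var n\<close>; it
    supplies the surplus reflection.\<close>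
  moreover have "Nop i n (Var n * g) = Var n * Nop i n g - act (transpose i n) g"
    using assms by (intro Nop_Var_right) simp
  ultimately have "(\<Sum>j\<in>{1..n} - {i}. Var j * Nop i j (Var n * g))
     = Var n * (\<Sum>j\<in>{1..n} - {i}. Var j * Nop i j g) - Var n * act (transpose i n) g"
    unfolding s by (simp add: distrib_left right_diff_distrib)
  then have "dunkl n i (Var n * g) = Var n * dunkl n i g - Var n * act (transpose i n) g"
    using assms by (simp only: dunkl_def) (simp add: partial_Var_mult_other distrib_left mult.left_commute[of "Const alpha"])
  moreover have "(\<Sum>j\<in>{1..<i}. act (transpose i j) (Var n * g)) = Var n * (\<Sum>j\<in>{1..<i}. act (transpose i j) g)"
    unfolding sum_distrib_left using assms
    by (intro sum.cong) (auto simp: act_mult act_Var transpose_apply_other)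
  ultimately have "cherednik n i (raise n f)
     = Var n * (dunkl n i g - act (transpose i n) g - (\<Sum>j\<in>{1..<i}. act (transpose i j) g))"
    using assms by (simp add: raise_def g_def cherednik_eq_dunkl right_diff_distrib)
  then show ?thesis using 1 by simp
qed

text \<open>Here \<open>Var n\<close> meets every divided difference from the left. The reflections
  so created cancel those subtracted in row n, and the Euler term adds alpha.\<close>

lemma cherednik_raise_last:
  assumes "1 \<le> n"
  shows "cherednik n n (raise n f) = raise n (cherednik n 1 f + Const alpha * f)"
proof -
  define g where "g = act (rot n) f"
  have b: "bij (rot n)" and im: "rot n ` {1..n} = {1..n}" using assms bij_rot rot_image by auto
  note lin = linear_op_act[OF b]
  have 1: "raise n (cherednik n 1 f + Const alpha * f) = Var n * (dunkl n n g + Const alpha * g)"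
    using assms unfolding raise_def g_def
    by (simp add: cherednik_eq_dunkl linear_op_add[OF lin] linear_op_scale[OF lin] act_dunkl[OF b im] rot_def)
  have s: "{1..n} - {n} = {1..<n}" by auto
  note s = this this[simplified]
  have "(\<Sum>j\<in>{1..<n}. Var j * Nop n j (Var n * g))
     = Var n * (\<Sum>j\<in>{1..<n}. Var j * Nop n j g) + (\<Sum>j\<in>{1..<n}. act (transpose n j) (Var n * g))"
    by (simp add: Nop_Var_left act_mult act_Var sum_distrib_left distrib_left sum.distrib mult.left_commute)
  then have "cherednik n n (raise n f) = Var n * (dunkl n n g + Const alpha * g)"
    using assms by (simp add: raise_def g_def cherednik_eq_dunkl dunkl_def s partial_Var_mult_same
       distrib_left mult.left_commute[of "Const alpha"])
  then show ?thesis using 1 by simp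
qed

section \<open>Triangularity\<close>

lemma of_int_eq_Fract: "(of_int k :: 'a::idom fract) = Fract (of_int k) 1"
  by (cases k rule: int_cases2) (simp_all add: of_nat_fract)

text \<open>The indeterminate satisfies no affine relation over the integers. Separation of spectral
  values and nonvanishing of hooks both rest on this.\<close>

lemma alpha_affine_eq_0:
  assumes "alpha * of_int a + of_int b = 0"
  shows "a = 0 \<and> b = 0"
proof -
  have "Fract ([:0, 1:] * of_int a + of_int b) 1 = (0 :: qalpha)"
    using assms by (simp add: alpha_def of_int_eq_Fract)
  then have "[:0, 1:] * of_int a + of_int b = (0 :: rat poly)"
    by (simp add: Zero_fract_def eq_fract)
  then have "[:of_int b, of_int a:] = (0 :: rat poly)"
    by (simp add: of_int_poly algebra_simps)
  then show ?thesis by simp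
qed

lemma alpha_affine_nonzero: "a \<noteq> 0 \<or> b \<noteq> 0 \<Longrightarrow> alpha * of_int a + of_int b \<noteq> 0"
  using alpha_affine_eq_0 by blast

lemma alpha_affine_nat_nonzero: "0 < a \<or> 0 < b \<Longrightarrow> alpha * of_nat a + of_nat b \<noteq> 0"
  using alpha_affine_nonzero[of "int a" "int b"] by auto

lemma compositions_iff: "m \<in> compositions n \<longleftrightarrow> (\<forall>j. j \<notin> {1..n} \<longrightarrow> lookup m j = 0)"
  by (auto simp: compositions_def in_keys_iff)

lemma compositions_eqI:
  assumes "\<mu> \<in> compositions n" "\<nu> \<in> compositions n" "\<And>i. i \<in> {1..n} \<Longrightarrow> lookup \<mu> i = lookup \<nu> i"
  shows "\<mu> = \<nu>"
proof (rule poly_mapping_eqI)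
  fix i show "lookup \<mu> i = lookup \<nu> i"
    using assms by (cases "i \<in> {1..n}") (auto simp: compositions_iff)
qed

text \<open>The alpha-coefficient of a spectral value is the entry itself. Hence a spectral vector
  determines its composition and the joint spectrum is simple.\<close>

lemma spectral_inject:
  assumes "spectral n \<mu> i = spectral n \<nu> j"
  shows "lookup \<mu> i = lookup \<nu> j"
proof -
  have "alpha * of_int (int (lookup \<mu> i) - int (lookup \<nu> j)) + of_int (int (leg' n \<nu> j) - int (leg' n \<mu> i)) = 0"
    using assms by (simp add: spectral_def algebra_simps)
  from alpha_affine_eq_0[OF this] show ?thesis by simp
qed

text \<open>A natural number in place of a dominance order. The quadratic part measures spread and
  dominates; the linear part, of slope at most n - 1, makes a rearrangement heavier when large
  entries come early.\<close>

definition weight :: "nat \<Rightarrow> expvec \<Rightarrow> nat" where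
  "weight n m = (\<Sum>r\<in>{1..n}. n * (lookup m r)\<^sup>2 + (n - r) * lookup m r)"

lemma weight_move:
  fixes m :: expvec
  assumes "p \<in> {1..n}" "q \<in> {1..n}" "p \<noteq> q" "0 < s" "lookup m q + s \<le> lookup m p"
    "lookup m q + s < lookup m p \<or> p < q"
  shows "weight n (m - single p s + single q s) < weight n m"
proof -
  let ?m = "m - single p s + single q s"
  let ?T = "\<lambda>m r. n * (lookup m r)\<^sup>2 + (n - r) * lookup m r"
  define R where "R = {1..n} - {p, q}"
  have s: "{1..n} = insert p (insert q R)" "finite R" "p \<notin> R" "q \<notin> R" using assms by (auto simp: R_def)
  have w: "weight n k = ?T k p + (?T k q + (\<Sum>r\<in>R. ?T k r))" for k
    unfolding weight_def s(1) using s assms(3) by simp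
  have R: "(\<Sum>r\<in>R. ?T ?m r) = (\<Sum>r\<in>R. ?T m r)"
    by (rule sum.cong) (auto simp: lookup_add lookup_minus lookup_single when_def R_def)
  define b e where "b = lookup m q" and "e = lookup m p - (b + s)"
  have a: "lookup m p = b + s + e" using assms(5) by (simp add: b_def e_def)
  have l: "lookup ?m p = b + e" "lookup ?m q = b + s"
    using assms(3) a by (auto simp: lookup_add lookup_minus lookup_single when_def b_def)
  \<comment> \<open>This will be the loss of weight. If e > 0, then 2 n e exceeds p - q; e = 0 is a
    plain exchange of two entries, decided by p < q.\<close>
  have pos: "0 < int s * (2 * int n * int e + (int q - int p))"
  proof -
    have "0 < 2 * int n * int e + (int q - int p)"
    proof (cases "e = 0")
      case True
      then show ?thesis using assms(6) a by (auto simp: b_def)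
    next
      case False
      then have "2 * int n \<le> 2 * int n * int e"
        using mult_left_mono[of 1 "int e" "2 * int n"] by simp
      moreover have "int p \<le> int n" "1 \<le> int q" "1 \<le> int n" using assms(1,2) by auto
      ultimately show ?thesis by linarith
    qed
    then show ?thesis using assms(4) by simp
  qed
  have "int (?T m p + ?T m q) - int (?T ?m p + ?T ?m q) = int s * (2 * int n * int e + (int q - int p))"
  proof -
    have "int (n - p) = int n - int p" "int (n - q) = int n - int q"
      using assms(1,2) by auto
    then show ?thesis
      unfolding l a b_def[symmetric] of_nat_add of_nat_mult of_nat_power
      by (simp only: of_nat_add) (simp add: power2_eq_square algebra_simps)
  qed
  then have "?T ?m p + ?T ?m q < ?T m p + ?T m q" using pos by linarith
  then show ?thesis unfolding w R by linarith
qed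

definition lower :: "nat \<Rightarrow> expvec \<Rightarrow> mpol \<Rightarrow> bool" where
  "lower n m f \<longleftrightarrow> (\<forall>\<nu>\<in>keys f. weight n \<nu> < weight n m)"

lemma lower_0 [simp]: "lower n m 0"
  by (simp add: lower_def)

lemma lower_add: "lower n m f \<Longrightarrow> lower n m g \<Longrightarrow> lower n m (f + g)"
  using keys_add[of f g] by (auto simp: lower_def)

lemma lower_uminus: "lower n m f \<Longrightarrow> lower n m (- f)"
  by (simp add: lower_def in_keys_iff)

lemma lower_sum: "(\<And>x. x \<in> A \<Longrightarrow> lower n m (f x)) \<Longrightarrow> lower n m (sum f A)"
  by (induction A rule: infinite_finite_induct) (simp_all add: lower_add)

lemma lower_single: "weight n k < weight n m \<Longrightarrow> lower n m (single k c)"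
  by (simp add: lower_def)

text \<open>For i < j even the complete exchange of a larger entry at i lowers the weight. Otherwise
  the expansion contains the monomial itself with coefficient -1, one unit of the second count in
  \<open>leg'\<close>.\<close>

lemma lower_Var_Nop_right:
  assumes "i \<in> {1..n}" "j \<in> {1..n}" "i < j"
  shows "lower n m (Var j * Nop i j (single m 1) + (if lookup m i < lookup m j then single m 1 else 0))"
proof (cases "lookup m i < lookup m j")
  case False
  then have "Var j * Nop i j (single m 1)
      = (\<Sum>s\<in>{1..lookup m i - lookup m j}. single (m - single i s + single j s) 1)"
    using assms unfolding sum_distrib_left
    by (simp only: Nop_single(1) not_less sum_distrib_left Var_mult_single)
      (intro sum.cong, simp, subst single_diff_add_exchange(2), auto)
  also have "lower n m \<dots>"
    using assms by (intro lower_sum lower_single weight_move) auto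
  finally show ?thesis using False by simp
next
  case True
  then have "Var j * Nop i j (single m 1)
      = - (\<Sum>s\<in>{1..lookup m j - lookup m i}. single (m - single j (s - 1) + single i (s - 1)) 1)"
    using assms
    by (simp only: Nop_single(2) not_less mult_minus_right sum_distrib_left Var_mult_single)
      (simp only: neg_equal_iff_equal, intro sum.cong, simp, subst single_diff_add_exchange(1), auto)
  \<comment> \<open>The term s = 1 is the monomial itself. The others move s - 1 units from j to i,
    always less than the full difference, as the move towards the smaller index demands.\<close>
  also have "{1..lookup m j - lookup m i} = insert 1 {2..lookup m j - lookup m i}"
    using True by auto
  also have "(\<Sum>s\<in>insert 1 {2..lookup m j - lookup m i}. single (m - single j (s - 1) + single i (s - 1)) 1)
     = single m 1 + (\<Sum>s\<in>{2..lookup m j - lookup m i}. single (m - single j (s - 1) + single i (s - 1)) (1 :: qalpha))"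
    by (subst sum.insert) simp_all
  finally have "Var j * Nop i j (single m 1) + single m 1
      = - (\<Sum>s\<in>{2..lookup m j - lookup m i}. single (m - single j (s - 1) + single i (s - 1)) 1)"
    by simp
  also have "lower n m \<dots>"
    using assms by (intro lower_uminus lower_sum lower_single weight_move) auto
  finally show ?thesis using True by simp
qed

text \<open>The factor \<open>Var j\<close> shifts the comparison by one: the complete exchange from
  i down to j is now excluded, and equal entries also give -1. This is the non-strict count in
  \<open>leg'\<close>.\<close>

lemma lower_Nop_Var_left:
  assumes "i \<in> {1..n}" "j \<in> {1..n}" "j < i"
  shows "lower n m (Nop i j (Var j * single m 1) + (if lookup m i \<le> lookup m j then single m 1 else 0))"
proof (cases "lookup m i \<le> lookup m j")
  case False
  have "Nop i j (single (eps j + m) 1)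
      = (\<Sum>s\<in>{1..lookup m i - lookup m j - 1}. single (eps j + m - single i s + single j (s - 1)) 1)"
    using assms False by (subst Nop_single(1)) (simp_all add: lookup_add lookup_eps)
  also have "\<dots> = (\<Sum>s\<in>{1..lookup m i - lookup m j - 1}. single (m - single i s + single j s) 1)"
    using assms by (intro sum.cong refl arg_cong2[of _ _ _ _ single])
      (auto intro!: poly_mapping_eqI simp: lookup_add lookup_minus lookup_eps lookup_single when_def)
  also have "lower n m \<dots>"
    using assms by (intro lower_sum lower_single weight_move) auto
  finally show ?thesis using False by (simp add: Var_mult_single)
next
  case True
  have "Nop i j (single (eps j + m) 1)
      = - (\<Sum>s\<in>{1..lookup m j + 1 - lookup m i}. single (eps j + m - single j s + single i (s - 1)) 1)"
    using assms True by (subst Nop_single(2)) (simp_all add: lookup_add lookup_eps)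
  also have "(\<Sum>s\<in>{1..lookup m j + 1 - lookup m i}. single (eps j + m - single j s + single i (s - 1)) (1::qalpha))
      = (\<Sum>s\<in>{1..lookup m j + 1 - lookup m i}. single (m - single j (s - 1) + single i (s - 1)) 1)"
    using assms by (intro sum.cong refl arg_cong2[of _ _ _ _ single])
      (auto intro!: poly_mapping_eqI simp: lookup_add lookup_minus lookup_eps lookup_single when_def)
  also have "{1..lookup m j + 1 - lookup m i} = insert 1 {2..lookup m j + 1 - lookup m i}"
    using True by auto
  also have "(\<Sum>s\<in>insert 1 {2..lookup m j + 1 - lookup m i}. single (m - single j (s - 1) + single i (s - 1)) 1)
     = single m 1 + (\<Sum>s\<in>{2..lookup m j + 1 - lookup m i}. single (m - single j (s - 1) + single i (s - 1)) (1 :: qalpha))"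
    by (subst sum.insert) simp_all
  finally have "Nop i j (single (eps j + m) 1) + single m 1
      = - (\<Sum>s\<in>{2..lookup m j + 1 - lookup m i}. single (m - single j (s - 1) + single i (s - 1)) 1)"
    by simp
  also have "lower n m \<dots>"
    using assms by (intro lower_uminus lower_sum lower_single weight_move) auto
  finally show ?thesis using True by (simp add: Var_mult_single)
qed

lemma sum_if_const: "finite A \<Longrightarrow> (\<Sum>x\<in>A. if P x then c else 0) = of_nat (card {x \<in> A. P x}) * (c :: 'a :: semiring_1)"
  by (simp add: sum.If_cases Int_def)

text \<open>The Euler term gives alpha times the exponent, and every row counted by
  \<open>leg'\<close> contributes -1 through one of the two preceding lemmas.\<close>

lemma cherednik_triangular:
  assumes i: "i \<in> {1..n}"
  shows "lower n m (cherednik n i (single m 1) - Const (spectral n m i) * single m 1)"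
proof -
  let ?x = "single m 1 :: mpol"
  let ?f = "\<Sum>j\<in>{1..<i}. Nop i j (Var j * ?x) + (if lookup m i \<le> lookup m j then ?x else 0)"
  let ?g = "\<Sum>j\<in>{i<..n}. Var j * Nop i j ?x + (if lookup m i < lookup m j then ?x else 0)"
  have s: "{h \<in> {1..n}. h < i \<and> lookup m h \<ge> lookup m i} = {h \<in> {1..<i}. lookup m i \<le> lookup m h}"
    "{h \<in> {1..n}. h > i \<and> lookup m h > lookup m i} = {h \<in> {i<..n}. lookup m i < lookup m h}"
    using i by auto
  have leg: "Const (of_nat (leg' n m i)) * ?x = (\<Sum>j\<in>{1..<i}. if lookup m i \<le> lookup m j then ?x else 0)
      + (\<Sum>j\<in>{i<..n}. if lookup m i < lookup m j then ?x else 0)"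
    by (simp only: leg'_def s of_nat_add Const_add distrib_right sum_if_const finite_atLeastLessThan finite_greaterThanAtMost)
      (simp add: Const_def)
  have d: "Const alpha * (Var i * partial i ?x) = Const (alpha * of_nat (lookup m i)) * ?x"
    by (rule poly_mapping_eqI) (simp add: lookup_Const_mult lookup_Var_mult_partial lookup_single when_def)
  have "cherednik n i ?x - Const (spectral n m i) * ?x = ?f + ?g"
    by (simp only: spectral_def Const_diff left_diff_distrib leg cherednik_def d sum.distrib) simp
  also have "lower n m \<dots>"
    using i by (intro lower_add lower_sum lower_Nop_Var_left lower_Var_Nop_right) auto
  finally show ?thesis .
qed

lemma lookup_cherednik_top:
  assumes "i \<in> {1..n}" "\<And>\<mu>. \<mu> \<in> keys f \<Longrightarrow> weight n \<mu> \<le> weight n \<nu>"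
  shows "lookup (cherednik n i f) \<nu> = spectral n \<nu> i * lookup f \<nu>"
proof -
  have 1: "lookup (cherednik n i (single m 1)) \<nu> = (if m = \<nu> then spectral n \<nu> i else 0)" if "m \<in> keys f" for m
  proof -
    have "\<nu> \<notin> keys (cherednik n i (single m 1) - Const (spectral n m i) * single m 1)"
      using cherednik_triangular[OF assms(1), of m] assms(2)[OF that] by (auto simp: lower_def)
    then show ?thesis
      by (simp add: in_keys_iff lookup_minus lookup_Const_mult lookup_single when_def)
  qed
  have "lookup (cherednik n i f) \<nu> = (\<Sum>m\<in>keys f. lookup f m * lookup (cherednik n i (single m 1)) \<nu>)"
    by (subst linear_op_expand[OF linear_op_cherednik]) (simp add: lookup_sum lookup_Const_mult)
  also have "\<dots> = (\<Sum>m\<in>keys f. if m = \<nu> then spectral n \<nu> i * lookup f m else 0)"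
    by (intro sum.cong) (auto simp: 1)
  also have "\<dots> = spectral n \<nu> i * lookup f \<nu>"
    by (simp add: sum.delta in_keys_iff)
  finally show ?thesis .
qed

text \<open>At an exponent of maximal weight the operators act by its spectral values. Two such
  exponents would share a spectral vector, so there is only one.\<close>

lemma joint_eigenfunction_leading:
  assumes "f \<in> polys n" "f \<noteq> 0" "\<And>i. i \<in> {1..n} \<Longrightarrow> cherednik n i f = Const (\<kappa> i) * f"
  obtains \<nu> where "\<nu> \<in> keys f" "\<And>i. i \<in> {1..n} \<Longrightarrow> \<kappa> i = spectral n \<nu> i"
    "\<And>\<mu>. \<mu> \<in> keys f \<Longrightarrow> \<mu> \<noteq> \<nu> \<Longrightarrow> weight n \<mu> < weight n \<nu>"
proof -
  have "keys f \<noteq> {}" using assms(2) by (metis keys_eq_empty)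
  then have "Max (weight n ` keys f) \<in> weight n ` keys f" by (intro Max_in) auto
  then obtain \<nu> where \<nu>: "\<nu> \<in> keys f" "Max (weight n ` keys f) = weight n \<nu>" by auto
  then have \<nu>: "\<nu> \<in> keys f" "\<And>\<mu>. \<mu> \<in> keys f \<Longrightarrow> weight n \<mu> \<le> weight n \<nu>"
    by (metis Max_ge finite_imageI finite_keys image_eqI)+
  have top: "\<kappa> i = spectral n \<mu> i" if "\<mu> \<in> keys f" "weight n \<mu> = weight n \<nu>" "i \<in> {1..n}" for \<mu> i
    using lookup_cherednik_top[of i n f \<mu>] \<nu>(2) that assms(3)[of i]
    by (auto simp: lookup_Const_mult in_keys_iff)
  have "weight n \<mu> < weight n \<nu>" if "\<mu> \<in> keys f" "\<mu> \<noteq> \<nu>" for \<mu>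
  proof (rule ccontr)
    assume "\<not> ?thesis"
    then have "weight n \<mu> = weight n \<nu>" using \<nu>(2)[OF that(1)] by simp
    then have "lookup \<mu> i = lookup \<nu> i" if "i \<in> {1..n}" for i
      using top[OF \<open>\<mu> \<in> keys f\<close> _ that] top[OF \<nu>(1) refl that] by (metis spectral_inject)
    then have "\<mu> = \<nu>"
      using compositions_eqI[of \<mu> n \<nu>] assms(1) that(1) \<nu>(1) by (auto simp: polys_def)
    with that show False by simp
  qed
  with \<nu> top show ?thesis using that by blast
qed

section \<open>Uniqueness of joint eigenfunctions\<close>

definition is_jack :: "nat \<Rightarrow> expvec \<Rightarrow> mpol \<Rightarrow> bool" where
  "is_jack n \<gamma> f \<longleftrightarrow> f \<in> polys n \<and> (\<forall>i\<in>{1..n}. cherednik n i f = Const (spectral n \<gamma> i) * f) \<and> lookup f \<gamma> = 1"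

lemma polys_iff: "f \<in> polys n \<longleftrightarrow> (\<forall>m. m \<notin> compositions n \<longrightarrow> lookup f m = 0)"
  by (auto simp: polys_def in_keys_iff)

lemma polys_diff: "f \<in> polys n \<Longrightarrow> g \<in> polys n \<Longrightarrow> f - g \<in> polys n"
  by (simp add: polys_iff lookup_minus)

lemma polys_scale: "f \<in> polys n \<Longrightarrow> Const c * f \<in> polys n"
  by (simp add: polys_iff lookup_Const_mult)

text \<open>The leading exponent of a nonzero eigenfunction would have the spectrum of \<gamma>,
  hence be \<gamma>, where the coefficient is zero.\<close>

lemma eigenfunction_zeroI:
  assumes "f \<in> polys n" "\<gamma> \<in> compositions n" "lookup f \<gamma> = 0"
    "\<And>i. i \<in> {1..n} \<Longrightarrow> cherednik n i f = Const (spectral n \<gamma> i) * f"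
  shows "f = 0"
proof (rule ccontr)
  assume "f \<noteq> 0"
  from joint_eigenfunction_leading[OF assms(1) this assms(4)] obtain \<nu> where
    \<nu>: "\<nu> \<in> keys f" "\<And>i. i \<in> {1..n} \<Longrightarrow> spectral n \<gamma> i = spectral n \<nu> i" by metis
  then have "\<gamma> = \<nu>" using assms(1,2)
    by (intro compositions_eqI[of _ n] spectral_inject) (auto simp: polys_def)
  then show False using \<nu>(1) assms(3) by (simp add: in_keys_iff)
qed

lemma is_jack_eqI:
  assumes "\<gamma> \<in> compositions n" "is_jack n \<gamma> f" "is_jack n \<gamma> g"
  shows "f = g"
proof -
  have "f - g = 0"
    using assms by (intro eigenfunction_zeroI[of _ n \<gamma>])
      (auto simp: is_jack_def polys_diff lookup_minus linear_op_diff[OF linear_op_cherednik] right_diff_distrib)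
  then show ?thesis by simp
qed

lemma is_jack_lower:
  assumes "\<gamma> \<in> compositions n" "is_jack n \<gamma> f" "\<mu> \<in> keys f" "\<mu> \<noteq> \<gamma>"
  shows "weight n \<mu> < weight n \<gamma>"
proof -
  have j: "f \<in> polys n" "\<And>i. i \<in> {1..n} \<Longrightarrow> cherednik n i f = Const (spectral n \<gamma> i) * f"
    using assms(2) by (auto simp: is_jack_def)
  have "f \<noteq> 0" using assms(3) by auto
  from joint_eigenfunction_leading[OF j(1) this j(2)] obtain \<nu> where
    \<nu>: "\<nu> \<in> keys f" "\<And>i. i \<in> {1..n} \<Longrightarrow> spectral n \<gamma> i = spectral n \<nu> i"
     "\<And>\<mu>. \<mu> \<in> keys f \<Longrightarrow> \<mu> \<noteq> \<nu> \<Longrightarrow> weight n \<mu> < weight n \<nu>" by metis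
  then have "\<gamma> = \<nu>" using assms(1) j(1)
    by (intro compositions_eqI[of _ n] spectral_inject) (auto simp: polys_def)
  then show ?thesis using \<nu>(3) assms by simp
qed

section \<open>Construction of the nonsymmetric Jack polynomials\<close>

text \<open>A strict linear order on rows: larger entry first, ties broken by smaller index. The
  number \<open>leg'\<close> is the rank of a row, so it is preserved by whatever preserves this
  order.\<close>

definition beats :: "expvec \<Rightarrow> nat \<Rightarrow> nat \<Rightarrow> bool" where
  "beats \<gamma> h i \<longleftrightarrow> h < i \<and> lookup \<gamma> i \<le> lookup \<gamma> h \<or> i < h \<and> lookup \<gamma> i < lookup \<gamma> h"

lemma leg'_eq_card: "leg' n \<gamma> i = card {h \<in> {1..n}. beats \<gamma> h i}"
proof -
  have "{h \<in> {1..n}. beats \<gamma> h i} = {h \<in> {1..n}. h < i \<and> lookup \<gamma> h \<ge> lookup \<gamma> i}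
      \<union> {h \<in> {1..n}. h > i \<and> lookup \<gamma> h > lookup \<gamma> i}"
    by (auto simp: beats_def)
  moreover have "card ({h \<in> {1..n}. h < i \<and> lookup \<gamma> h \<ge> lookup \<gamma> i}
      \<union> {h \<in> {1..n}. h > i \<and> lookup \<gamma> h > lookup \<gamma> i}) = leg' n \<gamma> i"
    unfolding leg'_def by (rule card_Un_disjoint) auto
  ultimately show ?thesis by simp
qed

lemma leg'_bij:
  assumes "bij \<pi>" "\<pi> ` {1..n} = {1..n}" "\<And>h. h \<in> {1..n} \<Longrightarrow> beats \<mu> (\<pi> h) (\<pi> i) \<longleftrightarrow> beats \<gamma> h i"
  shows "leg' n \<mu> (\<pi> i) = leg' n \<gamma> i"
proof -
  have "{h \<in> {1..n}. beats \<mu> h (\<pi> i)} = \<pi> ` {h \<in> {1..n}. beats \<gamma> h i}"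
    using assms(3) by (subst (1) assms(2)[symmetric]) auto
  then show ?thesis
    using card_image[OF inj_on_subset[OF bij_is_inj[OF assms(1)] subset_UNIV]]
    by (simp add: leg'_eq_card)
qed

definition swap_exp :: "nat \<Rightarrow> expvec \<Rightarrow> expvec" where
  "swap_exp i = map_key (transpose i (Suc i))"

lemma lookup_swap_exp: "lookup (swap_exp i \<gamma>) j = lookup \<gamma> (transpose i (Suc i) j)"
  by (simp add: swap_exp_def lookup_map_key)

lemma swap_exp_swap_exp [simp]: "swap_exp i (swap_exp i \<gamma>) = \<gamma>"
  by (rule poly_mapping_eqI) (simp add: lookup_swap_exp)

lemma swap_exp_eq: "lookup \<gamma> i = lookup \<gamma> (Suc i) \<Longrightarrow> swap_exp i \<gamma> = \<gamma>"
  by (rule poly_mapping_eqI) (auto simp: lookup_swap_exp transpose_def)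

lemma swap_exp_compositions:
  "1 \<le> i \<Longrightarrow> i < n \<Longrightarrow> \<gamma> \<in> compositions n \<Longrightarrow> swap_exp i \<gamma> \<in> compositions n"
  by (auto simp: compositions_iff lookup_swap_exp transpose_def)

text \<open>Exchanging unequal neighbours keeps the ranking of all rows. For equal neighbours the
  tie is broken by position and the claim fails, which is why such passes must carry the factor
  zero.\<close>

lemma spectral_swap_exp:
  assumes "1 \<le> i" "i < n" "lookup \<gamma> i \<noteq> lookup \<gamma> (Suc i)"
  shows "spectral n (swap_exp i \<gamma>) (transpose i (Suc i) j) = spectral n \<gamma> j"
proof -
  have "leg' n (swap_exp i \<gamma>) (transpose i (Suc i) j) = leg' n \<gamma> j"
  proof (rule leg'_bij[OF bij_transpose])
    show "transpose i (Suc i) ` {1..n} = {1..n}" using assms by (intro transpose_image_Icc) auto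
    show "beats (swap_exp i \<gamma>) (transpose i (Suc i) h) (transpose i (Suc i) j) \<longleftrightarrow> beats \<gamma> h j" for h
      using assms by (auto simp: beats_def lookup_swap_exp) (auto simp: transpose_def split: if_splits)
  qed
  then show ?thesis by (simp add: spectral_def lookup_swap_exp)
qed

text \<open>Equal neighbours are consecutive in the ranking.\<close>

lemma spectral_diff_equal:
  assumes "1 \<le> i" "i < n" "lookup \<gamma> i = lookup \<gamma> (Suc i)"
  shows "spectral n \<gamma> i - spectral n \<gamma> (Suc i) = 1"
proof -
  have "{h \<in> {1..n}. beats \<gamma> h (Suc i)} = insert i {h \<in> {1..n}. beats \<gamma> h i}"
  proof (rule set_eqI)
    fix h
    consider "h < i" | "h = i" | "h = Suc i" | "Suc i < h" by linarith
    then show "h \<in> {h \<in> {1..n}. beats \<gamma> h (Suc i)} \<longleftrightarrow> h \<in> insert i {h \<in> {1..n}. beats \<gamma> h i}"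
      using assms by cases (auto simp: beats_def)
  qed
  moreover have "i \<notin> {h \<in> {1..n}. beats \<gamma> h i}" by (simp add: beats_def)
  ultimately have "leg' n \<gamma> (Suc i) = Suc (leg' n \<gamma> i)"
    by (simp add: leg'_eq_card)
  then show ?thesis using assms by (simp add: spectral_def)
qed

lemma spectral_diff_nonzero:
  assumes "1 \<le> i" "i < n"
  shows "spectral n \<gamma> i - spectral n \<gamma> (Suc i) \<noteq> 0"
proof (cases "lookup \<gamma> i = lookup \<gamma> (Suc i)")
  case True
  then show ?thesis using spectral_diff_equal[OF assms True] by simp
next
  case False
  then show ?thesis using spectral_inject[of n \<gamma> i \<gamma> "Suc i"] by auto
qed

text \<open>For n at least 1 and \<gamma> a composition, this is \<open>(\<gamma>\<^sub>2, ...,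
  \<gamma>\<^sub>n, \<gamma>\<^sub>1 + 1)\<close>.\<close>

definition rot_exp :: "nat \<Rightarrow> expvec \<Rightarrow> expvec" where
  "rot_exp n \<gamma> = map_key (inv (rot n)) \<gamma> + eps n"

lemma rot_eq_iff: "1 \<le> n \<Longrightarrow> rot n h = n \<longleftrightarrow> h = 1"
  by (auto simp: rot_def)

lemma lookup_rot_exp:
  "1 \<le> n \<Longrightarrow> lookup (rot_exp n \<gamma>) (rot n h) = lookup \<gamma> h + (if h = 1 then 1 else 0)"
  using bij_rot[of n]
  by (auto simp: rot_exp_def lookup_add lookup_map_key bij_imp_bij_inv bij_is_inj lookup_eps rot_eq_iff)

lemma lookup_rot_exp_explicit:
  assumes "1 \<le> n"
  shows "1 \<le> p \<Longrightarrow> p < n \<Longrightarrow> lookup (rot_exp n \<gamma>) p = lookup \<gamma> (Suc p)"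
    and "lookup (rot_exp n \<gamma>) n = lookup \<gamma> 1 + 1"
  using lookup_rot_exp[OF assms, of \<gamma> "Suc p"] lookup_rot_exp[OF assms, of \<gamma> 1] by (auto simp: rot_def)

lemma rot_exp_compositions:
  assumes "1 \<le> n" "\<gamma> \<in> compositions n"
  shows "rot_exp n \<gamma> \<in> compositions n"
  unfolding compositions_iff
proof (intro allI impI)
  fix j assume "j \<notin> {1..n}"
  then have "rot n j = j" "j \<noteq> 1" using assms(1) by (auto simp: rot_def)
  then show "lookup (rot_exp n \<gamma>) j = 0"
    using lookup_rot_exp[OF assms(1), of \<gamma> j] assms(2) \<open>j \<notin> {1..n}\<close> by (simp add: compositions_iff)
qed

text \<open>Row 1 wins all ties and the last row loses them; raising the moved entry by one
  compensates exactly, so the ranking is unchanged.\<close>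

lemma spectral_rot_exp:
  assumes "1 \<le> n" "i \<in> {1..n}"
  shows "spectral n (rot_exp n \<gamma>) (rot n i) = spectral n \<gamma> i + (if i = 1 then alpha else 0)"
proof -
  have "leg' n (rot_exp n \<gamma>) (rot n i) = leg' n \<gamma> i"
  proof (rule leg'_bij[OF bij_rot[OF assms(1)] rot_image[OF assms(1)]])
    fix h assume "h \<in> {1..n}"
    then show "beats (rot_exp n \<gamma>) (rot n h) (rot n i) \<longleftrightarrow> beats \<gamma> h i"
      unfolding beats_def lookup_rot_exp[OF assms(1)] using assms(2) by (auto simp: rot_def)
  qed
  then show ?thesis by (simp add: spectral_def lookup_rot_exp[OF assms(1)] algebra_simps)
qed

lemma polys_act_swap:
  assumes "1 \<le> i" "i < n" "f \<in> polys n"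
  shows "act (transpose i (Suc i)) f \<in> polys n"
  using assms swap_exp_compositions[OF assms(1,2)] swap_exp_swap_exp
  unfolding polys_iff lookup_act[OF bij_transpose] swap_exp_def[symmetric] by metis

lemma polys_raise:
  assumes "1 \<le> n" "f \<in> polys n"
  shows "raise n f \<in> polys n"
  unfolding polys_iff
proof (intro allI impI)
  fix m assume "m \<notin> compositions n"
  then obtain j where j: "j \<notin> {1..n}" "lookup m j \<noteq> 0" by (auto simp: compositions_iff)
  then have "rot n j = j" "j \<noteq> n" using assms(1) by (auto simp: rot_def)
  then have "lookup (map_key (rot n) (m - eps n)) j \<noteq> 0"
    using j by (simp add: lookup_map_key bij_rot[OF assms(1)] bij_is_inj lookup_minus lookup_eps)
  then have "map_key (rot n) (m - eps n) \<notin> compositions n" using j by (auto simp: compositions_iff)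
  then show "lookup (raise n f) m = 0"
    using assms by (simp add: raise_def lookup_Var_mult lookup_act bij_rot polys_iff)
qed

lemma is_jack_raise:
  assumes "1 \<le> n" "is_jack n \<gamma> f"
  shows "is_jack n (rot_exp n \<gamma>) (raise n f)"
  unfolding is_jack_def
proof (intro conjI ballI)
  have f: "f \<in> polys n" "\<And>i. i \<in> {1..n} \<Longrightarrow> cherednik n i f = Const (spectral n \<gamma> i) * f" "lookup f \<gamma> = 1"
    using assms(2) by (auto simp: is_jack_def)
  note lin = linear_op_raise[OF assms(1)]
  show "raise n f \<in> polys n" by (rule polys_raise[OF assms(1) f(1)])
  show "lookup (raise n f) (rot_exp n \<gamma>) = 1"
    using assms(1) f(3) by (simp add: raise_def lookup_Var_mult rot_exp_def lookup_add lookup_eps lookup_act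
        bij_rot map_key_inv_map_key)
  fix j assume j: "j \<in> {1..n}"
  show "cherednik n j (raise n f) = Const (spectral n (rot_exp n \<gamma>) j) * raise n f"
  proof (cases "j = n")
    case True
    then show ?thesis
      using cherednik_raise_last[OF assms(1), of f] f(2)[of 1] spectral_rot_exp[OF assms(1), of 1 \<gamma>] assms(1)
      by (simp add: rot_def linear_op_add[OF lin] linear_op_scale[OF lin] Const_add distrib_right)
  next
    case False
    then show ?thesis
      using cherednik_raise[of j n f] f(2)[of "Suc j"] spectral_rot_exp[OF assms(1), of "Suc j" \<gamma>] j
      by (simp add: rot_def linear_op_scale[OF lin])
  qed
qed

text \<open>The reflection of f is an eigenfunction up to the term f or -f of the cross relations.
  The subtracted multiple is the one whose change of eigenvalue cancels that term.\<close>

lemma intertwiner_eigen: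
  assumes "1 \<le> i" "i < n" "\<And>j. j \<in> {1..n} \<Longrightarrow> cherednik n j f = Const (\<kappa> j) * f"
    and "\<kappa> i \<noteq> \<kappa> (Suc i)" "j \<in> {1..n}"
    and g: "g = act (transpose i (Suc i)) f - Const (inverse (\<kappa> i - \<kappa> (Suc i))) * f"
  shows "cherednik n j g = Const (\<kappa> (transpose i (Suc i) j)) * g"
proof -
  let ?s = "act (transpose i (Suc i))"
  define c where "c = inverse (\<kappa> i - \<kappa> (Suc i))"
  note lin = linear_op_act[OF bij_transpose, of i "Suc i"] and ch = linear_op_cherednik[of n]
  have c: "c * \<kappa> i = 1 + c * \<kappa> (Suc i)"
  proof -
    have "c * (\<kappa> i - \<kappa> (Suc i)) = 1" using assms(4) by (simp add: c_def)
    then show ?thesis by (simp add: algebra_simps)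
  qed
  have expand: "cherednik n j g = cherednik n j (?s f) - Const c * (Const (\<kappa> j) * f)"
    using assms(3)[OF assms(5)] by (simp add: g c_def linear_op_diff[OF ch] linear_op_scale[OF ch])
  consider "j = i" | "j = Suc i" | "j \<noteq> i" "j \<noteq> Suc i" by blast
  then show ?thesis
  proof cases
    case 1
    have "cherednik n i (?s f) = Const (\<kappa> (Suc i)) * ?s f + f"
    proof -
      have "cherednik n (Suc i) f = Const (\<kappa> (Suc i)) * f" using assms(2) by (intro assms(3)) auto
      then show ?thesis
        using act_cherednik_right[OF assms(1,2), of f] by (simp add: linear_op_scale[OF lin])
    qed
    then have "cherednik n j g = Const (\<kappa> (Suc i)) * ?s f + f - Const (c * \<kappa> i) * f"
      using expand 1 by (simp add: Const_mult)
    also have "\<dots> = Const (\<kappa> (Suc i)) * ?s f - Const (\<kappa> (Suc i)) * (Const c * f)"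
      unfolding c by (simp add: Const_add Const_mult algebra_simps)
    finally show ?thesis using 1 by (simp add: g c_def right_diff_distrib)
  next
    case 2
    have "cherednik n (Suc i) (?s f) = Const (\<kappa> i) * ?s f - f"
    proof -
      have "cherednik n i f = Const (\<kappa> i) * f" using assms(1,2) by (intro assms(3)) auto
      then show ?thesis
        using act_cherednik_left[OF assms(1,2), of f] by (simp add: linear_op_scale[OF lin])
    qed
    then have "cherednik n j g = Const (\<kappa> i) * ?s f - (1 + Const (c * \<kappa> (Suc i))) * f"
      using expand 2 by (simp add: Const_mult algebra_simps)
    also have "1 + Const (c * \<kappa> (Suc i)) = Const (c * \<kappa> i)"
      by (simp add: c Const_add)
    finally show ?thesis using 2 by (simp add: g c_def right_diff_distrib Const_mult mult.commute mult.left_commute)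
  next
    case 3
    have "cherednik n j (?s f) = Const (\<kappa> j) * ?s f"
      using act_cherednik_other[OF assms(1,2,5) 3, of f] assms(3)[OF assms(5)]
      by (simp add: linear_op_scale[OF lin])
    then show ?thesis using expand 3 by (simp add: g c_def right_diff_distrib mult.left_commute transpose_apply_other)
  qed
qed

lemma weight_swap_exp:
  assumes "1 \<le> i" "i < n" "lookup \<gamma> i < lookup \<gamma> (Suc i)"
  shows "weight n \<gamma> < weight n (swap_exp i \<gamma>)"
proof -
  let ?m = "swap_exp i \<gamma>" and ?s = "lookup \<gamma> (Suc i) - lookup \<gamma> i"
  have "weight n (?m - single i ?s + single (Suc i) ?s) < weight n ?m"
    using assms by (intro weight_move) (auto simp: lookup_swap_exp)
  also have "?m - single i ?s + single (Suc i) ?s = \<gamma>"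
    using assms by (intro poly_mapping_eqI)
      (auto simp: lookup_swap_exp lookup_add lookup_minus lookup_single when_def transpose_def)
  finally show ?thesis .
qed

text \<open>The exchange raises the weight, so the new exponent does not occur in f. Its coefficient
  comes from the reflected term alone and is 1 without rescaling.\<close>

lemma is_jack_swap:
  assumes "1 \<le> i" "i < n" "\<gamma> \<in> compositions n" "is_jack n \<gamma> f" "lookup \<gamma> i < lookup \<gamma> (Suc i)"
  shows "is_jack n (swap_exp i \<gamma>)
    (act (transpose i (Suc i)) f - Const (inverse (spectral n \<gamma> i - spectral n \<gamma> (Suc i))) * f)"
  (is "is_jack _ _ ?g")
proof -
  have f: "f \<in> polys n" "\<And>i. i \<in> {1..n} \<Longrightarrow> cherednik n i f = Const (spectral n \<gamma> i) * f" "lookup f \<gamma> = 1"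
    using assms(4) by (auto simp: is_jack_def)
  have "?g \<in> polys n"
    using assms f by (simp add: polys_diff polys_scale polys_act_swap)
  moreover have "cherednik n j ?g = Const (spectral n (swap_exp i \<gamma>) j) * ?g" if j: "j \<in> {1..n}" for j
  proof -
    have "cherednik n j ?g = Const (spectral n \<gamma> (transpose i (Suc i) j)) * ?g"
      using spectral_diff_nonzero[OF assms(1,2), of \<gamma>] f(2) j
      by (intro intertwiner_eigen[OF assms(1,2), where \<kappa> = "spectral n \<gamma>"]) auto
    also have "spectral n \<gamma> (transpose i (Suc i) j) = spectral n (swap_exp i \<gamma>) j"
      using spectral_swap_exp[OF assms(1,2), of \<gamma> "transpose i (Suc i) j"] assms(5) by simp
    finally show ?thesis .
  qed
  moreover have "lookup ?g (swap_exp i \<gamma>) = 1"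
  proof -
    have "lookup f (swap_exp i \<gamma>) = 0"
      using is_jack_lower[OF assms(3,4), of "swap_exp i \<gamma>"] weight_swap_exp[OF assms(1,2,5)]
      by (metis in_keys_iff less_asym less_irrefl)
    moreover have "lookup (act (transpose i (Suc i)) f) (swap_exp i \<gamma>) = 1"
      using f(3) by (simp add: lookup_act flip: swap_exp_def)
    ultimately show ?thesis by (simp add: lookup_minus lookup_Const_mult)
  qed
  ultimately show ?thesis by (simp add: is_jack_def)
qed

lemma is_jack_0: "is_jack n 0 1"
proof -
  have "Nop i j 1 = 0" if "i \<noteq> j" for i j
    using Nop_eqI[OF that, of 0 1] by (simp flip: Const_1)
  moreover have "Nop i j (Var j) = - 1" if "i \<noteq> j" for i j
    using Nop_eqI[OF that, of "- 1" "Var j"] by (simp add: act_Var)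
  moreover have "Var i * partial i 1 = 0" for i
    by (rule poly_mapping_eqI) (simp add: lookup_Var_mult_partial lookup_one when_def)
  ultimately have "cherednik n i 1 = Const (- of_nat (i - 1))" for i
    by (simp add: cherednik_def Const_uminus) (simp add: Const_def)
  moreover have "leg' n 0 i = i - 1" if "i \<in> {1..n}" for i
  proof -
    have "{h \<in> {1..n}. beats 0 h i} = {1..<i}" using that by (auto simp: beats_def)
    then show ?thesis by (simp add: leg'_eq_card)
  qed
  ultimately show ?thesis
    by (simp add: is_jack_def spectral_def polys_iff lookup_one when_def) (auto simp: compositions_iff)
qed

text \<open>Induction on the degree. If row n is positive, the composition is a rotation of one of
  smaller degree; the general case reduces to this one by exchanges.\<close>

lemma is_jack_exists:
  assumes "1 \<le> n" "\<gamma> \<in> compositions n"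
  shows "\<exists>f. is_jack n \<gamma> f"
  using assms(2)
proof (induction "\<Sum>r\<in>{1..n}. lookup \<gamma> r" arbitrary: \<gamma>)
  case 0
  then have "\<gamma> = 0" by (intro compositions_eqI[of _ n]) (auto simp: compositions_iff)
  then show ?case using is_jack_0 by blast
next
  case (Suc d)
  \<comment> \<open>Inner induction on the distance k from the last nonzero row to row n.\<close>
  have step: "\<exists>f. is_jack n \<gamma> f" if "\<gamma> \<in> compositions n" "(\<Sum>r\<in>{1..n}. lookup \<gamma> r) = Suc d" "k < n"
    "0 < lookup \<gamma> (n - k)" "\<And>j. n - k < j \<Longrightarrow> lookup \<gamma> j = 0" for k \<gamma>
    using that
  proof (induction k arbitrary: \<gamma>)
    case 0
    \<comment> \<open>The preimage under \<open>rot_exp\<close>, that is \<open>(\<gamma>\<^sub>n -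
      1, \<gamma>\<^sub>1, ..., \<gamma>\<^sub>n\<^sub>-\<^sub>1)\<close>.\<close>
    define \<beta> where "\<beta> = map_key (rot n) (\<gamma> - eps n)"
    have b: "bij (rot n)" using bij_rot assms by simp
    have "map_key (inv (rot n)) \<beta> = \<gamma> - eps n" by (simp add: \<beta>_def map_key_map_key_inv b)
    then have \<gamma>: "\<gamma> = rot_exp n \<beta>"
      using eps_plus_minus[of \<gamma> n] 0(4) by (simp add: rot_exp_def add.commute)
    have \<beta>: "\<beta> \<in> compositions n"
      unfolding compositions_iff
    proof (intro allI impI)
      fix j assume "j \<notin> {1..n}"
      moreover then have "rot n j = j" using assms by (auto simp: rot_def)
      ultimately show "lookup \<beta> j = 0"
        using 0(1) by (simp add: \<beta>_def lookup_map_key b bij_is_inj lookup_minus compositions_iff)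
    qed
    have "(\<Sum>r\<in>{1..n}. lookup \<gamma> r) = (\<Sum>r\<in>{1..n}. lookup \<gamma> (rot n r))"
      using rot_image[OF assms(1)] inj_on_subset[OF bij_is_inj[OF b]]
      by (metis sum.reindex_cong subset_UNIV)
    also have "\<dots> = (\<Sum>r\<in>{1..n}. lookup \<beta> r) + 1"
      unfolding \<gamma> lookup_rot_exp[OF assms(1)] using assms(1) by (simp add: sum.distrib sum.delta)
    finally have "d = (\<Sum>r\<in>{1..n}. lookup \<beta> r)" using 0(2) by simp
    from Suc.hyps(1)[OF this \<beta>] show ?case
      using is_jack_raise[OF assms(1)] \<gamma> by blast
  next
    case (Suc k)
    \<comment> \<open>The last nonzero row. Exchanging it with the zero row after it reduces k, and
      going back is an increasing exchange as \<open>is_jack_swap\<close> requires.\<close>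
    define i where "i = n - Suc k"
    have i: "1 \<le> i" "i < n" "n - k = Suc i" using Suc.prems(3) by (auto simp: i_def)
    let ?s = "transpose i (Suc i)"
    have "(\<Sum>r\<in>{1..n}. lookup (swap_exp i \<gamma>) r) = (\<Sum>r\<in>?s ` {1..n}. lookup \<gamma> r)"
      by (subst sum.reindex) (simp_all add: lookup_swap_exp inj_on_subset[OF inj_transpose])
    also have "?s ` {1..n} = {1..n}" using i by (intro transpose_image_Icc) auto
    finally have "(\<Sum>r\<in>{1..n}. lookup (swap_exp i \<gamma>) r) = Suc d" using Suc.prems(2) by simp
    moreover have "swap_exp i \<gamma> \<in> compositions n" using i Suc.prems(1) swap_exp_compositions by blast
    moreover have "lookup (swap_exp i \<gamma>) j = 0" if "n - k < j" for j
      using that i Suc.prems(5)[of j] by (simp add: lookup_swap_exp transpose_apply_other i_def)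
    ultimately obtain f where "is_jack n (swap_exp i \<gamma>) f"
      using Suc.IH[of "swap_exp i \<gamma>"] Suc.prems(3,4) i by (auto simp: lookup_swap_exp i_def)
    moreover have "lookup (swap_exp i \<gamma>) i < lookup (swap_exp i \<gamma>) (Suc i)"
      using Suc.prems(4) Suc.prems(5)[of "Suc i"] by (simp add: lookup_swap_exp i_def)
    ultimately show ?case
      using is_jack_swap[OF i(1,2) \<open>swap_exp i \<gamma> \<in> compositions n\<close>] by (metis swap_exp_swap_exp)
  qed
  define m where "m = Max (keys \<gamma>)"
  have "\<gamma> \<noteq> 0" using Suc.hyps(2) by auto
  then have ne: "keys \<gamma> \<noteq> {}" by (metis keys_eq_empty)
  then have m: "m \<in> keys \<gamma>" by (simp add: m_def)
  then have "m \<in> {1..n}" using Suc.prems by (auto simp: compositions_def)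
  moreover have "lookup \<gamma> j = 0" if "m < j" for j
  proof (rule ccontr)
    assume "lookup \<gamma> j \<noteq> 0"
    then have "j \<le> m" unfolding m_def by (intro Max_ge) (auto simp: in_keys_iff)
    with that show False by simp
  qed
  ultimately show ?case
    using m by (intro step[of \<gamma> "n - m"] Suc.prems Suc.hyps(2)[symmetric]) (auto simp: in_keys_iff)
qed

lemma jackE_is_jack:
  assumes "1 \<le> n" "\<gamma> \<in> compositions n"
  shows "is_jack n \<gamma> (jackE n \<gamma>)"
proof -
  obtain f where "is_jack n \<gamma> f" using is_jack_exists[OF assms] by blast
  then have "\<exists>!f. is_jack n \<gamma> f" using is_jack_eqI[OF assms(2)] by blast
  from theI'[OF this] show ?thesis by (simp add: jackE_def is_jack_def)
qed

lemma jackE_eqI: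
  assumes "1 \<le> n" "\<gamma> \<in> compositions n" "is_jack n \<gamma> f"
  shows "jackE n \<gamma> = f"
  using is_jack_eqI[OF assms(2) jackE_is_jack[OF assms(1,2)] assms(3)] .

lemma raise_jackE:
  assumes "1 \<le> n" "\<gamma> \<in> compositions n"
  shows "raise n (jackE n \<gamma>) = jackE n (rot_exp n \<gamma>)"
  using jackE_eqI[OF assms(1) rot_exp_compositions is_jack_raise] jackE_is_jack assms by metis

text \<open>Coefficient of the exchanged term, for a standing entry a and an incoming entry b. It is
  1 when the exchange raises the weight; the value for a > b is forced because the reflection is an
  involution.\<close>

definition move_factor :: "nat \<Rightarrow> nat \<Rightarrow> qalpha \<Rightarrow> qalpha" where
  "move_factor a b \<delta> = (if a = b then 0 else if a < b then 1 else 1 - (inverse \<delta>)\<^sup>2)"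

lemma act_swap_jackE:
  assumes "1 \<le> i" "i < n" "\<gamma> \<in> compositions n"
  defines "\<delta> \<equiv> spectral n \<gamma> i - spectral n \<gamma> (Suc i)"
  shows "act (transpose i (Suc i)) (jackE n \<gamma>) = Const (inverse \<delta>) * jackE n \<gamma>
    + Const (move_factor (lookup \<gamma> i) (lookup \<gamma> (Suc i)) \<delta>) * jackE n (swap_exp i \<gamma>)"
proof -
  have n: "1 \<le> n" using assms by simp
  let ?s = "act (transpose i (Suc i))"
  have E: "is_jack n \<mu> (jackE n \<mu>)" if "\<mu> \<in> compositions n" for \<mu> using jackE_is_jack[OF n that] .
  have up: "jackE n (swap_exp i \<mu>) = ?s (jackE n \<mu>) - Const (inverse (spectral n \<mu> i - spectral n \<mu> (Suc i))) * jackE n \<mu>"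
    if "\<mu> \<in> compositions n" "lookup \<mu> i < lookup \<mu> (Suc i)" for \<mu>
    using jackE_eqI[OF n swap_exp_compositions[OF assms(1,2) that(1)] is_jack_swap[OF assms(1,2) that(1) E[OF that(1)] that(2)]] .
  consider "lookup \<gamma> i = lookup \<gamma> (Suc i)" | "lookup \<gamma> i < lookup \<gamma> (Suc i)" | "lookup \<gamma> i > lookup \<gamma> (Suc i)"
    by linarith
  then show ?thesis
  proof cases
    case 1
    have \<delta>: "\<delta> = 1" using spectral_diff_equal[OF assms(1,2) 1] by (simp add: \<delta>_def)
    define g where "g = ?s (jackE n \<gamma>) - Const (inverse \<delta>) * jackE n \<gamma>"
    have f: "jackE n \<gamma> \<in> polys n" "\<And>i. i \<in> {1..n} \<Longrightarrow> cherednik n i (jackE n \<gamma>) = Const (spectral n \<gamma> i) * jackE n \<gamma>"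
      using E[OF assms(3)] by (auto simp: is_jack_def)
    have g: "cherednik n j g = Const (spectral n \<gamma> (transpose i (Suc i) j)) * g" if "j \<in> {1..n}" for j
      using spectral_diff_nonzero[OF assms(1,2), of \<gamma>] f(2) that
      by (intro intertwiner_eigen[OF assms(1,2), where \<kappa> = "spectral n \<gamma>"]) (auto simp: g_def \<delta>_def)
    have gp: "g \<in> polys n" using f(1) assms by (simp add: g_def polys_diff polys_scale polys_act_swap)
    \<comment> \<open>A nonzero g would have the spectral vector of \<gamma> with positions i and i
      + 1 exchanged. Its leading exponent would then have to be \<gamma>, whose two values
      differ.\<close>
    have "g = 0"
    proof (rule ccontr)
      assume "g \<noteq> 0"
      from joint_eigenfunction_leading[OF gp this g] obtain \<nu> where \<nu>: "\<nu> \<in> keys g"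
        "\<And>j. j \<in> {1..n} \<Longrightarrow> spectral n \<gamma> (transpose i (Suc i) j) = spectral n \<nu> j" by metis
      have "lookup \<nu> j = lookup \<gamma> (transpose i (Suc i) j)" if "j \<in> {1..n}" for j
        using \<nu>(2)[OF that] spectral_inject by metis
      then have "\<nu> = swap_exp i \<gamma>"
        using \<nu>(1) gp assms by (intro compositions_eqI[of _ n])
          (auto simp: lookup_swap_exp polys_def swap_exp_compositions)
      then have "\<nu> = \<gamma>" using swap_exp_eq[OF 1] by simp
      then show False using \<nu>(2)[of i] spectral_diff_nonzero[OF assms(1,2), of \<gamma>] assms by simp
    qed
    then show ?thesis using 1 by (simp add: g_def move_factor_def)
  next
    case 2
    then show ?thesis using up[OF assms(3) 2] by (simp add: move_factor_def \<delta>_def)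
  next
    case 3
    \<comment> \<open>The exchanged composition falls under the increasing case. Applying the
      reflection to that formula again solves for the image of
      \<open>jackE n \<gamma>\<close>.\<close>
    let ?\<mu> = "swap_exp i \<gamma>"
    have c: "?\<mu> \<in> compositions n" using assms swap_exp_compositions by blast
    have \<delta>: "spectral n ?\<mu> i - spectral n ?\<mu> (Suc i) = - \<delta>"
      using spectral_swap_exp[OF assms(1,2), of \<gamma> "Suc i"] spectral_swap_exp[OF assms(1,2), of \<gamma> i] 3
      by (simp add: \<delta>_def)
    have "jackE n \<gamma> = ?s (jackE n ?\<mu>) + Const (inverse \<delta>) * jackE n ?\<mu>"
      using up[OF c] 3 by (simp add: lookup_swap_exp \<delta> Const_uminus)
    then have s: "?s (jackE n ?\<mu>) = jackE n \<gamma> - Const (inverse \<delta>) * jackE n ?\<mu>" by simp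
    have lin: "linear_op ?s" by (simp add: linear_op_act)
    have "?s (?s (jackE n ?\<mu>)) = ?s (jackE n \<gamma>) - Const (inverse \<delta>) * ?s (jackE n ?\<mu>)"
      using arg_cong[OF s, of ?s] by (simp only: linear_op_diff[OF lin] linear_op_scale[OF lin])
    then have "jackE n ?\<mu> = ?s (jackE n \<gamma>) - Const (inverse \<delta>) * ?s (jackE n ?\<mu>)"
      by (simp only: act_swap_swap)
    then have "jackE n ?\<mu> = ?s (jackE n \<gamma>) - Const (inverse \<delta>) * (jackE n \<gamma> - Const (inverse \<delta>) * jackE n ?\<mu>)"
      by (simp only: s)
    then have "?s (jackE n \<gamma>) = jackE n ?\<mu> + Const (inverse \<delta>) * (jackE n \<gamma> - Const (inverse \<delta>) * jackE n ?\<mu>)"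
      by (simp only: eq_diff_eq)
    then show ?thesis using 3
      by (simp add: move_factor_def Const_diff Const_mult power2_eq_square algebra_simps)
  qed
qed

section \<open>Chains of adjacent transpositions\<close>

text \<open>At the heaviest index with a nonzero coefficient, no other Jack polynomial of the sum
  contributes to the monomial of that exponent.\<close>

lemma jackE_independent:
  assumes n: "1 \<le> n" and A: "finite A" "A \<subseteq> compositions n"
    and zero: "(\<Sum>\<mu>\<in>A. Const (c \<mu>) * jackE n \<mu>) = 0" and \<mu>: "\<mu> \<in> A"
  shows "c \<mu> = 0"
proof (rule ccontr)
  assume "c \<mu> \<noteq> 0"
  define B where "B = {\<mu> \<in> A. c \<mu> \<noteq> 0}"
  have B: "finite B" "B \<noteq> {}" using A \<mu> \<open>c \<mu> \<noteq> 0\<close> by (auto simp: B_def)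
  then have "Max (weight n ` B) \<in> weight n ` B" by (intro Max_in) auto
  then obtain \<nu> where "\<nu> \<in> B" "Max (weight n ` B) = weight n \<nu>" by auto
  then have \<nu>: "\<nu> \<in> B" "\<And>\<rho>. \<rho> \<in> B \<Longrightarrow> weight n \<rho> \<le> weight n \<nu>"
    using B by (metis Max_ge finite_imageI image_eqI)+
  have "c \<rho> * lookup (jackE n \<rho>) \<nu> = (if \<rho> = \<nu> then c \<rho> else 0)" if "\<rho> \<in> A" for \<rho>
  proof -
    have j: "is_jack n \<rho> (jackE n \<rho>)" and \<rho>: "\<rho> \<in> compositions n"
      using jackE_is_jack[OF n] that A(2) by auto
    have "lookup (jackE n \<rho>) \<nu> = 0" if "\<rho> \<noteq> \<nu>" "c \<rho> \<noteq> 0"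
      using is_jack_lower[OF \<rho> j, of \<nu>] \<nu>(2)[of \<rho>] that \<open>\<rho> \<in> A\<close>
      by (force simp: B_def in_keys_iff)
    then show ?thesis using j by (auto simp: is_jack_def)
  qed
  then have "lookup (\<Sum>\<mu>\<in>A. Const (c \<mu>) * jackE n \<mu>) \<nu> = (\<Sum>\<rho>\<in>A. if \<rho> = \<nu> then c \<rho> else 0)"
    by (simp add: lookup_sum lookup_Const_mult)
  also have "\<dots> = c \<nu>"
    using \<nu>(1) A(1) by (simp add: B_def)
  finally show False using zero \<nu>(1) by (simp add: B_def)
qed

section \<open>Hooks and coefficients in the dual basis\<close>

lemma upper_hook_eq: "upper_hook n \<gamma> s = alpha * of_nat (Suc (arm \<gamma> s)) + of_nat (Suc (leg n \<gamma> s))"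
  by (simp add: upper_hook_def)

lemma lower_hook_eq: "lower_hook n \<gamma> s = alpha * of_nat (Suc (arm \<gamma> s)) + of_nat (leg n \<gamma> s)"
  by (simp add: lower_hook_def upper_hook_def)

lemma upper_hook_nonzero: "upper_hook n \<gamma> s \<noteq> 0"
  unfolding upper_hook_eq by (rule alpha_affine_nat_nonzero) simp

lemma lower_hook_nonzero: "lower_hook n \<gamma> s \<noteq> 0"
  unfolding lower_hook_eq by (rule alpha_affine_nat_nonzero) simp

lemma finite_diagram [simp]: "finite (diagram n \<gamma>)"
  by (simp add: diagram_def)

lemma upper_hooks_nonzero: "upper_hooks n \<gamma> \<noteq> 0"
  by (simp add: upper_hooks_def upper_hook_nonzero)

lemma lower_hooks_nonzero: "lower_hooks n \<gamma> \<noteq> 0"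
  by (simp add: lower_hooks_def lower_hook_nonzero)

text \<open>The source of the asymmetry in the formula: the factor at \<eta> is its upper hooks,
  while the target contributes its lower hooks.\<close>

lemma jackF_dual_eq: "jackF_dual n \<mu> = Const (inverse (lower_hooks n \<mu>)) * jackE n \<mu>"
proof -
  have "inverse (upper_hooks n \<mu> * lower_hooks n \<mu>) * upper_hooks n \<mu> = inverse (lower_hooks n \<mu>)"
    by (simp add: upper_hooks_nonzero lower_hooks_nonzero field_simps)
  then show ?thesis
    by (simp only: jackF_dual_def jackF_def flip: mult.assoc Const_mult)
qed

text \<open>The index map need not be injective, because the expansion will run over sets L, several
  of which may give one composition. Independence makes the description in
  \<open>pieri_coeff\<close> unique.\<close>

lemma lookup_pieri_coeff:
  assumes n: "1 \<le> n" and I: "finite I" "\<And>x. x \<in> I \<Longrightarrow> \<mu> x \<in> compositions n"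
    and prod: "jackF n (eps k) * jackF n \<eta> = (\<Sum>x\<in>I. Const (c x) * jackE n (\<mu> x))"
  shows "lookup (pieri_coeff n k \<eta>) \<nu> = (\<Sum>x\<in>I. if \<mu> x = \<nu> then c x * lower_hooks n \<nu> else 0)"
proof -
  define S :: "(expvec \<Rightarrow>\<^sub>0 qalpha) \<Rightarrow> mpol" where
    "S g = (\<Sum>\<mu>\<in>keys g. Const (lookup g \<mu>) * jackF_dual n \<mu>)" for g
  have S_add: "S (f + g) = S f + S g" for f g
    unfolding S_def by (rule setsum_keys_plus_distrib) (simp_all add: Const_add distrib_right)
  have S_sum: "S (sum f J) = (\<Sum>x\<in>J. S (f x))" for f :: "'a \<Rightarrow> _" and J
    by (induction J rule: infinite_finite_induct) (simp_all add: S_add, simp_all add: S_def)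
  have S_single: "S (single m a) = Const a * jackF_dual n m" for m a
    by (cases "a = 0") (simp_all add: S_def)
  define G where "G = (\<Sum>x\<in>I. single (\<mu> x) (c x * lower_hooks n (\<mu> x)))"
  have "keys G \<subseteq> (\<Union>x\<in>I. keys (single (\<mu> x) (c x * lower_hooks n (\<mu> x))))"
    unfolding G_def by (rule keys_sum)
  also have "\<dots> \<subseteq> compositions n" using I(2) by (auto split: if_splits)
  finally have keysG: "keys G \<subseteq> compositions n" .
  have SG: "jackF n (eps k) * jackF n \<eta> = S G"
    unfolding prod G_def S_sum S_single jackF_dual_eq
    by (simp add: lower_hooks_nonzero flip: mult.assoc Const_mult) (simp add: lower_hooks_nonzero mult.assoc)
  have unique: "g = G" if g: "keys g \<subseteq> compositions n" "S g = S G" for g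
  proof -
    let ?d = "g - G"
    have "S (?d + G) = S g" by simp
    then have "S ?d = 0" using S_add[of ?d G] g(2) by simp
    then have "(\<Sum>\<mu>\<in>keys ?d. Const (lookup ?d \<mu> * inverse (lower_hooks n \<mu>)) * jackE n \<mu>) = 0"
      by (simp add: S_def jackF_dual_eq Const_mult mult.assoc)
    moreover have "keys ?d \<subseteq> compositions n"
    proof
      fix t assume "t \<in> keys ?d"
      then have "lookup g t \<noteq> 0 \<or> lookup G t \<noteq> 0" by (auto simp: in_keys_iff lookup_minus)
      then show "t \<in> compositions n" using g(1) keysG by (auto simp: in_keys_iff)
    qed
    ultimately have "lookup ?d \<mu> * inverse (lower_hooks n \<mu>) = 0" if "\<mu> \<in> keys ?d" for \<mu>
      using jackE_independent[OF n finite_keys, where c = "\<lambda>\<mu>. lookup ?d \<mu> * inverse (lower_hooks n \<mu>)"] that by blast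
    then have "\<mu> \<notin> keys ?d" for \<mu>
      by (metis in_keys_iff inverse_nonzero_iff_nonzero lower_hooks_nonzero mult_eq_0_iff)
    then have "?d = 0" by (metis keys_eq_empty ex_in_conv)
    then show ?thesis by simp
  qed
  have "pieri_coeff n k \<eta> = G"
    unfolding pieri_coeff_def SG S_def[symmetric]
    by (rule the_equality) (simp add: keysG, metis unique)
  then show ?thesis
    by (auto simp: G_def lookup_sum lookup_single when_def intro!: sum.cong)
qed

text \<open>The product of adjacent transpositions
  \<open>s\<^sub>m \<cdots> s\<^sub>i\<^sub>-\<^sub>1\<close> for m at most i, the last factor
  acting first; an entry at i is moved down to m.\<close>

definition cycle_down :: "nat \<Rightarrow> nat \<Rightarrow> nat \<Rightarrow> nat" where
  "cycle_down m i p = (if p = i then m else if m \<le> p \<and> p < i then Suc p else p)"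

lemma bij_cycle_down: "m \<le> i \<Longrightarrow> bij (cycle_down m i)"
  by (rule o_bij[where g = "\<lambda>p. if p = m then i else if m < p \<and> p \<le> i then p - 1 else p"])
    (auto simp: fun_eq_iff cycle_down_def)

lemma cycle_down_step: "m < i \<Longrightarrow> cycle_down m i = transpose m (Suc m) \<circ> cycle_down (Suc m) i"
  by (auto simp: fun_eq_iff cycle_down_def transpose_def)

lemma act_cycle_down_step: "m < i \<Longrightarrow> act (cycle_down m i) f = act (transpose m (Suc m)) (act (cycle_down (Suc m) i) f)"
  by (subst act_act) (simp_all add: bij_cycle_down cycle_down_step)

text \<open>The three permutations compose to the identity, so only the factor \<open>Var n\<close>
  of \<open>raise\<close>, carried to index i, remains.\<close>

lemma Var_mult_eq_raise:
  assumes "1 \<le> i" "i \<le> n"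
  shows "Var i * f = act (cycle_down i n) (raise n (act (cycle_down 1 i) f))"
proof -
  have b: "bij (cycle_down i n)" "bij (rot n)" "bij (cycle_down 1 i)" using assms by (auto simp: bij_cycle_down bij_rot)
  have "cycle_down i n \<circ> rot n \<circ> cycle_down 1 i = id"
    using assms by (auto simp: fun_eq_iff cycle_down_def rot_def)
  moreover have "cycle_down i n n = i" by (simp add: cycle_down_def)
  ultimately show ?thesis
    using b by (simp add: raise_def act_mult act_Var act_act bij_comp comp_assoc)
qed

text \<open>The original row of the entry travelling into position p: the nearest stop at or after
  p, or the start i.\<close>

definition next_stop :: "nat set \<Rightarrow> nat \<Rightarrow> nat \<Rightarrow> nat" where
  "next_stop S i p = (LEAST q. p \<le> q \<and> (q \<in> S \<or> q = i))"

lemma next_stop_here: "p \<in> S \<or> p = i \<Longrightarrow> next_stop S i p = p"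
  unfolding next_stop_def by (rule Least_equality) auto

lemma next_stop_later: "p \<notin> S \<Longrightarrow> p \<noteq> i \<Longrightarrow> next_stop S i p = next_stop S i (Suc p)"
  unfolding next_stop_def by (rule arg_cong[of _ _ Least]) (auto simp: fun_eq_iff Suc_le_eq le_less)

lemma next_stop_insert: "m < p \<Longrightarrow> next_stop (insert m S) i p = next_stop S i p"
  unfolding next_stop_def by (rule arg_cong[of _ _ Least]) (auto simp: fun_eq_iff)

text \<open>The arrangement once the traveller is at m. A stop at p - 1 leaves the arriving entry in
  row p; otherwise the entry of row p - 1 is pushed up to p. Polymorphic, to serve entries and
  spectral values alike.\<close>

definition shuffle :: "nat set \<Rightarrow> nat \<Rightarrow> nat \<Rightarrow> (nat \<Rightarrow> 'a) \<Rightarrow> nat \<Rightarrow> 'a" where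
  "shuffle S m i f p = (if p < m \<or> i < p then f p else if p = m then f (next_stop S i m)
     else if p - 1 \<in> S then f (next_stop S i p) else f (p - 1))"

lemma shuffle_init: "shuffle S i i f = f"
  by (auto simp: fun_eq_iff shuffle_def next_stop_here)

lemma shuffle_stay: "m < i \<Longrightarrow> m \<in> S \<Longrightarrow> shuffle S m i f = shuffle S (Suc m) i f"
  by (auto simp: fun_eq_iff shuffle_def next_stop_here less_Suc_eq)

lemma shuffle_move: "m < i \<Longrightarrow> m \<notin> S \<Longrightarrow> shuffle S m i f p = shuffle S (Suc m) i f (transpose m (Suc m) p)"
  by (auto simp: shuffle_def next_stop_later[of m S i] transpose_def)

lemma shuffle_insert: "m < k \<Longrightarrow> shuffle (insert m S) k i f p = shuffle S k i f p"
  by (auto simp: shuffle_def next_stop_insert)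

text \<open>Written with spectral values of the starting composition. This agrees with the
  intermediate ones as long as no earlier factor vanished.\<close>

definition chain_factor :: "nat \<Rightarrow> expvec \<Rightarrow> nat set \<Rightarrow> nat \<Rightarrow> nat \<Rightarrow> qalpha" where
  "chain_factor n \<gamma> S i r =
     (let q = next_stop S i (Suc r); \<delta> = spectral n \<gamma> r - spectral n \<gamma> q
      in if r \<in> S then inverse \<delta> else move_factor (lookup \<gamma> r) (lookup \<gamma> q) \<delta>)"

lemma sum_Pow_insert:
  assumes "finite A" "m \<notin> A"
  shows "(\<Sum>S\<in>Pow (insert m A). F S) = (\<Sum>S\<in>Pow A. F (insert m S) + F S)"
proof -
  have "inj_on (insert m) (Pow A)" using assms(2) by (auto simp: inj_on_def)
  moreover have "Pow A \<inter> insert m ` Pow A = {}" using assms(2) by auto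
  ultimately show ?thesis
    unfolding Pow_insert using assms(1)
    by (simp add: sum.union_disjoint sum.reindex sum.distrib add.commute)
qed

text \<open>For \<open>S \<subseteq> {m..<i}\<close> the entry at position \<open>i\<close> travels down to position \<open>m\<close>; at each
  \<open>r \<in> S\<close> it is left behind and the entry at \<open>r\<close> continues instead.\<close>

lemma act_cycle_down_jackE:
  assumes "1 \<le> m" "m \<le> i" "i \<le> n" "\<gamma> \<in> compositions n"
  obtains X where
    "act (cycle_down m i) (jackE n \<gamma>)
       = (\<Sum>S\<in>Pow {m..<i}. Const (\<Prod>r\<in>{m..<i}. chain_factor n \<gamma> S i r) * jackE n (X S))"
    "\<And>S. S \<subseteq> {m..<i} \<Longrightarrow> X S \<in> compositions n"
    "\<And>S. S \<subseteq> {m..<i} \<Longrightarrow> lookup (X S) = shuffle S m i (lookup \<gamma>)"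
    "\<And>S. S \<subseteq> {m..<i} \<Longrightarrow> (\<Prod>r\<in>{m..<i}. chain_factor n \<gamma> S i r) \<noteq> 0 \<Longrightarrow>
       spectral n (X S) = shuffle S m i (spectral n \<gamma>)"
proof -
  define C where "C k S = (\<Prod>r\<in>{k..<i}. chain_factor n \<gamma> S i r)" for k S
  have "1 \<le> m \<Longrightarrow> \<exists>X. act (cycle_down m i) (jackE n \<gamma>) = (\<Sum>S\<in>Pow {m..<i}. Const (C m S) * jackE n (X S))
     \<and> (\<forall>S. S \<subseteq> {m..<i} \<longrightarrow> X S \<in> compositions n \<and> lookup (X S) = shuffle S m i (lookup \<gamma>)
         \<and> (C m S \<noteq> 0 \<longrightarrow> spectral n (X S) = shuffle S m i (spectral n \<gamma>)))"
    using assms(2)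
  proof (induction m rule: inc_induct)
    case base
    have "cycle_down i i = id" by (auto simp: fun_eq_iff cycle_down_def)
    then have "act (cycle_down i i) f = f" for f by (simp only: act_id)
    then show ?case
      using assms by (intro exI[of _ "\<lambda>_. \<gamma>"]) (simp add: shuffle_init C_def)
  next
    case (step m)
    then obtain X where X: "act (cycle_down (Suc m) i) (jackE n \<gamma>) = (\<Sum>S\<in>Pow {Suc m..<i}. Const (C (Suc m) S) * jackE n (X S))"
      and X_comp: "\<And>S. S \<subseteq> {Suc m..<i} \<Longrightarrow> X S \<in> compositions n"
      and X_lookup: "\<And>S. S \<subseteq> {Suc m..<i} \<Longrightarrow> lookup (X S) = shuffle S (Suc m) i (lookup \<gamma>)"
      and X_spec: "\<And>S. S \<subseteq> {Suc m..<i} \<Longrightarrow> C (Suc m) S \<noteq> 0 \<Longrightarrow> spectral n (X S) = shuffle S (Suc m) i (spectral n \<gamma>)"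
      by auto
    have m: "1 \<le> m" "m < n" "m < i" using step assms by auto
    have ins: "{m..<i} = insert m {Suc m..<i}" using m by auto
    \<comment> \<open>Membership of m in S selects the unexchanged term of
      \<open>act_swap_jackE\<close>.\<close>
    define Y where "Y S = (if m \<in> S then X (S - {m}) else swap_exp m (X S))" for S
    have C_insert: "C m (insert m S) = C (Suc m) S * inverse (spectral n \<gamma> m - spectral n \<gamma> (next_stop S i (Suc m)))"
      and C_same: "C m S = C (Suc m) S * move_factor (lookup \<gamma> m) (lookup \<gamma> (next_stop S i (Suc m)))
          (spectral n \<gamma> m - spectral n \<gamma> (next_stop S i (Suc m)))"
      if S: "S \<subseteq> {Suc m..<i}" for S
    proof -
      have "m \<notin> S" using S by auto
      have "chain_factor n \<gamma> (insert m S) i r = chain_factor n \<gamma> S i r" if "r \<in> {Suc m..<i}" for r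
        using that by (simp add: chain_factor_def next_stop_insert Let_def)
      then have "C (Suc m) (insert m S) = C (Suc m) S" by (simp add: C_def)
      moreover have "C m T = chain_factor n \<gamma> T i m * C (Suc m) T" for T
        unfolding C_def ins by simp
      ultimately show "C m (insert m S) = C (Suc m) S * inverse (spectral n \<gamma> m - spectral n \<gamma> (next_stop S i (Suc m)))"
        "C m S = C (Suc m) S * move_factor (lookup \<gamma> m) (lookup \<gamma> (next_stop S i (Suc m)))
          (spectral n \<gamma> m - spectral n \<gamma> (next_stop S i (Suc m)))"
        using \<open>m \<notin> S\<close> by (simp_all add: chain_factor_def next_stop_insert Let_def mult.commute)
    qed
    have "act (cycle_down m i) (jackE n \<gamma>) = (\<Sum>S\<in>Pow {m..<i}. Const (C m S) * jackE n (Y S))"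
    proof -
      let ?s = "act (transpose m (Suc m))"
      have lin: "linear_op ?s" by (simp add: linear_op_act)
      have 1: "Const (C (Suc m) S) * ?s (jackE n (X S))
        = Const (C m (insert m S)) * jackE n (Y (insert m S)) + Const (C m S) * jackE n (Y S)"
        if "S \<in> Pow {Suc m..<i}" for S
      \<comment> \<open>A zero coefficient leaves the spectral vector of \<open>X S\<close>
        undetermined, but it divides both new coefficients, so every term vanishes.\<close>
      proof (cases "C (Suc m) S = 0")
        case True
        then show ?thesis using that by (simp add: C_insert C_same)
      next
        case False
        have S: "S \<subseteq> {Suc m..<i}" "m \<notin> S" using that by auto
        have f: "shuffle S (Suc m) i f m = f m" "shuffle S (Suc m) i f (Suc m) = f (next_stop S i (Suc m))" for f :: "nat \<Rightarrow> 'b"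
          using m by (auto simp: shuffle_def)
        have Y: "Y (insert m S) = X S" "Y S = swap_exp m (X S)" using S by (auto simp: Y_def)
        show ?thesis
          unfolding act_swap_jackE[OF m(1,2) X_comp[OF S(1)]] X_lookup[OF S(1)] X_spec[OF S(1) False] f
            Y C_insert[OF S(1)] C_same[OF S(1)]
          by (simp add: Const_mult distrib_left mult.assoc)
      qed
      have "act (cycle_down m i) (jackE n \<gamma>) = (\<Sum>S\<in>Pow {Suc m..<i}. Const (C (Suc m) S) * ?s (jackE n (X S)))"
        unfolding act_cycle_down_step[OF m(3)] X by (simp only: linear_op_sum[OF lin] linear_op_scale[OF lin])
      also have "\<dots> = (\<Sum>S\<in>Pow {Suc m..<i}. Const (C m (insert m S)) * jackE n (Y (insert m S)) + Const (C m S) * jackE n (Y S))"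
        by (intro sum.cong refl 1)
      also have "\<dots> = (\<Sum>S\<in>Pow {m..<i}. Const (C m S) * jackE n (Y S))"
        unfolding ins by (rule sum_Pow_insert[symmetric]) auto
      finally show ?thesis .
    qed
    moreover have "Y S \<in> compositions n \<and> lookup (Y S) = shuffle S m i (lookup \<gamma>)
         \<and> (C m S \<noteq> 0 \<longrightarrow> spectral n (Y S) = shuffle S m i (spectral n \<gamma>))" if S: "S \<subseteq> {m..<i}" for S
    proof (cases "m \<in> S")
      case True
      define T where "T = S - {m}"
      have T: "S = insert m T" "T \<subseteq> {Suc m..<i}" "m \<notin> T" "Y S = X T"
        using S True m by (auto simp: T_def Y_def ins)
      have "shuffle S m i f = shuffle T (Suc m) i f" for f :: "nat \<Rightarrow> 'b"
        using T m by (auto simp: shuffle_stay fun_eq_iff shuffle_insert)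
      then show ?thesis
        using T X_comp[OF T(2)] X_lookup[OF T(2)] X_spec[OF T(2)] C_insert[OF T(2)]
        by (auto simp: fun_eq_iff shuffle_stay m shuffle_insert)
    next
      case False
      then have T: "S \<subseteq> {Suc m..<i}" "Y S = swap_exp m (X S)" using S by (auto simp: Y_def ins)
      have "Y S \<in> compositions n" using T X_comp swap_exp_compositions m by simp
      moreover have "lookup (Y S) = shuffle S m i (lookup \<gamma>)"
        using T m False by (simp add: fun_eq_iff lookup_swap_exp X_lookup shuffle_move)
      moreover have "spectral n (Y S) = shuffle S m i (spectral n \<gamma>)" if "C m S \<noteq> 0"
      proof
        fix j
        have "C (Suc m) S \<noteq> 0" and ne: "lookup \<gamma> m \<noteq> lookup \<gamma> (next_stop S i (Suc m))"
          using that C_same[OF T(1)] by (auto simp: move_factor_def)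
        then have "spectral n (X S) = shuffle S (Suc m) i (spectral n \<gamma>)" using X_spec T by simp
        moreover have "lookup (X S) m \<noteq> lookup (X S) (Suc m)"
          using ne m by (simp add: X_lookup[OF T(1)] shuffle_def)
        then have "spectral n (Y S) (transpose m (Suc m) (transpose m (Suc m) j)) = spectral n (X S) (transpose m (Suc m) j)"
          unfolding T(2) by (rule spectral_swap_exp[OF m(1,2)])
        ultimately show "spectral n (Y S) j = shuffle S m i (spectral n \<gamma>) j"
          using False m by (simp add: shuffle_move)
      qed
      ultimately show ?thesis by blast
    qed
    ultimately show ?case by blast
  qed
  then show ?thesis using that assms(1) unfolding C_def by blast
qed

section \<open>Multiplication by a variable\<close>

text \<open>A version of \<open>next_stop\<close> without a starting row: the nearest element of L
  after r, with default t from the last element on. One function thus serves every i in L.\<close>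

definition carry :: "nat set \<Rightarrow> (nat \<Rightarrow> 'a) \<Rightarrow> 'a \<Rightarrow> nat \<Rightarrow> 'a" where
  "carry L f t r = (if \<exists>q\<in>L. r < q then f (Min {q \<in> L. r < q}) else t)"

lemma carry_in: "finite L \<Longrightarrow> Suc r \<in> L \<Longrightarrow> carry L f t r = f (Suc r)"
proof -
  assume L: "finite L" "Suc r \<in> L"
  then have "Min {q \<in> L. r < q} = Suc r" by (intro Min_eqI) auto
  then show ?thesis using L by (auto simp: carry_def)
qed

lemma carry_notin: "Suc r \<notin> L \<Longrightarrow> carry L f t r = carry L f t (Suc r)"
proof -
  assume L: "Suc r \<notin> L"
  then have *: "r < q \<longleftrightarrow> Suc r < q" if "q \<in> L" for q using that by (metis Suc_lessD Suc_lessI)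
  then have "{q \<in> L. r < q} = {q \<in> L. Suc r < q}" by auto
  moreover from * have "(\<exists>q\<in>L. r < q) \<longleftrightarrow> (\<exists>q\<in>L. Suc r < q)" by blast
  ultimately show ?thesis by (simp add: carry_def)
qed

lemma carry_last: "L \<subseteq> {..r} \<Longrightarrow> carry L f t r = t"
  by (auto simp: carry_def)

lemma carry_0:
  assumes "L \<subseteq> {1..n}" "L \<noteq> {}"
  shows "carry L f t 0 = f (Min L)"
proof -
  have "\<forall>q\<in>L. 0 < q" using assms by auto
  then have "{q \<in> L. 0 < q} = L" "\<exists>q\<in>L. 0 < q" using assms(2) by auto
  then show ?thesis by (simp add: carry_def)
qed

text \<open>The entry passing row r on the complete journey. After the last element of L this is the
  entry of the first one, raised by the rotation.\<close>

definition carried :: "nat set \<Rightarrow> expvec \<Rightarrow> nat \<Rightarrow> nat" where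
  "carried L \<eta> = carry L (lookup \<eta>) (lookup \<eta> (Min L) + 1)"

definition carried_spectral :: "nat \<Rightarrow> nat set \<Rightarrow> expvec \<Rightarrow> nat \<Rightarrow> qalpha" where
  "carried_spectral n L \<eta> = carry L (spectral n \<eta>) (spectral n \<eta> (Min L) + alpha)"

section \<open>The operator c_L and maximality in terms of the travelling entry\<close>

lemma elt_mem: "finite L \<Longrightarrow> 1 \<le> p \<Longrightarrow> p \<le> card L \<Longrightarrow> elt L p \<in> L"
  using bij_betwE[OF elt_bij] by (metis atLeastAtMost_iff)

lemma elt_obtain: "finite L \<Longrightarrow> r \<in> L \<Longrightarrow> \<exists>p. 1 \<le> p \<and> p \<le> card L \<and> r = elt L p"
  using bij_betw_imp_surj_on[OF elt_bij] by (metis atLeastAtMost_iff imageE)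

lemma elt_less: "1 \<le> p \<Longrightarrow> p < q \<Longrightarrow> q \<le> card L \<Longrightarrow> elt L p < elt L q"
  unfolding elt_def by (intro sorted_wrt_nth_less[OF strict_sorted_list_of_set]) auto

lemma elt_less_iff:
  assumes "1 \<le> p" "p \<le> card L" "1 \<le> q" "q \<le> card L"
  shows "elt L p < elt L q \<longleftrightarrow> p < q"
  using elt_less[of p q L] elt_less[of q p L] assms by (metis less_asym less_irrefl linorder_neqE_nat)

lemma card_pos_finite: "L \<noteq> {} \<Longrightarrow> finite L \<Longrightarrow> 1 \<le> card L"
  by (simp add: Suc_le_eq card_gt_0_iff)

lemma elt_1: "finite L \<Longrightarrow> L \<noteq> {} \<Longrightarrow> elt L 1 = Min L"
proof -
  assume L: "finite L" "L \<noteq> {}"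
  have "Min L = elt L 1"
  proof (rule Min_eqI[OF L(1)])
    fix y assume "y \<in> L"
    then obtain p where "1 \<le> p" "p \<le> card L" "y = elt L p" using elt_obtain L by metis
    then show "elt L 1 \<le> y" using elt_less[of 1 p L] by (cases "p = 1") auto
  qed (use elt_mem[OF L(1), of 1] card_pos_finite[OF L(2,1)] in auto)
  then show ?thesis by simp
qed

lemma Min_greater_elt:
  assumes "finite L" "1 \<le> p" "p < card L"
  shows "Min {q \<in> L. elt L p < q} = elt L (p + 1)"
proof (rule Min_eqI)
  fix y assume "y \<in> {q \<in> L. elt L p < q}"
  then obtain q where q: "1 \<le> q" "q \<le> card L" "y = elt L q" "elt L p < elt L q"
    using elt_obtain assms(1) by (metis (mono_tags, lifting) mem_Collect_eq)
  then have "p < q" using elt_less_iff assms by auto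
  then show "elt L (p + 1) \<le> y"
    using elt_less[of "p + 1" q L] q by (cases "q = p + 1") auto
qed (use assms elt_mem[of L "p + 1"] elt_less[of p "p + 1" L] in auto)

lemma lookup_cop:
  assumes "L \<subseteq> {1..n}" "L \<noteq> {}"
  shows "lookup (cop L \<eta>) r = (if r \<in> L then carried L \<eta> r else lookup \<eta> r)"
proof (cases "r \<in> L")
  case True
  have fin: "finite L" using assms(1) finite_subset by blast
  obtain p where p: "1 \<le> p" "p \<le> card L" "r = elt L p" using elt_obtain[OF fin True] by blast
  show ?thesis
  proof (cases "p < card L")
    case True
    then have "\<exists>q\<in>L. r < q" using elt_mem[OF fin, of "p + 1"] elt_less[of p "p + 1" L] p by auto
    then show ?thesis
      using \<open>r \<in> L\<close> lookup_cop_inside[OF fin p(1,2)] True Min_greater_elt[OF fin p(1) True] p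
      by (simp add: carried_def carry_def)
  next
    case False
    have "\<not> r < q" if "q \<in> L" for q
    proof -
      obtain q' where "1 \<le> q'" "q' \<le> card L" "q = elt L q'" using elt_obtain[OF fin \<open>q \<in> L\<close>] by blast
      then show ?thesis using elt_less_iff[of p L q'] p False by auto
    qed
    then show ?thesis
      using \<open>r \<in> L\<close> lookup_cop_inside[OF fin p(1,2)] False p elt_1[OF fin assms(2)]
      by (auto simp: carried_def carry_def)
  qed
next
  case False
  then show ?thesis
    using lookup_cop_outside[of L r \<eta>] assms finite_subset[OF assms(1)] by simp
qed

lemma cop_compositions:
  assumes "L \<subseteq> {1..n}" "L \<noteq> {}" "\<eta> \<in> compositions n"
  shows "cop L \<eta> \<in> compositions n"
  unfolding compositions_iff lookup_cop[OF assms(1,2)] using assms by (auto simp: compositions_iff)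

text \<open>Before the first element of L, between neighbouring elements and after the last one, the
  passing entry is \<eta> at the first element, at the next element, and at the first element plus
  1. These are the values forbidden by (M1), (M2) and (M3).\<close>

lemma maximal_set_iff:
  "maximal_set n \<eta> L \<longleftrightarrow>
     L \<noteq> {} \<and> L \<subseteq> {1..n} \<and> (\<forall>r\<in>{1..n} - L. lookup \<eta> r \<noteq> carried L \<eta> r)"
proof (cases "L \<noteq> {} \<and> L \<subseteq> {1..n}")
  case True
  then have L: "L \<noteq> {}" "L \<subseteq> {1..n}" "finite L" using finite_subset by auto
  note c = card_pos_finite[OF L(1,3)] and e1 = elt_1[OF L(3,1)]
  have first: "elt L 1 \<le> q" if "q \<in> L" for q using that L by (simp only: e1) simp
  have last: "q \<le> elt L (card L)" if q: "q \<in> L" for q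
  proof -
    obtain p where "1 \<le> p" "p \<le> card L" "q = elt L p" using elt_obtain[OF L(3) q] by blast
    then show ?thesis using elt_less[of p "card L" L] by (cases "p = card L") auto
  qed
  have before: "carried L \<eta> r = lookup \<eta> (elt L 1)" if "r < elt L 1" for r
  proof -
    have "{q \<in> L. r < q} = L" using first that by force
    then show ?thesis using that elt_mem[OF L(3) order.refl c] by (auto simp: carried_def carry_def e1 simp del: One_nat_def)
  qed
  have after: "carried L \<eta> r = lookup \<eta> (elt L 1) + 1" if "elt L (card L) < r" for r
  proof -
    have "\<not> (\<exists>q\<in>L. r < q)" using last that by force
    then show ?thesis unfolding carried_def carry_def e1 by simp
  qed
  have between: "carried L \<eta> r = lookup \<eta> (elt L p) \<and> r \<notin> L"
    if p: "1 < p" "p \<le> card L" "elt L (p - 1) < r" "r < elt L p" for p r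
  proof -
    have *: "q \<in> L \<Longrightarrow> elt L (p - 1) < q \<Longrightarrow> elt L p \<le> q" for q
      using Min_greater_elt[OF L(3), of "p - 1"] p Min_le[of "{q \<in> L. elt L (p - 1) < q}" q] L(3) by auto
    then have "r \<notin> L" using p by force
    moreover have "Min {q \<in> L. r < q} = elt L p"
      using p L(3) * elt_mem[OF L(3), of p] by (intro Min_eqI) force+
    moreover have "\<exists>q\<in>L. r < q" using p elt_mem[OF L(3), of p] by auto
    ultimately show ?thesis by (simp add: carried_def carry_def)
  qed
  have "(\<forall>r\<in>{1..n} - L. lookup \<eta> r \<noteq> carried L \<eta> r)" if M: "maximal_set n \<eta> L"
  proof
    fix r assume r: "r \<in> {1..n} - L"
    consider "r < elt L 1" | "elt L (card L) < r" | "elt L 1 < r" "r < elt L (card L)"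
      using r elt_mem[OF L(3), of 1] elt_mem[OF L(3), of "card L"] c by (metis DiffE le_refl linorder_neqE_nat)
    then show "lookup \<eta> r \<noteq> carried L \<eta> r"
    proof cases
      case 1 then show ?thesis using before M r by (simp add: maximal_set_def)
    next
      case 2 then show ?thesis using after M r by (simp add: maximal_set_def)
    next
      case 3
      define p where "p = (LEAST p. r < elt L p \<and> 1 \<le> p)"
      have p: "r < elt L p \<and> 1 \<le> p" unfolding p_def by (rule LeastI[of _ "card L"]) (use 3 c in auto)
      have pc: "p \<le> card L" unfolding p_def by (rule Least_le) (use 3 c in auto)
      have "p \<noteq> 1" using 3 p by auto
      then have p1: "1 < p" using p by simp
      then have "\<not> (r < elt L (p - 1) \<and> 1 \<le> p - 1)"
        using not_less_Least[of "p - 1" "\<lambda>p. r < elt L p \<and> 1 \<le> p"] by (simp add: p_def)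
      then have "elt L (p - 1) \<le> r" using p1 by auto
      moreover have "elt L (p - 1) \<in> L" using p1 pc by (intro elt_mem[OF L(3)]) auto
      then have "elt L (p - 1) \<noteq> r" using r by auto
      ultimately have "elt L (p - 1) < r" by simp
      then show ?thesis using between[of p r] p pc p1 M by (simp add: maximal_set_def)
    qed
  qed
  moreover have "maximal_set n \<eta> L" if M: "\<forall>r\<in>{1..n} - L. lookup \<eta> r \<noteq> carried L \<eta> r"
    unfolding maximal_set_def
  proof (intro conjI ballI allI impI)
    fix i assume "i \<in> {1..n}" "i < elt L 1"
    then show "lookup \<eta> i \<noteq> lookup \<eta> (elt L 1)"
      using M before[of i] first[of i] by force
  next
    fix p i assume p: "1 < p \<and> p \<le> card L" "elt L (p - 1) < i \<and> i < elt L p"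
    then have "i \<in> {1..n}" using elt_mem[OF L(3), of p] L(2) by force
    moreover have b: "carried L \<eta> i = lookup \<eta> (elt L p)" "i \<notin> L" using between[of p i] p by auto
    ultimately have "lookup \<eta> i \<noteq> carried L \<eta> i" using M by blast
    then show "lookup \<eta> i \<noteq> lookup \<eta> (elt L p)" by (simp only: b(1) not_False_eq_True)
  next
    fix i assume i: "elt L (card L) < i \<and> i \<le> n"
    then have "i \<in> {1..n}" "i \<notin> L" using last[of i] by auto
    then have "lookup \<eta> i \<noteq> carried L \<eta> i" using M by blast
    then show "lookup \<eta> i \<noteq> lookup \<eta> (elt L 1) + 1" using i by (simp only: after not_False_eq_True)
  qed (use L in auto)
  ultimately show ?thesis using L by blast
next
  case False
  then show ?thesis by (auto simp: maximal_set_def)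
qed

text \<open>The common form of \<open>chain_factor\<close> in both halves of the journey, depending
  only on L and the row.\<close>

definition row_factor :: "nat \<Rightarrow> nat set \<Rightarrow> expvec \<Rightarrow> nat \<Rightarrow> qalpha" where
  "row_factor n L \<eta> r = (let \<delta> = spectral n \<eta> r - carried_spectral n L \<eta> r in
     if r \<in> L then inverse \<delta> else move_factor (lookup \<eta> r) (carried L \<eta> r) \<delta>)"

lemma next_stop_bounds: "p \<le> i \<Longrightarrow> p \<le> next_stop S i p \<and> next_stop S i p \<le> i"
  unfolding next_stop_def by (metis (mono_tags, lifting) LeastI Least_le)

lemma carry_eq_next_stop_below:
  assumes "finite L" "i \<in> L" "L \<inter> {..<i} = S" "r < i"
  shows "carry L f t r = f (next_stop S i (Suc r))"
proof -
  obtain d where "i = Suc r + d" using assms(4) by (metis less_iff_Suc_add add_Suc)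
  then show ?thesis
  proof (induction d arbitrary: r)
    case 0
    then show ?case using assms by (simp add: carry_in next_stop_here)
  next
    case (Suc d)
    then have "Suc r \<in> L \<longleftrightarrow> Suc r \<in> S" "Suc r \<noteq> i" using assms by auto
    then show ?case using Suc assms(1) by (cases "Suc r \<in> L") (auto simp: carry_in carry_notin next_stop_here next_stop_later)
  qed
qed

text \<open>The second half takes place after the rotation: row q < n then holds the original row q
  + 1, hence the shift between S and L, and row n holds the raised entry t.\<close>

lemma carry_eq_next_stop_above:
  assumes "finite L" "L \<subseteq> {1..n}" "\<And>q. i \<le> q \<Longrightarrow> q < n \<Longrightarrow> Suc q \<in> L \<longleftrightarrow> q \<in> S" "i \<le> r" "r \<le> n"
  shows "carry L f t r = (if next_stop S n r < n then f (Suc (next_stop S n r)) else t)"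
  using assms(5)
proof (induction r rule: inc_induct)
  case base
  then show ?case using assms(2) by (subst carry_last) (auto simp: next_stop_here)
next
  case (step q)
  then have "Suc q \<in> L \<longleftrightarrow> q \<in> S" using assms(3,4) by auto
  then show ?case using step assms(1) by (cases "q \<in> S") (auto simp: carry_in carry_notin next_stop_here next_stop_later)
qed

text \<open>S holds the stops below i, T those of the second half, in rotated positions. Row i is
  both start and end of the journey and is never passed or stopped at, so its factor is
  absent.\<close>

lemma act_raise_jackE_subset:
  assumes i: "1 \<le> i" "i \<le> n" and \<eta>: "\<eta> \<in> compositions n" and S: "S \<subseteq> {1..<i}"
    and X: "X \<in> compositions n" "lookup X = shuffle S 1 i (lookup \<eta>)"
    and X_spec: "(\<Prod>r\<in>{1..<i}. chain_factor n \<eta> S i r) \<noteq> 0 \<Longrightarrow> spectral n X = shuffle S 1 i (spectral n \<eta>)"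
  shows "Const (\<Prod>r\<in>{1..<i}. chain_factor n \<eta> S i r) * act (cycle_down i n) (raise n (jackE n X))
    = (\<Sum>T\<in>Pow {i..<n}. Const (\<Prod>r\<in>{1..n} - {i}. row_factor n (S \<union> {i} \<union> Suc ` T) \<eta> r)
        * jackE n (cop (S \<union> {i} \<union> Suc ` T) \<eta>))"
proof -
  have n: "1 \<le> n" using i by simp
  define \<zeta> where "\<zeta> = rot_exp n X"
  have \<zeta>: "\<zeta> \<in> compositions n" using rot_exp_compositions[OF n X(1)] by (simp add: \<zeta>_def)
  obtain Y where Y: "act (cycle_down i n) (jackE n \<zeta>)
       = (\<Sum>T\<in>Pow {i..<n}. Const (\<Prod>r\<in>{i..<n}. chain_factor n \<zeta> T n r) * jackE n (Y T))"
    and Y_comp: "\<And>T. T \<subseteq> {i..<n} \<Longrightarrow> Y T \<in> compositions n"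
    and Y_lookup: "\<And>T. T \<subseteq> {i..<n} \<Longrightarrow> lookup (Y T) = shuffle T i n (lookup \<zeta>)"
    by (rule act_cycle_down_jackE[OF i order.refl \<zeta>]) (rule that)
  define C where "C = (\<Prod>r\<in>{1..<i}. chain_factor n \<eta> S i r)"
  have summand: "Const C * (Const (\<Prod>r\<in>{i..<n}. chain_factor n \<zeta> T n r) * jackE n (Y T))
      = Const (\<Prod>r\<in>{1..n} - {i}. row_factor n (S \<union> {i} \<union> Suc ` T) \<eta> r) * jackE n (cop (S \<union> {i} \<union> Suc ` T) \<eta>)"
    if T: "T \<subseteq> {i..<n}" for T
  proof -
    define L where "L = S \<union> {i} \<union> Suc ` T"
    have L: "L \<subseteq> {1..n}" "i \<in> L" "L \<noteq> {}" using S T i by (auto simp: L_def)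
    then have fin: "finite L" using finite_subset by blast
    have mem_below: "r \<in> L \<longleftrightarrow> r \<in> S" if "r < i" for r using that T by (auto simp: L_def)
    have mem_above: "Suc r \<in> L \<longleftrightarrow> r \<in> T" if "i \<le> r" for r using that S by (auto simp: L_def)
    have LS: "L \<inter> {..<i} = S" using mem_below S by auto
    have below: "carry L f t r = f (next_stop S i (Suc r))" if "r < i" for f :: "nat \<Rightarrow> 'b" and t r
      by (rule carry_eq_next_stop_below[OF fin L(2) LS that])
    have above: "carry L f t r = (if next_stop T n r < n then f (Suc (next_stop T n r)) else t)"
      if "i \<le> r" "r \<le> n" for f :: "nat \<Rightarrow> 'b" and t r
      by (rule carry_eq_next_stop_above[OF fin L(1) mem_above that]) auto
    \<comment> \<open>The entry that finally reaches row 1 comes from the first element of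
      L.\<close>
    have Min: "next_stop S i (Suc 0) = Min L"
      using below[of 0 "\<lambda>x. x" 0] carry_0[OF L(1,3), of "\<lambda>x. x" 0] i by simp
    have shuffle_above: "shuffle S 1 i f (Suc q) = f (Suc q)" if "i \<le> q" for f :: "nat \<Rightarrow> 'b" and q
      using that by (simp add: shuffle_def)
    have shuffle_1: "shuffle S 1 i f 1 = f (Min L)" for f :: "nat \<Rightarrow> 'b"
      using i by (simp add: shuffle_def Min)
    have \<zeta>_lookup: "lookup \<zeta> q = (if q < n then lookup \<eta> (Suc q) else lookup \<eta> (Min L) + 1)" if "i \<le> q" "q \<le> n" for q
    proof (cases "q = n")
      case True
      then show ?thesis
        using lookup_rot_exp_explicit(2)[OF n, of X] shuffle_1[of "lookup \<eta>"] by (simp add: \<zeta>_def X(2))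
    next
      case False
      then show ?thesis
        using that i lookup_rot_exp_explicit(1)[OF n, of q X] shuffle_above[OF that(1), of "lookup \<eta>"]
        by (simp add: \<zeta>_def X(2))
    qed
    have \<zeta>_next_stop: "lookup \<zeta> (next_stop T n r) = carried L \<eta> r" if "i \<le> r" "r \<le> n" for r
      unfolding carried_def above[OF that] using \<zeta>_lookup[of "next_stop T n r"] next_stop_bounds[of r n T] that by simp
    have Y_eq: "Y T = cop L \<eta>"
    proof (rule compositions_eqI[OF Y_comp[OF T] cop_compositions[OF L(1,3) \<eta>]])
      fix p assume p: "p \<in> {1..n}"
      consider "p < i" | "p = i" | "i < p" by linarith
      then show "lookup (Y T) p = lookup (cop L \<eta>) p"
      proof cases
        case 1
        then have "lookup (Y T) p = shuffle S 1 i (lookup \<eta>) (Suc p)"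
          using lookup_rot_exp_explicit(1)[OF n, of p X] p i by (simp add: Y_lookup[OF T] shuffle_def[of T] \<zeta>_def X(2))
        then show ?thesis
          using 1 p mem_below[OF 1] by (simp add: lookup_cop[OF L(1,3)] shuffle_def carried_def below[OF 1])
      next
        case 2
        then show ?thesis
          using L(2) i \<zeta>_next_stop[of i] by (simp add: Y_lookup[OF T] lookup_cop[OF L(1,3)] shuffle_def)
      next
        case 3
        then obtain q where q: "p = Suc q" "i \<le> q" "q < n" using p by (cases p) auto
        then show ?thesis
          using \<zeta>_next_stop[of p] \<zeta>_lookup[of q] mem_above[of q] by (simp add: Y_lookup[OF T] lookup_cop[OF L(1,3)] shuffle_def)
      qed
    qed
    have C_eq: "(\<Prod>r\<in>{1..<i}. row_factor n L \<eta> r) = C"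
      unfolding C_def
    proof (rule prod.cong[OF refl])
      fix r assume "r \<in> {1..<i}"
      then show "row_factor n L \<eta> r = chain_factor n \<eta> S i r"
        using mem_below[of r] by (simp add: row_factor_def chain_factor_def carried_def carried_spectral_def Let_def below)
    qed
    \<comment> \<open>Without C nonzero the spectral vector of X is undetermined; for C = 0 both
      sides of \<open>summand\<close> vanish.\<close>
    have D_eq: "(\<Prod>r\<in>{i<..n}. row_factor n L \<eta> r) = (\<Prod>r\<in>{i..<n}. chain_factor n \<zeta> T n r)" if "C \<noteq> 0"
    proof -
      have spec: "spectral n X = shuffle S 1 i (spectral n \<eta>)" using that by (intro X_spec) (simp add: C_def)
      have \<zeta>_spec: "spectral n \<zeta> q = (if q < n then spectral n \<eta> (Suc q) else spectral n \<eta> (Min L) + alpha)"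
        if "i \<le> q" "q \<le> n" for q
      proof (cases "q = n")
        case True
        then show ?thesis using spectral_rot_exp[OF n, of 1 X] n i shuffle_1[of "spectral n \<eta>"]
          by (simp add: \<zeta>_def spec rot_def)
      next
        case False
        then show ?thesis using spectral_rot_exp[OF n, of "Suc q" X] n i that shuffle_above[OF that(1), of "spectral n \<eta>"]
          by (simp add: \<zeta>_def spec rot_def)
      qed
      have \<zeta>_spec_next_stop: "spectral n \<zeta> (next_stop T n r) = carried_spectral n L \<eta> r" if "i \<le> r" "r \<le> n" for r
        unfolding carried_spectral_def above[OF that] using \<zeta>_spec[of "next_stop T n r"] next_stop_bounds[of r n T] that by simp
      have "(\<Prod>r\<in>{i<..n}. row_factor n L \<eta> r) = (\<Prod>r\<in>{i..<n}. row_factor n L \<eta> (Suc r))"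
        by (rule prod.reindex_cong[of Suc]) (auto simp: image_Suc_atLeastLessThan)
      also have "\<dots> = (\<Prod>r\<in>{i..<n}. chain_factor n \<zeta> T n r)"
      proof (rule prod.cong[OF refl])
        fix r assume "r \<in> {i..<n}"
        then have r: "i \<le> r" "r < n" "i \<le> Suc r" "Suc r \<le> n" "r \<le> n" by auto
        show "row_factor n L \<eta> (Suc r) = chain_factor n \<zeta> T n r"
          unfolding row_factor_def chain_factor_def Let_def \<zeta>_spec_next_stop[OF r(3,4)] \<zeta>_next_stop[OF r(3,4)]
            \<zeta>_spec[OF r(1,5)] \<zeta>_lookup[OF r(1,5)] mem_above[OF r(1)]
          using r(2) by simp
      qed
      finally show ?thesis .
    qed
    have split: "{1..n} - {i} = {1..<i} \<union> {i<..n}" using i by auto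
    have "(\<Prod>r\<in>{1..n} - {i}. row_factor n L \<eta> r)
        = (\<Prod>r\<in>{1..<i}. row_factor n L \<eta> r) * (\<Prod>r\<in>{i<..n}. row_factor n L \<eta> r)"
      unfolding split by (rule prod.union_disjoint) auto
    then have "(\<Prod>r\<in>{1..n} - {i}. row_factor n L \<eta> r) = C * (\<Prod>r\<in>{i..<n}. chain_factor n \<zeta> T n r)"
      using C_eq D_eq by (cases "C = 0") auto
    then show ?thesis by (simp only: Y_eq Const_mult mult.assoc L_def[symmetric])
  qed
  have "Const C * act (cycle_down i n) (raise n (jackE n X))
    = (\<Sum>T\<in>Pow {i..<n}. Const C * (Const (\<Prod>r\<in>{i..<n}. chain_factor n \<zeta> T n r) * jackE n (Y T)))"
    unfolding raise_jackE[OF n X(1)] \<zeta>_def[symmetric] Y by (rule sum_distrib_left)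
  also have "\<dots> = (\<Sum>T\<in>Pow {i..<n}. Const (\<Prod>r\<in>{1..n} - {i}. row_factor n (S \<union> {i} \<union> Suc ` T) \<eta> r)
        * jackE n (cop (S \<union> {i} \<union> Suc ` T) \<eta>))"
    by (intro sum.cong refl summand) simp
  finally show ?thesis by (simp only: C_def)
qed

lemma Var_mult_jackE:
  assumes i: "i \<in> {1..n}" and \<eta>: "\<eta> \<in> compositions n"
  shows "Var i * jackE n \<eta>
    = (\<Sum>L\<in>{L. L \<subseteq> {1..n} \<and> i \<in> L}. Const (\<Prod>r\<in>{1..n} - {i}. row_factor n L \<eta> r) * jackE n (cop L \<eta>))"
proof -
  have i': "1 \<le> i" "i \<le> n" "1 \<le> n" using i by auto
  define F where "F L = Const (\<Prod>r\<in>{1..n} - {i}. row_factor n L \<eta> r) * jackE n (cop L \<eta>)" for L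
  obtain X where X: "act (cycle_down 1 i) (jackE n \<eta>)
       = (\<Sum>S\<in>Pow {1..<i}. Const (\<Prod>r\<in>{1..<i}. chain_factor n \<eta> S i r) * jackE n (X S))"
    and XS: "\<And>S. S \<subseteq> {1..<i} \<Longrightarrow> X S \<in> compositions n"
      "\<And>S. S \<subseteq> {1..<i} \<Longrightarrow> lookup (X S) = shuffle S 1 i (lookup \<eta>)"
      "\<And>S. S \<subseteq> {1..<i} \<Longrightarrow> (\<Prod>r\<in>{1..<i}. chain_factor n \<eta> S i r) \<noteq> 0 \<Longrightarrow>
         spectral n (X S) = shuffle S 1 i (spectral n \<eta>)"
    by (rule act_cycle_down_jackE[OF order.refl i'(1,2) \<eta>]) (rule that)
  have lin: "linear_op (\<lambda>f. act (cycle_down i n) (raise n f))"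
    by (rule linear_op_compose[OF linear_op_act[OF bij_cycle_down[OF i'(2)]] linear_op_raise[OF i'(3)]])
  have "Var i * jackE n \<eta> = (\<Sum>S\<in>Pow {1..<i}. Const (\<Prod>r\<in>{1..<i}. chain_factor n \<eta> S i r)
      * act (cycle_down i n) (raise n (jackE n (X S))))"
    unfolding Var_mult_eq_raise[OF i'(1,2)] X by (simp only: linear_op_sum[OF lin] linear_op_scale[OF lin])
  also have "\<dots> = (\<Sum>S\<in>Pow {1..<i}. \<Sum>T\<in>Pow {i..<n}. F (S \<union> {i} \<union> Suc ` T))"
  proof (rule sum.cong[OF refl])
    fix S assume "S \<in> Pow {1..<i}"
    then have "S \<subseteq> {1..<i}" by simp
    from act_raise_jackE_subset[OF i'(1,2) \<eta> this XS(1)[OF this] XS(2)[OF this] XS(3)[OF this]]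
    show "Const (\<Prod>r\<in>{1..<i}. chain_factor n \<eta> S i r) * act (cycle_down i n) (raise n (jackE n (X S)))
        = (\<Sum>T\<in>Pow {i..<n}. F (S \<union> {i} \<union> Suc ` T))"
      unfolding F_def .
  qed
  also have "\<dots> = (\<Sum>(S, T)\<in>Pow {1..<i} \<times> Pow {i..<n}. F (S \<union> {i} \<union> Suc ` T))"
    by (rule sum.cartesian_product)
  also have "\<dots> = (\<Sum>L\<in>{L. L \<subseteq> {1..n} \<and> i \<in> L}. F L)"
  \<comment> \<open>A set L containing i splits uniquely at i, its upper part being pulled back
    along the shift.\<close>
  proof (rule sum.reindex_bij_witness[where j = "\<lambda>(S, T). S \<union> {i} \<union> Suc ` T"
        and i = "\<lambda>L. (L \<inter> {1..<i}, {r \<in> {i..<n}. Suc r \<in> L})"])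
    fix L assume L: "L \<in> {L. L \<subseteq> {1..n} \<and> i \<in> L}"
    have "q \<in> Suc ` {r \<in> {i..<n}. Suc r \<in> L}" if "q \<in> L" "q \<notin> {1..<i}" "q \<noteq> i" for q
      using that L by (cases q) force+
    then have "L \<subseteq> L \<inter> {1..<i} \<union> {i} \<union> Suc ` {r \<in> {i..<n}. Suc r \<in> L}" by blast
    moreover have "L \<inter> {1..<i} \<union> {i} \<union> Suc ` {r \<in> {i..<n}. Suc r \<in> L} \<subseteq> L" using L by auto
    ultimately show "(case (L \<inter> {1..<i}, {r \<in> {i..<n}. Suc r \<in> L}) of (S, T) \<Rightarrow> S \<union> {i} \<union> Suc ` T) = L"
      unfolding prod.case by (rule subset_antisym[rotated])
  qed (use i' in auto)
  finally show ?thesis by (simp only: F_def)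
qed

section \<open>Hook identities\<close>

lemma carried_in: "finite L \<Longrightarrow> Suc r \<in> L \<Longrightarrow> carried L \<eta> r = lookup \<eta> (Suc r)"
  by (simp add: carried_def carry_in)

lemma carried_notin: "Suc r \<notin> L \<Longrightarrow> carried L \<eta> r = carried L \<eta> (Suc r)"
  unfolding carried_def by (rule carry_notin)

lemma carried_last: "L \<subseteq> {1..n} \<Longrightarrow> carried L \<eta> n = lookup \<eta> (Min L) + 1"
  unfolding carried_def by (rule carry_last) auto

lemma carried_0: "L \<subseteq> {1..n} \<Longrightarrow> L \<noteq> {} \<Longrightarrow> carried L \<eta> 0 = lookup \<eta> (Min L)"
  unfolding carried_def by (rule carry_0)

text \<open>As g is arbitrary, this is an equality of multisets. Reading rows from n downwards, a
  row of L takes the traveller and releases its own entry; other rows keep theirs.\<close>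

lemma sum_cop_suffix:
  fixes g :: "nat \<Rightarrow> int"
  assumes L: "L \<subseteq> {1..n}" "L \<noteq> {}" and r: "r \<le> n"
  shows "(\<Sum>h\<in>{r<..n}. g (lookup (cop L \<eta>) h)) + g (carried L \<eta> r)
    = (\<Sum>h\<in>{r<..n}. g (lookup \<eta> h)) + g (lookup \<eta> (Min L) + 1)"
  using r
proof (induction r rule: inc_induct)
  case base
  then show ?case using carried_last[OF L(1), of \<eta>] by simp
next
  case (step r)
  have fin: "finite L" using L(1) finite_subset by blast
  have s: "{r<..n} = insert (Suc r) {Suc r<..n}" using step by auto
  have sums: "(\<Sum>h\<in>{r<..n}. f h) = f (Suc r) + (\<Sum>h\<in>{Suc r<..n}. f h)" for f :: "nat \<Rightarrow> int"
    unfolding s by (rule sum.insert) auto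
  show ?case
    using step.IH unfolding sums lookup_cop[OF L]
    by (cases "Suc r \<in> L") (auto simp: carried_in[OF fin] carried_notin)
qed

lemma sum_cop:
  fixes g :: "nat \<Rightarrow> int"
  assumes L: "L \<subseteq> {1..n}" "L \<noteq> {}"
  shows "(\<Sum>h\<in>{1..n}. g (lookup (cop L \<eta>) h)) + g (lookup \<eta> (Min L))
    = (\<Sum>h\<in>{1..n}. g (lookup \<eta> h)) + g (lookup \<eta> (Min L) + 1)"
proof -
  have "{0<..n} = {1..n}" by auto
  then show ?thesis using sum_cop_suffix[OF L, of 0 g \<eta>] carried_0[OF L, of \<eta>] by simp
qed

text \<open>The shift for rows up to r mirrors the leg, which compares earlier rows by their entry
  plus one. Advancing the cut over a row of L again trades its entry for the traveller.\<close>

lemma sum_cop_cut: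
  fixes g :: "nat \<Rightarrow> int"
  assumes L: "L \<subseteq> {1..n}" "L \<noteq> {}" and r: "r \<le> n"
  defines "T \<equiv> \<lambda>\<gamma> r. \<Sum>h\<in>{1..n}. if h \<le> r then g (lookup \<gamma> h + 1) else g (lookup \<gamma> h)"
  shows "T (cop L \<eta>) r + g (carried L \<eta> r) = T \<eta> r + g (carried L \<eta> r + 1)"
  using r
proof (induction r)
  case 0
  have "(\<Sum>h\<in>{1..n}. if h \<le> 0 then g (lookup \<gamma> h + 1) else g (lookup \<gamma> h)) = (\<Sum>h\<in>{1..n}. g (lookup \<gamma> h))" for \<gamma>
    by (rule sum.cong) auto
  then show ?case
    using sum_cop[OF L, of g \<eta>] carried_0[OF L, of \<eta>] by (simp add: T_def)
next
  case (Suc r)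
  have fin: "finite L" using L(1) finite_subset by blast
  have step: "T \<gamma> (Suc r) = T \<gamma> r + (g (lookup \<gamma> (Suc r) + 1) - g (lookup \<gamma> (Suc r)))" for \<gamma>
  proof -
    have "T \<gamma> (Suc r) - T \<gamma> r
      = (\<Sum>h\<in>{1..n}. if h = Suc r then g (lookup \<gamma> h + 1) - g (lookup \<gamma> h) else 0)"
      unfolding T_def sum_subtractf[symmetric] by (rule sum.cong) auto
    also have "\<dots> = g (lookup \<gamma> (Suc r) + 1) - g (lookup \<gamma> (Suc r))"
      using Suc.prems by (simp add: sum.delta)
    finally show ?thesis by simp
  qed
  have "T (cop L \<eta>) r + g (carried L \<eta> r) = T \<eta> r + g (carried L \<eta> r + 1)"
    using Suc by simp
  then show ?case
    unfolding step lookup_cop[OF L]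
    by (cases "Suc r \<in> L") (auto simp: carried_in[OF fin] carried_notin)
qed

text \<open>Legs are the case of an interval indicator; for general g the legs of \<eta> and of its
  image are compared by one identity.\<close>

definition side_sum :: "nat \<Rightarrow> expvec \<Rightarrow> nat \<Rightarrow> (nat \<Rightarrow> int) \<Rightarrow> int" where
  "side_sum n \<gamma> r g = (\<Sum>h\<in>{1..n} - {r}. if h < r then g (lookup \<gamma> h + 1) else g (lookup \<gamma> h))"

lemma side_sum_cop:
  assumes L: "L \<subseteq> {1..n}" "L \<noteq> {}" and r: "r \<in> {1..n}"
  shows "side_sum n (cop L \<eta>) r g + g (lookup (cop L \<eta>) r + 1) + g (carried L \<eta> r)
    = side_sum n \<eta> r g + g (lookup \<eta> r + 1) + g (carried L \<eta> r + 1)"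
proof -
  have "(\<Sum>h\<in>{1..n}. if h \<le> r then g (lookup \<gamma> h + 1) else g (lookup \<gamma> h))
     = side_sum n \<gamma> r g + g (lookup \<gamma> r + 1)" for \<gamma>
  proof -
    have "(\<Sum>h\<in>{1..n} - {r}. if h \<le> r then g (lookup \<gamma> h + 1) else g (lookup \<gamma> h)) = side_sum n \<gamma> r g"
      unfolding side_sum_def by (rule sum.cong) auto
    then show ?thesis by (subst sum.remove[OF _ r]) simp_all
  qed
  then show ?thesis using sum_cop_cut[OF L, of r g \<eta>] r by simp
qed

lemma card_sides:
  "int (card {h \<in> {1..n}. h < r \<and> P (lookup \<gamma> h + 1)} + card {h \<in> {1..n}. r < h \<and> P (lookup \<gamma> h)})
    = side_sum n \<gamma> r (\<lambda>x. if P x then 1 else 0)"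
proof -
  let ?A = "{h \<in> {1..n} - {r}. if h < r then P (lookup \<gamma> h + 1) else P (lookup \<gamma> h)}"
  let ?B = "{h \<in> {1..n}. h < r \<and> P (lookup \<gamma> h + 1)}"
  let ?C = "{h \<in> {1..n}. r < h \<and> P (lookup \<gamma> h)}"
  have A: "?A = ?B \<union> ?C" by auto
  have cards: "card ?A = card ?B + card ?C"
    unfolding A by (rule card_Un_disjoint) auto
  have "side_sum n \<gamma> r (\<lambda>x. if P x then 1 else 0)
      = (\<Sum>h\<in>{1..n} - {r}. if (if h < r then P (lookup \<gamma> h + 1) else P (lookup \<gamma> h)) then 1 else 0)"
    unfolding side_sum_def by (rule sum.cong[OF refl]) simp
  also have "\<dots> = int (card ?A)"
    by (subst sum_if_const) simp_all
  finally show ?thesis by (simp only: cards)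
qed

lemma leg_eq_side_sum:
  "int (leg n \<gamma> (r, j)) = side_sum n \<gamma> r (\<lambda>x. if j \<le> x \<and> x \<le> lookup \<gamma> r then 1 else 0)"
  unfolding leg_def using card_sides[of n r "\<lambda>x. j \<le> x \<and> x \<le> lookup \<gamma> r" \<gamma>] by simp

lemma prod_replace:
  fixes f :: "nat \<Rightarrow> 'a :: field"
  assumes "finite A" "a \<in> A" "f a \<noteq> 0"
  shows "(\<Prod>j\<in>A. if j = a then c else f j) = (\<Prod>j\<in>A. f j) * (c / f a)"
proof -
  have "(\<Prod>j\<in>A - {a}. if j = a then c else f j) = (\<Prod>j\<in>A - {a}. f j)"
    by (rule prod.cong) auto
  then show ?thesis using assms by (simp add: prod.remove[OF assms(1,2)])
qed

section \<open>Spectral differences as hooks for a maximal set\<close>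

locale maximal =
  fixes n :: nat and \<eta> :: expvec and L :: "nat set"
  assumes max: "maximal_set n \<eta> L"
begin

lemma L: "L \<subseteq> {1..n}" "L \<noteq> {}" "finite L"
  using max finite_subset by (auto simp: maximal_set_iff)

lemma avoid: "r \<in> {1..n} \<Longrightarrow> r \<notin> L \<Longrightarrow> lookup \<eta> r \<noteq> carried L \<eta> r"
  using max by (simp add: maximal_set_iff)

abbreviation "lam \<equiv> cop L \<eta>"

abbreviation "reach r \<equiv> {h \<in> {1..n}. h \<le> r \<and> carried L \<eta> r \<le> lookup \<eta> h \<or> r < h \<and> carried L \<eta> r < lookup \<eta> h}"

text \<open>The spectral value of the travelling entry when it passes row \<open>r\<close>, counted as if that
  entry sat between rows \<open>r\<close> and \<open>r + 1\<close>; maximality makes the count insensitive to where it came from.\<close>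

lemma carried_spectral_eq:
  assumes r: "r \<in> {1..n}"
  shows "carried_spectral n L \<eta> r = alpha * of_nat (carried L \<eta> r) - of_nat (card (reach r))"
proof (cases "\<exists>q\<in>L. r < q")
  case True
  define q where "q = Min {q \<in> L. r < q}"
  have "q \<in> {q \<in> L. r < q}" unfolding q_def by (rule Min_in) (use L True in auto)
  then have q: "q \<in> L" "r < q" by auto
  have q_le: "q \<le> h" if "h \<in> L" "r < h" for h
    unfolding q_def using that L by (intro Min_le) auto
  have cv: "carried L \<eta> r = lookup \<eta> q" "carried_spectral n L \<eta> r = spectral n \<eta> q"
    using True by (simp_all add: carried_def carried_spectral_def carry_def q_def)
  have ne: "lookup \<eta> h \<noteq> lookup \<eta> q" if h: "r < h" "h < q" for h
  proof -
    have "h \<notin> L" using q_le h by force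
    moreover have "Min {q' \<in> L. h < q'} = q" using q q_le h L(3) by (intro Min_eqI) auto
    then have "carried L \<eta> h = lookup \<eta> q" using q h by (auto simp: carried_def carry_def)
    moreover have "h \<in> {1..n}" using h q L(1) by auto
    ultimately show ?thesis using avoid by metis
  qed
  have "{h \<in> {1..n}. beats \<eta> h q} = reach r"
  proof (rule set_eqI)
    fix h
    consider "h \<le> r" | "r < h" "h < q" | "h = q" | "q < h" by linarith
    then show "h \<in> {h \<in> {1..n}. beats \<eta> h q} \<longleftrightarrow> h \<in> reach r"
      using q ne[of h] by cases (auto simp: beats_def cv)
  qed
  then show ?thesis by (simp add: cv(2) spectral_def leg'_eq_card cv(1))
next
  case False
  define p where "p = Min L"
  have p: "p \<in> L" unfolding p_def using L by (intro Min_in) auto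
  have pr: "p \<le> r" using p False by force
  have p_le: "p \<le> h" if "h \<in> L" for h unfolding p_def using that L by (intro Min_le) auto
  have cv: "carried L \<eta> r = lookup \<eta> p + 1" "carried_spectral n L \<eta> r = spectral n \<eta> p + alpha"
    using False by (simp_all add: carried_def carried_spectral_def carry_def p_def)
  \<comment> \<open>Maximality excludes equality with \<eta> at p in rows before p, and, in
    \<open>ne2\<close>, with the raised value after r. This reconciles ranking by the old entry at p
    with counting by the raised one at r.\<close>
  have ne1: "lookup \<eta> h \<noteq> lookup \<eta> p" if h: "h \<in> {1..n}" "h < p" for h
  proof -
    have "h \<notin> L" using p_le h by force
    moreover have "{q \<in> L. h < q} = L" using p_le h by force
    then have "carried L \<eta> h = lookup \<eta> p" using h p by (auto simp: carried_def carry_def p_def)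
    ultimately show ?thesis using avoid h by metis
  qed
  have ne2: "lookup \<eta> h \<noteq> lookup \<eta> p + 1" if h: "h \<in> {1..n}" "r < h" for h
  proof -
    have "h \<notin> L" using False h by blast
    moreover have "carried L \<eta> h = lookup \<eta> p + 1" using h False by (auto simp: carried_def carry_def p_def)
    ultimately show ?thesis using avoid h by metis
  qed
  have "{h \<in> {1..n}. beats \<eta> h p} = reach r"
  proof (rule set_eqI)
    fix h
    consider "h < p" | "h = p" | "p < h" "h \<le> r" | "r < h" by linarith
    then show "h \<in> {h \<in> {1..n}. beats \<eta> h p} \<longleftrightarrow> h \<in> reach r"
    proof cases
      case 1 then show ?thesis using ne1[of h] pr by (auto simp: beats_def cv)
    next
      case 4 then show ?thesis using ne2[of h] pr by (auto simp: beats_def cv)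
    qed (use pr in \<open>auto simp: beats_def cv\<close>)
  qed
  then show ?thesis by (simp add: cv(2) spectral_def leg'_eq_card cv(1) algebra_simps)
qed

lemma delta_eq:
  assumes "r \<in> {1..n}"
  shows "spectral n \<eta> r - carried_spectral n L \<eta> r = alpha * (of_nat (lookup \<eta> r) - of_nat (carried L \<eta> r))
    + (of_nat (card (reach r)) - of_nat (card {h \<in> {1..n}. beats \<eta> h r}))"
  by (simp add: carried_spectral_eq[OF assms] spectral_def leg'_eq_card algebra_simps)

text \<open>Row r itself is the only row counted by \<open>reach r\<close> that is not ahead of it.
  So a stop between equal entries has factor 1, and no arrow replaces anything.\<close>

lemma delta_equal:
  assumes "r \<in> {1..n}" "lookup \<eta> r = carried L \<eta> r"
  shows "spectral n \<eta> r - carried_spectral n L \<eta> r = 1"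
proof -
  have "reach r = insert r {h \<in> {1..n}. beats \<eta> h r}"
    using assms by (auto simp: beats_def)
  moreover have "r \<notin> {h \<in> {1..n}. beats \<eta> h r}" by (simp add: beats_def)
  ultimately show ?thesis using assms(2) by (simp add: delta_eq[OF assms(1)])
qed

text \<open>The rows of \<open>reach r\<close> not ahead of r are those of the leg, and r itself,
  which supplies the 1 of the upper hook.\<close>

lemma delta_upper:
  assumes "r \<in> {1..n}" "carried L \<eta> r < lookup \<eta> r"
  shows "spectral n \<eta> r - carried_spectral n L \<eta> r = upper_hook n \<eta> (r, carried L \<eta> r + 1)"
proof -
  let ?v = "carried L \<eta> r" and ?A = "{h \<in> {1..n}. beats \<eta> h r}"
  let ?D = "{h \<in> {1..n}. h < r \<and> ?v + 1 \<le> lookup \<eta> h + 1 \<and> lookup \<eta> h + 1 \<le> lookup \<eta> r}"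
  let ?D' = "{h \<in> {1..n}. h > r \<and> ?v + 1 \<le> lookup \<eta> h \<and> lookup \<eta> h \<le> lookup \<eta> r}"
  have "reach r = insert r (?A \<union> (?D \<union> ?D'))"
  proof (rule set_eqI)
    fix h
    consider "h < r" | "h = r" | "r < h" by linarith
    then show "h \<in> reach r \<longleftrightarrow> h \<in> insert r (?A \<union> (?D \<union> ?D'))"
      using assms by cases (auto simp: beats_def)
  qed
  moreover have "r \<notin> ?A \<union> (?D \<union> ?D')" by (auto simp: beats_def)
  moreover have "card (?A \<union> (?D \<union> ?D')) = card ?A + card (?D \<union> ?D')"
    by (rule card_Un_disjoint) (auto simp: beats_def)
  moreover have "card (?D \<union> ?D') = card ?D + card ?D'"
    by (rule card_Un_disjoint) auto
  ultimately have "card (reach r) = Suc (card ?A + leg n \<eta> (r, ?v + 1))"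
    by (simp add: leg_def)
  then show ?thesis
    using assms(2) by (simp add: delta_eq[OF assms(1)] upper_hook_def arm_def of_nat_diff)
qed

text \<open>Now the rows ahead of r but outside \<open>reach r\<close> form the leg, and r is in
  neither set, hence the lower hook. The box lies beyond row r of \<eta>, so it belongs to the
  target diagram.\<close>

lemma delta_lower:
  assumes "r \<in> L" "lookup \<eta> r < carried L \<eta> r"
  shows "spectral n \<eta> r - carried_spectral n L \<eta> r = - lower_hook n lam (r, lookup \<eta> r + 1)"
proof -
  have r: "r \<in> {1..n}" using assms L by auto
  let ?v = "carried L \<eta> r" and ?A = "{h \<in> {1..n}. beats \<eta> h r}"
  let ?g = "\<lambda>x. if lookup \<eta> r + 1 \<le> x \<and> x \<le> ?v then 1 else 0 :: int"
  let ?D = "{h \<in> {1..n}. h < r \<and> lookup \<eta> r + 1 \<le> lookup \<eta> h + 1 \<and> lookup \<eta> h + 1 \<le> ?v}"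
  let ?D' = "{h \<in> {1..n}. r < h \<and> lookup \<eta> r + 1 \<le> lookup \<eta> h \<and> lookup \<eta> h \<le> ?v}"
  have lam: "lookup lam r = ?v" using assms(1) by (simp add: lookup_cop[OF L(1,2)])
  have "int (leg n lam (r, lookup \<eta> r + 1)) = side_sum n lam r ?g"
    by (simp add: leg_eq_side_sum lam)
  \<comment> \<open>The correction terms at the two ends of the interval are both 1 and
    cancel.\<close>
  also have "\<dots> = side_sum n \<eta> r ?g"
    using side_sum_cop[OF L(1,2) r, of \<eta> ?g] assms(2) by (simp add: lam)
  also have "\<dots> = int (card ?D + card ?D')"
    using card_sides[of n r "\<lambda>x. lookup \<eta> r + 1 \<le> x \<and> x \<le> ?v" \<eta>] by simp
  finally have leg: "leg n lam (r, lookup \<eta> r + 1) = card ?D + card ?D'" by simp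
  have "?A = reach r \<union> (?D \<union> ?D')"
  proof (rule set_eqI)
    fix h
    consider "h < r" | "h = r" | "r < h" by linarith
    then show "h \<in> ?A \<longleftrightarrow> h \<in> reach r \<union> (?D \<union> ?D')"
      using assms(2) by cases (auto simp: beats_def)
  qed
  moreover have "card (reach r \<union> (?D \<union> ?D')) = card (reach r) + card (?D \<union> ?D')"
    by (rule card_Un_disjoint) auto
  moreover have "card (?D \<union> ?D') = card ?D + card ?D'"
    by (rule card_Un_disjoint) auto
  ultimately have "card ?A = card (reach r) + leg n lam (r, lookup \<eta> r + 1)"
    unfolding leg by simp
  then show ?thesis
    using assms(2)
    by (simp add: delta_eq[OF r] lower_hook_def upper_hook_def arm_def lam of_nat_diff algebra_simps)
qed

text \<open>The legs differ by the jump of an interval indicator at the passing entry. The jump at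
  the upper end would need that entry to equal row r, which maximality forbids.\<close>

lemma leg_cop:
  assumes "r \<in> {1..n}" "r \<notin> L" "1 \<le> j" "j \<le> lookup \<eta> r"
  shows "leg n lam (r, j) = leg n \<eta> (r, j) + (if j = carried L \<eta> r + 1 then 1 else 0)"
proof -
  have lam: "lookup lam r = lookup \<eta> r" using assms(2) by (simp add: lookup_cop[OF L(1,2)])
  define g :: "nat \<Rightarrow> int" where "g x = (if j \<le> x \<and> x \<le> lookup \<eta> r then 1 else 0)" for x
  have legs: "int (leg n \<gamma> (r, j)) = side_sum n \<gamma> r g" if "lookup \<gamma> r = lookup \<eta> r" for \<gamma>
    unfolding leg_eq_side_sum that g_def[abs_def] ..
  have "g (carried L \<eta> r + 1) = g (carried L \<eta> r) + (if j = carried L \<eta> r + 1 then 1 else 0)"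
    using avoid[OF assms(1,2)] assms(4) by (auto simp: g_def)
  then have "int (leg n lam (r, j)) = int (leg n \<eta> (r, j)) + (if j = carried L \<eta> r + 1 then 1 else 0)"
    using side_sum_cop[OF L(1,2) assms(1), of \<eta> g] by (simp add: legs lam)
  then show ?thesis by (simp split: if_splits)
qed

definition source_row :: "nat set \<Rightarrow> nat \<Rightarrow> qalpha" where
  "source_row K r = (\<Prod>j\<in>{1..lookup \<eta> r}. source_entry n \<eta> L K (r, j))"

definition target_row :: "nat set \<Rightarrow> nat \<Rightarrow> qalpha" where
  "target_row K r = (\<Prod>j\<in>{1..lookup lam r}. target_entry n \<eta> L K (r, j))"

definition upper_row :: "nat \<Rightarrow> qalpha" where
  "upper_row r = (\<Prod>j\<in>{1..lookup \<eta> r}. upper_hook n \<eta> (r, j))"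

definition lower_row :: "nat \<Rightarrow> qalpha" where
  "lower_row r = (\<Prod>j\<in>{1..lookup lam r}. lower_hook n lam (r, j))"

lemma row_suppressed:
  assumes "r \<in> L"
  shows "source_row {r} r * target_row {r} r = upper_row r * lower_row r"
  using assms by (simp add: source_row_def target_row_def upper_row_def lower_row_def source_entry_def target_entry_def)

text \<open>A replacement divides the row product by the replaced hook, which is the spectral
  difference up to sign; the entry -1 in the target absorbs the sign of
  \<open>delta_lower\<close>.\<close>

lemma row_inside:
  assumes r: "r \<in> L" "r \<notin> K"
  shows "source_row K r * target_row K r = upper_row r * lower_row r * row_factor n L \<eta> r"
proof -
  have rn: "r \<in> {1..n}" using r L by auto
  have lam: "lookup lam r = carried L \<eta> r" using r by (simp add: lookup_cop[OF L(1,2)])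
  note defs = source_row_def target_row_def upper_row_def lower_row_def source_entry_def target_entry_def
  consider "lookup \<eta> r = carried L \<eta> r" | "carried L \<eta> r < lookup \<eta> r" | "lookup \<eta> r < carried L \<eta> r" by linarith
  then show ?thesis
  proof cases
    case 1
    then show ?thesis using r by (simp add: defs lam row_factor_def delta_equal[OF rn 1] Let_def)
  next
    case 2
    have "source_row K r = (\<Prod>j\<in>{1..lookup \<eta> r}. if j = carried L \<eta> r + 1 then 1 else upper_hook n \<eta> (r, j))"
      using r 2 by (simp add: source_row_def source_entry_def lam)
    also have "\<dots> = upper_row r * (1 / upper_hook n \<eta> (r, carried L \<eta> r + 1))"
      unfolding upper_row_def using 2 by (intro prod_replace upper_hook_nonzero) auto
    finally have "source_row K r = upper_row r * row_factor n L \<eta> r"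
      using r by (simp only: row_factor_def delta_upper[OF rn 2] Let_def if_True inverse_eq_divide)
    moreover have "target_row K r = lower_row r"
      using r 2 by (simp add: target_row_def target_entry_def lower_row_def lam)
    ultimately show ?thesis by simp
  next
    case 3
    have "target_row K r = (\<Prod>j\<in>{1..carried L \<eta> r}. if j = lookup \<eta> r + 1 then - 1 else lower_hook n lam (r, j))"
      using r 3 by (simp add: target_row_def target_entry_def lam)
    also have "\<dots> = lower_row r * (- 1 / lower_hook n lam (r, lookup \<eta> r + 1))"
      unfolding lower_row_def lam using 3 by (intro prod_replace lower_hook_nonzero) auto
    also have "- 1 / lower_hook n lam (r, lookup \<eta> r + 1) = row_factor n L \<eta> r"
      using r by (simp only: row_factor_def delta_lower[OF r(1) 3] Let_def if_True inverse_eq_divide)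
    finally have "target_row K r = lower_row r * row_factor n L \<eta> r" .
    moreover have "source_row K r = upper_row r"
      using r 3 by (simp add: source_row_def source_entry_def upper_row_def lam)
    ultimately show ?thesis by simp
  qed
qed

text \<open>The filling has lower hooks in the source and upper hooks in the target, compared here
  with the reverse. Boxes with equal legs agree crosswise; if a leg grows, its box yields (\<delta>
  - 1)(\<delta> + 1) against \<delta> squared.\<close>

lemma row_outside:
  assumes r: "r \<in> {1..n}" "r \<notin> L"
  shows "source_row K r * target_row K r = upper_row r * lower_row r * row_factor n L \<eta> r"
proof -
  let ?v = "carried L \<eta> r"
  have lam: "lookup lam r = lookup \<eta> r" using r by (simp add: lookup_cop[OF L(1,2)])
  define u w where "u j = upper_hook n \<eta> (r, j)" and "w j = lower_hook n lam (r, j)" for j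
  have arm: "arm lam (r, j) = arm \<eta> (r, j)" for j by (simp add: arm_def lam)
  have same: "lower_hook n \<eta> (r, j) = w j \<and> upper_hook n lam (r, j) = u j"
    if "j \<in> {1..lookup \<eta> r}" "j \<noteq> ?v + 1" for j
    using leg_cop[OF r, of j] that by (simp add: u_def w_def lower_hook_def upper_hook_def arm)
  have lhs: "source_row K r * target_row K r = (\<Prod>j\<in>{1..lookup \<eta> r}. lower_hook n \<eta> (r, j) * upper_hook n lam (r, j))"
    using r by (simp add: source_row_def target_row_def source_entry_def target_entry_def lam prod.distrib)
  have rhs: "upper_row r * lower_row r = (\<Prod>j\<in>{1..lookup \<eta> r}. u j * w j)"
    by (simp add: upper_row_def lower_row_def u_def w_def lam prod.distrib)
  have "lookup \<eta> r \<noteq> ?v" using avoid r by blast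
  then consider "lookup \<eta> r < ?v" | "?v < lookup \<eta> r" by linarith
  then show ?thesis
  proof cases
    case 1
    have "(\<Prod>j\<in>{1..lookup \<eta> r}. lower_hook n \<eta> (r, j) * upper_hook n lam (r, j)) = (\<Prod>j\<in>{1..lookup \<eta> r}. u j * w j)"
      using same 1 by (intro prod.cong) (auto simp: mult.commute)
    then show ?thesis using r 1 by (simp add: lhs rhs row_factor_def Let_def move_factor_def)
  next
    case 2
    define \<delta> where "\<delta> = u (?v + 1)"
    have a: "?v + 1 \<in> {1..lookup \<eta> r}" using 2 by auto
    have leg: "leg n lam (r, ?v + 1) = leg n \<eta> (r, ?v + 1) + 1" using leg_cop[OF r, of "?v + 1"] 2 by simp
    have d: "lower_hook n \<eta> (r, ?v + 1) = \<delta> - 1" "upper_hook n lam (r, ?v + 1) = \<delta> + 1" "w (?v + 1) = \<delta>"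
      unfolding \<delta>_def u_def w_def lower_hook_def upper_hook_def arm leg by simp_all
    have nz: "\<delta> \<noteq> 0" by (simp add: \<delta>_def u_def upper_hook_nonzero)
    have "row_factor n L \<eta> r = 1 - (inverse \<delta>)\<^sup>2"
      using r 2 unfolding row_factor_def delta_upper[OF r(1) 2] by (simp add: Let_def move_factor_def \<delta>_def u_def)
    then have f: "(\<delta> - 1) * (\<delta> + 1) = \<delta> * \<delta> * row_factor n L \<eta> r"
      using nz by (simp add: field_simps power2_eq_square)
    have "(\<Prod>j\<in>{1..lookup \<eta> r} - {?v + 1}. lower_hook n \<eta> (r, j) * upper_hook n lam (r, j))
        = (\<Prod>j\<in>{1..lookup \<eta> r} - {?v + 1}. u j * w j)"
      using same by (intro prod.cong) (auto simp: mult.commute)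
    then show ?thesis
      unfolding lhs rhs prod.remove[OF finite_atLeastAtMost a] d f \<delta>_def[symmetric] by simp
  qed
qed

text \<open>Row i carries no row factor, in accordance with its suppressed replacement.\<close>

lemma jeu_except_eq:
  assumes i: "i \<in> L"
  shows "jeu_except n \<eta> L i
    = upper_hooks n \<eta> * (\<Prod>r\<in>{1..n} - {i}. row_factor n L \<eta> r) * lower_hooks n lam"
proof -
  have iN: "i \<in> {1..n}" using i L by auto
  have Sigma: "(\<Prod>s\<in>diagram n \<gamma>. f s) = (\<Prod>r\<in>{1..n}. \<Prod>j\<in>{1..lookup \<gamma> r}. f (r, j))" for \<gamma> and f :: "nat \<times> nat \<Rightarrow> qalpha"
    unfolding diagram_def by (subst prod.Sigma) (auto intro!: prod.cong)
  have "jeu_except n \<eta> L i = (\<Prod>r\<in>{1..n}. source_row {i} r * target_row {i} r)"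
    by (simp add: jeu_except_def jeu_def Sigma source_row_def target_row_def prod.distrib)
  also have "\<dots> = upper_row i * lower_row i * (\<Prod>r\<in>{1..n} - {i}. source_row {i} r * target_row {i} r)"
    using row_suppressed[OF i] by (subst prod.remove[OF _ iN]) simp_all
  also have "(\<Prod>r\<in>{1..n} - {i}. source_row {i} r * target_row {i} r)
      = (\<Prod>r\<in>{1..n} - {i}. upper_row r * lower_row r * row_factor n L \<eta> r)"
  proof (rule prod.cong[OF refl])
    fix r assume "r \<in> {1..n} - {i}"
    then show "source_row {i} r * target_row {i} r = upper_row r * lower_row r * row_factor n L \<eta> r"
      using row_inside[of r "{i}"] row_outside[of r "{i}"] by (cases "r \<in> L") auto
  qed
  also have "upper_row i * lower_row i * \<dots>
      = (\<Prod>r\<in>{1..n}. upper_row r * lower_row r) * (\<Prod>r\<in>{1..n} - {i}. row_factor n L \<eta> r)"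
    by (subst prod.remove[OF _ iN]) (simp_all add: prod.distrib)
  also have "(\<Prod>r\<in>{1..n}. upper_row r * lower_row r) = upper_hooks n \<eta> * lower_hooks n lam"
    by (simp add: upper_hooks_def lower_hooks_def Sigma upper_row_def lower_row_def prod.distrib)
  finally show ?thesis by (simp add: ac_simps)
qed

end

text \<open>Comparing \<open>\<Sum>h. x\<^sub>h\<^sup>2\<close> for \<open>\<eta>\<close> and \<open>c\<^sub>L(\<eta>)\<close> determines \<open>\<eta>\<close> at \<open>j\<^sub>1\<close>. From then on
  \<open>L\<close> can be read off upwards from row 1: by maximality a row belongs to \<open>L\<close> exactly when it equals
  the entry travelling past it, and then \<open>c\<^sub>L(\<eta>)\<close> tells which entry arrives there.\<close>

lemma cop_inject:
  assumes "maximal_set n \<eta> L" "maximal_set n \<eta> L'" "cop L \<eta> = cop L' \<eta>"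
  shows "L = L'"
proof -
  interpret M: maximal n \<eta> L by unfold_locales (rule assms(1))
  interpret M': maximal n \<eta> L' by unfold_locales (rule assms(2))
  \<comment> \<open>The difference is 2 v + 1 with v the entry at the first element, so it
    determines v.\<close>
  have "int (lookup \<eta> (Min L) + 1)^2 - int (lookup \<eta> (Min L))^2
      = int (lookup \<eta> (Min L') + 1)^2 - int (lookup \<eta> (Min L'))^2"
    using sum_cop[OF M.L(1,2), of "\<lambda>x. int x ^ 2" \<eta>] sum_cop[OF M'.L(1,2), of "\<lambda>x. int x ^ 2" \<eta>] assms(3)
    by simp
  then have min: "lookup \<eta> (Min L) = lookup \<eta> (Min L')"
    by (simp add: power2_eq_square algebra_simps)
  have "carried L \<eta> r = carried L' \<eta> r \<and> L \<inter> {..r} = L' \<inter> {..r}" if "r \<le> n" for r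
    using that
  proof (induction r)
    case 0
    have "L \<inter> {..0} = {}" "L' \<inter> {..0} = {}" using M.L(1) M'.L(1) by auto
    then show ?case using carried_0[OF M.L(1,2), of \<eta>] carried_0[OF M'.L(1,2), of \<eta>] min by simp
  next
    case (Suc r)
    then have cv: "carried L \<eta> r = carried L' \<eta> r" and le: "L \<inter> {..r} = L' \<inter> {..r}" and rn: "Suc r \<in> {1..n}" by auto
    have mem: "Suc r \<in> L \<longleftrightarrow> Suc r \<in> L'"
      using cv M.avoid[OF rn] M'.avoid[OF rn] carried_in[OF M.L(3), of r \<eta>] carried_in[OF M'.L(3), of r \<eta>]
        carried_notin[of r L \<eta>] carried_notin[of r L' \<eta>] by metis
    have "carried L \<eta> (Suc r) = carried L' \<eta> (Suc r)"
    proof (cases "Suc r \<in> L")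
      case True
      then show ?thesis
        using lookup_cop[OF M.L(1,2), of \<eta> "Suc r"] lookup_cop[OF M'.L(1,2), of \<eta> "Suc r"] mem assms(3) by simp
    next
      case False
      then show ?thesis using carried_notin[of r L \<eta>] carried_notin[of r L' \<eta>] mem cv by simp
    qed
    moreover have "L \<inter> {..Suc r} = L' \<inter> {..Suc r}"
      using le mem by (auto simp: atMost_Suc)
    ultimately show ?case by blast
  qed
  moreover have "L \<inter> {..n} = L" "L' \<inter> {..n} = L'" using M.L(1) M'.L(1) by auto
  ultimately show ?thesis by (metis order.refl)
qed

section \<open>The Pieri formula\<close>

lemma eps_compositions: "k \<in> {1..n} \<Longrightarrow> eps k \<in> compositions n"
  by (auto simp: compositions_iff lookup_eps)

lemma rot_exp_0: "1 \<le> n \<Longrightarrow> rot_exp n 0 = eps n"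
  by (rule poly_mapping_eqI)
    (simp add: rot_exp_def lookup_add lookup_map_key bij_rot bij_imp_bij_inv bij_is_inj)

text \<open>Descending induction from \<open>raise n 1\<close>, which is \<open>Var n\<close>; each
  exchange moves the entry 1 one row up the diagram, towards row 1.\<close>

lemma jackE_eps:
  assumes "1 \<le> k" "k \<le> n"
  shows "jackE n (eps k) = Var k + Const (inverse (alpha + of_nat k)) * (\<Sum>i\<in>{k<..n}. Var i)"
  using assms(2,1)
proof (induction k rule: inc_induct)
  case base
  then have n: "1 \<le> n" by simp
  have 0: "(0 :: expvec) \<in> compositions n" by (simp add: compositions_iff)
  have "jackE n 0 = 1" by (rule jackE_eqI[OF n 0 is_jack_0])
  then have "jackE n (eps n) = raise n 1"
    using raise_jackE[OF n 0] rot_exp_0[OF n] by simp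
  also have "act (rot n) 1 = 1"
    using act_Const[OF bij_rot[OF n], of 1] by simp
  then have "raise n 1 = Var n" by (simp add: raise_def)
  finally show ?case by simp
next
  case (step k)
  define a b where "a = inverse (alpha + of_nat k)" and "b = inverse (alpha + of_nat (Suc k))"
  define \<Sigma> where "\<Sigma> = (\<Sum>i\<in>{Suc k<..n}. Var i)"
  have IH: "jackE n (eps (Suc k)) = Var (Suc k) + Const b * \<Sigma>"
    using step by (simp add: b_def \<Sigma>_def)
  have e: "eps (Suc k) \<in> compositions n" using step by (intro eps_compositions) auto
  have "{h \<in> {1..n}. beats (eps (Suc k)) h k} = insert (Suc k) {1..<k}"
    using step by (auto simp: beats_def lookup_eps)
  then have "leg' n (eps (Suc k)) k = k"
    using step by (simp add: leg'_eq_card)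
  moreover have "{h \<in> {1..n}. beats (eps (Suc k)) h (Suc k)} = {}"
    by (auto simp: beats_def lookup_eps)
  then have "leg' n (eps (Suc k)) (Suc k) = 0"
    unfolding leg'_eq_card by simp
  ultimately have \<delta>: "spectral n (eps (Suc k)) k - spectral n (eps (Suc k)) (Suc k) = - (alpha + of_nat k)"
    by (simp add: spectral_def lookup_eps)
  have sw: "swap_exp k (eps (Suc k)) = eps k"
    by (rule poly_mapping_eqI) (auto simp: lookup_swap_exp lookup_eps transpose_def)
  have "act (transpose k (Suc k)) (jackE n (eps (Suc k))) = Const (- a) * jackE n (eps (Suc k)) + jackE n (eps k)"
  proof -
    have "inverse (- (alpha + of_nat k)) = - a"
      unfolding a_def by (rule inverse_minus_eq)
    moreover have "move_factor (lookup (eps (Suc k)) k) (lookup (eps (Suc k)) (Suc k)) d = 1" for d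
      by (simp add: move_factor_def lookup_eps)
    ultimately show ?thesis
      using act_swap_jackE[OF step(4,2) e] unfolding \<delta> sw by simp
  qed
  moreover have "act (transpose k (Suc k)) (jackE n (eps (Suc k))) = Var k + Const b * \<Sigma>"
  proof -
    have lin: "linear_op (act (transpose k (Suc k)))" by (simp add: linear_op_act)
    have "act (transpose k (Suc k)) \<Sigma> = \<Sigma>"
      unfolding \<Sigma>_def linear_op_sum[OF lin] by (intro sum.cong) (auto simp: act_Var transpose_apply_other)
    then show ?thesis
      unfolding IH linear_op_add[OF lin] linear_op_scale[OF lin] by (simp add: act_Var)
  qed
  ultimately have "jackE n (eps k) = Var k + Const b * \<Sigma> + Const a * (Var (Suc k) + Const b * \<Sigma>)"
    by (simp add: IH Const_uminus algebra_simps)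
  also have "\<dots> = Var k + (Const a * Var (Suc k) + Const (b + a * b) * \<Sigma>)"
    by (simp add: Const_add Const_mult algebra_simps)
  \<comment> \<open>The denominators of a and b differ by 1.\<close>
  also have "b + a * b = a"
  proof -
    have "alpha + of_nat k \<noteq> 0" "alpha + of_nat (Suc k) \<noteq> 0"
      using alpha_affine_nat_nonzero[of 1 k] alpha_affine_nat_nonzero[of 1 "Suc k"] by simp_all
    then have ab: "a * (alpha + of_nat k) = 1" "b * (alpha + of_nat (Suc k)) = 1"
      by (simp_all add: a_def b_def)
    have "a = a * (b * (alpha + of_nat (Suc k)))" by (simp only: ab mult_1_right)
    also have "\<dots> = b * (a * (alpha + of_nat k)) + a * b" by (simp add: algebra_simps)
    finally show ?thesis by (simp only: ab mult_1_right)
  qed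
  also have "Const a * Var (Suc k) + Const a * \<Sigma> = Const a * (\<Sum>i\<in>{k<..n}. Var i)"
  proof -
    have "{k<..n} = insert (Suc k) {Suc k<..n}" using step by auto
    then show ?thesis by (simp add: \<Sigma>_def distrib_left)
  qed
  finally show ?case by (simp add: a_def)
qed

text \<open>The single box has leg k - 1, so its upper hook alpha + k clears the denominator of
  \<open>jackE_eps\<close>.\<close>

lemma jackF_eps:
  assumes "1 \<le> k" "k \<le> n"
  shows "jackF n (eps k) = Const (alpha + of_nat k) * Var k + (\<Sum>i\<in>{k<..n}. Var i)"
proof -
  have "diagram n (eps k) = {(k, 1)}"
    using assms by (auto simp: diagram_def lookup_eps split: if_splits)
  moreover have "{h \<in> {1..n}. h < k \<and> 1 \<le> lookup (eps k) h + 1 \<and> lookup (eps k) h + 1 \<le> lookup (eps k) k} = {1..<k}"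
    "{h \<in> {1..n}. h > k \<and> 1 \<le> lookup (eps k) h \<and> lookup (eps k) h \<le> lookup (eps k) k} = {}"
    using assms by (auto simp: lookup_eps)
  then have "leg n (eps k) (k, 1) = k - 1" by (simp only: leg_def prod.case) simp
  ultimately have u: "upper_hooks n (eps k) = alpha + of_nat k"
    using assms by (simp add: upper_hooks_def upper_hook_def arm_def lookup_eps of_nat_diff)
  have "alpha + of_nat k \<noteq> 0" using alpha_affine_nat_nonzero[of 1 k] by simp
  then show ?thesis
    by (simp add: jackF_def u jackE_eps[OF assms] distrib_left flip: mult.assoc Const_mult)
qed

text \<open>Extending by zero to i outside L puts all variables over one index set, so the sums over
  i and L can be interchanged. Non-maximal L are still included.\<close>

lemma pieri_expansion:
  assumes \<eta>: "\<eta> \<in> compositions n" and k: "1 \<le> k" "k \<le> n"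
  defines "P \<equiv> \<lambda>i L. if i \<in> L then upper_hooks n \<eta> * (\<Prod>r\<in>{1..n} - {i}. row_factor n L \<eta> r) else 0"
  shows "jackF n (eps k) * jackF n \<eta>
    = (\<Sum>L\<in>{L. L \<subseteq> {1..n} \<and> L \<noteq> {}}.
        Const ((alpha + of_nat k) * P k L + (\<Sum>i\<in>{k<..n}. P i L)) * jackE n (cop L \<eta>))"
proof -
  let ?I = "{L. L \<subseteq> {1..n} \<and> L \<noteq> {}}"
  have VarF: "Var i * jackF n \<eta> = (\<Sum>L\<in>?I. Const (P i L) * jackE n (cop L \<eta>))" if i: "i \<in> {1..n}" for i
  proof -
    have "Var i * jackF n \<eta> = Const (upper_hooks n \<eta>) * (Var i * jackE n \<eta>)"
      by (simp add: jackF_def mult.left_commute)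
    also have "\<dots> = (\<Sum>L\<in>{L. L \<subseteq> {1..n} \<and> i \<in> L}. Const (P i L) * jackE n (cop L \<eta>))"
      unfolding Var_mult_jackE[OF i \<eta>] sum_distrib_left
      by (rule sum.cong) (simp_all add: P_def Const_mult mult.assoc)
    also have "\<dots> = (\<Sum>L\<in>?I. Const (P i L) * jackE n (cop L \<eta>))"
      by (rule sum.mono_neutral_left) (auto simp: P_def)
    finally show ?thesis .
  qed
  have "jackF n (eps k) * jackF n \<eta> = Const (alpha + of_nat k) * (Var k * jackF n \<eta>)
      + (\<Sum>i\<in>{k<..n}. Var i * jackF n \<eta>)"
    by (simp add: jackF_eps[OF k] distrib_right sum_distrib_right mult.assoc)
  also have "(\<Sum>i\<in>{k<..n}. Var i * jackF n \<eta>) = (\<Sum>i\<in>{k<..n}. \<Sum>L\<in>?I. Const (P i L) * jackE n (cop L \<eta>))"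
    using k by (intro sum.cong[OF refl] VarF) auto
  also have "\<dots> = (\<Sum>L\<in>?I. Const (\<Sum>i\<in>{k<..n}. P i L) * jackE n (cop L \<eta>))"
    unfolding Const_sum sum_distrib_right by (rule sum.swap)
  also have "Var k * jackF n \<eta> = (\<Sum>L\<in>?I. Const (P k L) * jackE n (cop L \<eta>))"
    using k by (intro VarF) auto
  finally show ?thesis
    by (simp only: Const_add Const_mult distrib_right sum.distrib sum_distrib_left mult.assoc)
qed

text \<open>Some row outside L equals the entry passing it. It cannot be i, so its zero factor stays
  in the product.\<close>

lemma row_factor_nonmaximal:
  assumes "L \<subseteq> {1..n}" "L \<noteq> {}" "\<not> maximal_set n \<eta> L" "i \<in> L"
  shows "(\<Prod>r\<in>{1..n} - {i}. row_factor n L \<eta> r) = 0"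
proof -
  obtain r where r: "r \<in> {1..n}" "r \<notin> L" "lookup \<eta> r = carried L \<eta> r"
    using assms(1-3) unfolding maximal_set_iff by blast
  then have "row_factor n L \<eta> r = 0" by (simp add: row_factor_def Let_def move_factor_def)
  moreover have "r \<in> {1..n} - {i}" using r assms(4) by auto
  ultimately show ?thesis by (intro prod_zero) auto
qed

theorem theorem1p2:
  fixes n k :: nat and \<eta> :: expvec
  assumes "1 \<le> n" and "\<eta> \<in> compositions n" and "1 \<le> k" and "k \<le> n"
  shows "(\<forall>L. maximal_set n \<eta> L \<longrightarrow>
            lookup (pieri_coeff n k \<eta>) (cop L \<eta>) =
              (if k \<in> L then (alpha + of_nat k) * jeu_except n \<eta> L k else 0)
              + (\<Sum>i\<in>{i\<in>L. i > k}. jeu_except n \<eta> L i))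
       \<and> (\<forall>\<mu>\<in>compositions n. (\<nexists>L. maximal_set n \<eta> L \<and> \<mu> = cop L \<eta>) \<longrightarrow>
            lookup (pieri_coeff n k \<eta>) \<mu> = 0)"
proof -
  define P where "P i L = (if i \<in> L then upper_hooks n \<eta> * (\<Prod>r\<in>{1..n} - {i}. row_factor n L \<eta> r) else 0)" for i L
  define c where "c L = (alpha + of_nat k) * P k L + (\<Sum>i\<in>{k<..n}. P i L)" for L
  let ?I = "{L. L \<subseteq> {1..n} \<and> L \<noteq> {}}"
  have fin: "finite ?I" by (rule finite_subset[of _ "Pow {1..n}"]) auto
  have coeff: "lookup (pieri_coeff n k \<eta>) \<nu> = (\<Sum>L\<in>?I. if cop L \<eta> = \<nu> then c L * lower_hooks n \<nu> else 0)" for \<nu>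
  proof (rule lookup_pieri_coeff[OF assms(1)])
    show "finite ?I" by (rule fin)
    show "jackF n (eps k) * jackF n \<eta> = (\<Sum>L\<in>?I. Const (c L) * jackE n (cop L \<eta>))"
      using pieri_expansion[OF assms(2-4)] by (simp only: c_def P_def)
  qed (use assms(2) cop_compositions in auto)
  have nonmax: "c L = 0" if "L \<in> ?I" "\<not> maximal_set n \<eta> L" for L
  proof -
    have "P i L = 0" for i
      using row_factor_nonmaximal[of L n \<eta> i] that by (simp only: P_def) simp
    then show ?thesis by (simp add: c_def)
  qed
  have "lookup (pieri_coeff n k \<eta>) (cop L \<eta>) = (if k \<in> L then (alpha + of_nat k) * jeu_except n \<eta> L k else 0)
      + (\<Sum>i\<in>{i\<in>L. i > k}. jeu_except n \<eta> L i)" if M: "maximal_set n \<eta> L" for L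
  proof -
    interpret maximal n \<eta> L by unfold_locales (rule M)
    \<comment> \<open>Other maximal sets have other images, and non-maximal sets with the same image
      carry the coefficient zero.\<close>
    have "lookup (pieri_coeff n k \<eta>) (cop L \<eta>) = (\<Sum>L'\<in>?I. if L' = L then c L * lower_hooks n lam else 0)"
      unfolding coeff
    proof (rule sum.cong[OF refl])
      fix L' assume "L' \<in> ?I"
      then show "(if cop L' \<eta> = lam then c L' * lower_hooks n lam else 0) = (if L' = L then c L * lower_hooks n lam else 0)"
        using nonmax[of L'] cop_inject[OF _ M, of L'] by auto
    qed
    also have "\<dots> = c L * lower_hooks n lam"
      using L(1,2) fin by (simp add: sum.delta)
    also have "\<dots> = (alpha + of_nat k) * (P k L * lower_hooks n lam) + (\<Sum>i\<in>{k<..n}. P i L * lower_hooks n lam)"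
      by (simp add: c_def distrib_right sum_distrib_right mult.assoc)
    also have "(\<Sum>i\<in>{k<..n}. P i L * lower_hooks n lam) = (\<Sum>i\<in>{i\<in>L. i > k}. P i L * lower_hooks n lam)"
      using L(1) by (intro sum.mono_neutral_right) (auto simp: P_def)
    also have "\<dots> = (\<Sum>i\<in>{i\<in>L. i > k}. jeu_except n \<eta> L i)"
      by (rule sum.cong) (simp_all add: P_def jeu_except_eq)
    finally show ?thesis by (simp add: P_def jeu_except_eq)
  qed
  moreover have "lookup (pieri_coeff n k \<eta>) \<mu> = 0" if "\<nexists>L. maximal_set n \<eta> L \<and> \<mu> = cop L \<eta>" for \<mu>
    unfolding coeff using that nonmax by (intro sum.neutral) auto
  ultimately show ?thesis by blast
qed

end
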